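(* There is a deterministic algorithm that, given any directed graph $G$ on $n$ vertices, computes $\oplus\mathscr H$ (the parity of the number of directed Hamiltonian cycles of $G$) in time within a polynomial factor (in $n$) of the $n$th Fibonacci number $F_n$, where $F_n\in O(1.619^n)$, using polynomial space.
   Context: For a directed graph $G=(V,E)$, $\mathscr H$ denotes the set of directed Hamiltonian cycles of $G$ (directed cycles visiting every vertex exactly once), and $\oplus\mathscr H = |\mathscr H| \bmod 2$. $F_n$ is the $n$th Fibonacci number ($F_0=0$, $F_1=1$, $F_{n}=F_{n-1}+F_{n-2}$). *)

theory Defs
  imports
    "Graph_Theory.Pair_Digraph"
    "HOL-Computational_Algebra.Polynomial"
    "HOL-Library.Landau_Symbols"
    "HOL-Library.Log_Nat"
    "HOL-Number_Theory.Fib"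
begin

text \<open>
  A Hamiltonian cycle is represented by its set of arcs, so that the arc walks traversing one
  cycle from different starting vertices are counted once. In the library, \<open>cycle\<close> means a
  nonempty closed arc walk without repeated vertices; two-cycles and loops are cycles. Loops
  matter only on a single vertex.
\<close>

definition hamiltonian_cycles :: "'a pair_pre_digraph \<Rightarrow> ('a \<times> 'a) set set" where
  "hamiltonian_cycles G =
     {set p | p. pre_digraph.cycle (with_proj G) p \<and> fst ` set p = pverts G}"


text \<open>
  The model of computation is the random access machine of Cook and Reckhow (Time bounded random
  access machines, 1973) with logarithmic cost, over natural numbers and with truncated
  subtraction. All register and jump operands in instructions are constants of the program.
\<close>

datatype instr =
    Const nat nat      \<comment> \<open>\<open>R\<^sub>i := c\<close>\<close>
  | Add nat nat nat    \<comment> \<open>\<open>R\<^sub>i := R\<^sub>j + R\<^sub>k\<close>\<close>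
  | Sub nat nat nat    \<comment> \<open>\<open>R\<^sub>i := R\<^sub>j - R\<^sub>k\<close>\<close>
  | Load nat nat       \<comment> \<open>\<open>R\<^sub>i := R\<close> at address \<open>R\<^sub>j\<close>\<close>
  | Store nat nat      \<comment> \<open>\<open>R\<close> at address \<open>R\<^sub>i := R\<^sub>j\<close>\<close>
  | JumpPos nat nat    \<comment> \<open>continue at instruction \<open>m\<close> if \<open>R\<^sub>j > 0\<close>\<close>
  | Read nat           \<comment> \<open>\<open>R\<^sub>i :=\<close> next input number, or \<open>0\<close> if there is none\<close>
  | Print nat          \<comment> \<open>append \<open>R\<^sub>i\<close> to the output\<close>

record config =
  pc :: nat
  mem :: "nat \<Rightarrow> nat"
  inp :: "nat list"
  out :: "nat list"

fun exec :: "instr \<Rightarrow> config \<Rightarrow> config" where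
  "exec (Const i c) s = s\<lparr>pc := Suc (pc s), mem := (mem s)(i := c)\<rparr>"
| "exec (Add i j k) s = s\<lparr>pc := Suc (pc s), mem := (mem s)(i := mem s j + mem s k)\<rparr>"
| "exec (Sub i j k) s = s\<lparr>pc := Suc (pc s), mem := (mem s)(i := mem s j - mem s k)\<rparr>"
| "exec (Load i j) s = s\<lparr>pc := Suc (pc s), mem := (mem s)(i := mem s (mem s j))\<rparr>"
| "exec (Store i j) s = s\<lparr>pc := Suc (pc s), mem := (mem s)(mem s i := mem s j)\<rparr>"
| "exec (JumpPos m j) s = s\<lparr>pc := if mem s j > 0 then m else Suc (pc s)\<rparr>"
| "exec (Read i) s = s\<lparr>pc := Suc (pc s),
     mem := (mem s)(i := (case inp s of [] \<Rightarrow> 0 | x # _ \<Rightarrow> x)), inp := tl (inp s)\<rparr>"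
| "exec (Print i) s = s\<lparr>pc := Suc (pc s), out := out s @ [mem s i]\<rparr>"

definition halted :: "instr list \<Rightarrow> config \<Rightarrow> bool" where
  "halted P s \<longleftrightarrow> length P \<le> pc s"

definition step :: "instr list \<Rightarrow> config \<Rightarrow> config" where
  "step P s = (if halted P s then s else exec (P ! pc s) s)"

definition run :: "instr list \<Rightarrow> nat list \<Rightarrow> nat \<Rightarrow> config" where
  "run P xs t = (step P ^^ t) \<lparr>pc = 0, mem = (\<lambda>_. 0), inp = xs, out = []\<rparr>"

text \<open>Length of the binary representation, where \<open>0\<close> has length \<open>1\<close>.\<close>

definition bitsize :: "nat \<Rightarrow> nat" where
  "bitsize x = max 1 (floorlog 2 x)"

fun instr_cost :: "instr \<Rightarrow> config \<Rightarrow> nat" where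
  "instr_cost (Const i c) s = bitsize c"
| "instr_cost (Add i j k) s = bitsize (mem s j) + bitsize (mem s k)"
| "instr_cost (Sub i j k) s = bitsize (mem s j) + bitsize (mem s k)"
| "instr_cost (Load i j) s = bitsize (mem s j) + bitsize (mem s (mem s j))"
| "instr_cost (Store i j) s = bitsize (mem s i) + bitsize (mem s j)"
| "instr_cost (JumpPos m j) s = bitsize (mem s j)"
| "instr_cost (Read i) s = bitsize (case inp s of [] \<Rightarrow> 0 | x # _ \<Rightarrow> x)"
| "instr_cost (Print i) s = bitsize (mem s i)"

definition time_used :: "instr list \<Rightarrow> nat list \<Rightarrow> nat \<Rightarrow> nat" where
  "time_used P xs t =
     (\<Sum>k<t. let s = run P xs k in if halted P s then 0 else instr_cost (P ! pc s) s)"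

text \<open>
  Every nonzero register is charged for its address and its content. The input (read-only,
  read once) and the output (write-only) are not charged. The sum is finite by the lemma below.
\<close>

definition mem_size :: "(nat \<Rightarrow> nat) \<Rightarrow> nat" where
  "mem_size R = (\<Sum>r | R r \<noteq> 0. bitsize r + bitsize (R r))"

definition space_used :: "instr list \<Rightarrow> nat list \<Rightarrow> nat \<Rightarrow> nat" where
  "space_used P xs t = (MAX k\<in>{..t}. mem_size (mem (run P xs k)))"

lemma finite_support_run: "finite {r. mem (run P xs t) r \<noteq> 0}"
proof (induction t)
  case 0
  then show ?case by (simp add: run_def)
next
  case (Suc t)
  have upd: "finite {r. (f(a := b)) r \<noteq> 0}" if "finite {r. f r \<noteq> 0}"
    for f :: "nat \<Rightarrow> nat" and a b
    by (rule finite_subset[of _ "insert a {r. f r \<noteq> 0}"]) (use that in auto)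
  have "finite {r. mem (exec i s) r \<noteq> 0}" if "finite {r. mem s r \<noteq> 0}" for i s
    using that by (cases i) (simp_all add: upd del: fun_upd_apply neq0_conv)
  then show ?case
    using Suc by (simp add: run_def step_def del: neq0_conv)
qed


text \<open>
  A digraph with vertices \<open>0, \<dots>, n - 1\<close> is input as \<open>n\<close> followed by its adjacency matrix,
  row by row.
\<close>

definition graph_input :: "nat \<Rightarrow> nat pair_pre_digraph \<Rightarrow> nat list" where
  "graph_input n G = n # [if (u, v) \<in> parcs G then 1 else 0. u \<leftarrow> [0..<n], v \<leftarrow> [0..<n]]"

end

theory Submission
  imports Defs "Jordan_Normal_Form.Determinant" "HOL-Combinatorics.Orbits" "HOL-Library.Z2"
begin

text \<open>
  Let \<open>A\<close> be the adjacency matrix over the two-element field. For a vector \<open>x\<close> and any shift \<open>\<rho>\<close> put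
  \<open>d = A x + \<rho>\<close> and let \<open>M\<^sub>x\<close> be \<open>diag d + A diag x\<close>, the second summand with column 0 erased.
  Expanding \<open>\<Sum>\<^sub>x det M\<^sub>x\<close> leaves the permutations \<open>r\<close> of the vertices along the arcs, each counted once
  for every \<open>r\<close>-invariant vertex set avoiding 0. There are \<open>2 ^ (c - 1)\<close> such sets when \<open>r\<close> has \<open>c\<close> cycles, so
  modulo 2 exactly the Hamiltonian cycles survive, whatever \<open>\<rho>\<close> is.

  Column \<open>v\<close> of \<open>M\<^sub>x\<close> vanishes if \<open>d\<^sub>v = 0\<close> and (\<open>v = 0\<close> or \<open>x\<^sub>v = 0\<close>). Hence a search tree that fixes
  \<open>x\<^sub>0, x\<^sub>1, \<dots>\<close> may discard each prefix whose affine system of forced equations \<open>d\<^sub>v = 1\<close> is unsolvable.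
  A prefix with \<open>2 ^ k\<close> solutions is given the weight \<open>fib (k + 2)\<close>. Averaged over the bit \<open>\<rho>\<^sub>t\<close>, the
  weights of the children of a prefix of length \<open>t\<close> add up to at most its own weight. Choosing the bits of \<open>\<rho>\<close>
  one after another so as to minimise the total weight of the next level (method of conditional
  expectations) therefore keeps every level at no more than \<open>fib (n + 2)\<close> nonempty nodes. Each choice
  and the final summation are depth-first searches that run a Gaussian elimination at every node,
  hence use polynomial space.
\<close>

section \<open>Summation over the cube modulo 2\<close>

text \<open>Erasing column 0 halves the number of invariant sets: with it there would be
  \<open>2 ^ c\<close> of them, an even number for every \<open>r\<close>, and the total would
  vanish. The shift drops out because summation over the cube keeps only the monomial containing
  every variable, and choosing a constant \<rho> i leaves some variable out.

  The shift serves the running time alone. For an unlucky system d_v may be constantly 1 on the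
  branch x_v = 0; both children then keep half the solutions, and a complete binary tree results.
  Suppose fixing x_v, v > 0, halves \<open>2 ^ k\<close> solutions. The branch x_v = 1 weighs
  \<open>fib (k + 1)\<close>. The branch x_v = 0 weighs \<open>fib k\<close> if d_v varies on it,
  which gives \<open>fib (k + 2)\<close> exactly; if d_v is constant there, the branch dies under
  one of the two shifts, and its mean weight, half of \<open>fib (k + 1)\<close>, is at most
  \<open>fib k\<close>. This recurrence is the origin of the weights.

  Bit t of \<rho> has no effect on prefixes of length at most t. Hence the bits can be fixed one by
  one, and each decision compares two traversals that stop at length t + 1.\<close>

lemma bit_add_self [simp]: "(a :: bit) + a = 0"
  by (cases a) auto

lemma bit_uminus [simp]: "- (a :: bit) = a"
  by (cases a) auto

text \<open>The involution has no fixed points, so the terms fall into pairs of equal value, which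
  cancel modulo 2. The vanishing of incomplete monomials and the parity of invariant sets are both
  obtained from this.\<close>

lemma sum_involution_bit:
  fixes f :: "'a \<Rightarrow> bit"
  assumes "finite A"
    and "\<And>x. x \<in> A \<Longrightarrow> h x \<in> A \<and> h x \<noteq> x \<and> h (h x) = x \<and> f (h x) = f x"
  shows "sum f A = 0"
  using assms
proof (induction "card A" arbitrary: A rule: less_induct)
  case less
  show ?case
  proof (cases "A = {}")
    case False
    then obtain x where x: "x \<in> A" by blast
    let ?B = "A - {x, h x}"
    have hx: "h x \<in> A" "h x \<noteq> x" "h (h x) = x" "f (h x) = f x" using less.prems(2)[OF x] by auto
    have "sum f ?B = 0"
    proof (rule less.hyps)
      show "card ?B < card A" using x less.prems(1) by (intro psubset_card_mono) auto
      show "finite ?B" using less.prems(1) by auto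
      fix y assume y: "y \<in> ?B"
      then have *: "h y \<in> A" "h y \<noteq> y" "h (h y) = y" "f (h y) = f y" using less.prems(2)[of y] by auto
      have "h y \<noteq> x" "h y \<noteq> h x" using y * hx by auto
      then show "h y \<in> ?B \<and> h y \<noteq> y \<and> h (h y) = y \<and> f (h y) = f y" using * by auto
    qed
    moreover have "sum f A = sum f {x, h x} + sum f ?B"
      using x hx(1) less.prems(1) by (metis add.commute empty_subsetI insert_subset sum.subset_diff)
    ultimately show ?thesis using hx by simp
  qed simp
qed

lemma prod_add_eq_sum_Pow:
  fixes f g :: "'a \<Rightarrow> 'b::comm_semiring_1"
  assumes "finite A"
  shows "(\<Prod>i\<in>A. f i + g i) = (\<Sum>T\<in>Pow A. (\<Prod>i\<in>T. f i) * (\<Prod>i\<in>A - T. g i))"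
  using assms
proof (induction A)
  case (insert a A)
  have inj: "inj_on (insert a) (Pow A)" using insert(2) by (auto simp: inj_on_def)
  have disj: "Pow A \<inter> insert a ` Pow A = {}" using insert(2) by auto
  have 1: "(\<Prod>i\<in>insert a T. f i) * (\<Prod>i\<in>A - T. g i)
      = f a * ((\<Prod>i\<in>T. f i) * (\<Prod>i\<in>A - T. g i))" if "T \<in> Pow A" for T
  proof -
    have "a \<notin> T" using that insert by auto
    then show ?thesis using that insert by (simp add: finite_subset mult.assoc)
  qed
  have 2: "(\<Prod>i\<in>T. f i) * (\<Prod>i\<in>insert a A - T. g i)
      = g a * ((\<Prod>i\<in>T. f i) * (\<Prod>i\<in>A - T. g i))" if "T \<in> Pow A" for T
  proof -
    have "insert a A - T = insert a (A - T)" "a \<notin> T" using that insert by auto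
    then show ?thesis using that insert by (simp add: finite_subset mult_ac)
  qed
  show ?case
    using insert inj disj
    by (simp add: Pow_insert sum.union_disjoint sum.reindex 1 2 sum_distrib_left[symmetric] distrib_right add.commute)
qed simp

definition cube :: "nat \<Rightarrow> (nat \<Rightarrow> bit) set" where
  "cube n = {x. \<forall>i\<ge>n. x i = 0}"

lemma finite_cube [simp]: "finite (cube n)"
proof -
  have "cube n \<subseteq> (\<lambda>S i. if i \<in> S then 1 else 0) ` Pow {..<n}"
  proof
    fix x assume "x \<in> cube n"
    then have "x = (\<lambda>i. if i \<in> {i. x i = 1} then 1 else 0)" "{i. x i = 1} \<in> Pow {..<n}"
      by (auto simp: cube_def fun_eq_iff not_less[symmetric] intro: ccontr)
    then show "x \<in> (\<lambda>S i. if i \<in> S then 1 else 0) ` Pow {..<n}" by blast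
  qed
  then show ?thesis by (rule finite_subset) auto
qed

text \<open>Flipping a variable that is absent from the monomial cancels the sum; for the full
  monomial only the all-ones point contributes. Summation over the cube therefore reads off the
  coefficient of the full monomial.\<close>

lemma sum_cube_monomial:
  assumes "S \<subseteq> {..<n}"
  shows "(\<Sum>x\<in>cube n. \<Prod>i\<in>S. x i) = (if S = {..<n} then 1 else 0)"
proof (cases "S = {..<n}")
  case True
  let ?o = "\<lambda>i. if i < n then 1 else 0 :: bit"
  have o: "?o \<in> cube n" by (auto simp: cube_def)
  have "(\<Sum>x\<in>cube n. \<Prod>i\<in>S. x i) = (\<Sum>x\<in>{?o}. \<Prod>i\<in>S. x i)"
  proof (rule sum.mono_neutral_right)
    show "\<forall>x\<in>cube n - {?o}. (\<Prod>i\<in>S. x i) = 0"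
    proof
      fix x assume x: "x \<in> cube n - {?o}"
      then obtain i where "x i \<noteq> ?o i" by (auto simp: fun_eq_iff)
      then have "i < n" "x i = 0" using x by (auto simp: cube_def split: if_splits)
      then show "(\<Prod>i\<in>S. x i) = 0" using True by auto
    qed
  qed (use o in auto)
  then show ?thesis using True by simp
next
  case False
  then obtain j where j: "j < n" "j \<notin> S" using assms by auto
  have "(\<Sum>x\<in>cube n. \<Prod>i\<in>S. x i) = 0"
  proof (rule sum_involution_bit[where h = "\<lambda>x. x(j := x j + 1)"])
    fix x :: "nat \<Rightarrow> bit" assume x: "x \<in> cube n"
    have "(\<Prod>i\<in>S. (x(j := x j + 1)) i) = (\<Prod>i\<in>S. x i)"
      by (rule prod.cong) (use j in auto)
    moreover have "x(j := x j + 1) \<noteq> x" by (metis add_cancel_right_right bit_not_one_iff fun_upd_same zero_neq_one)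
    ultimately show "x(j := x j + 1) \<in> cube n \<and> x(j := x j + 1) \<noteq> x \<and>
      (x(j := x j + 1))(j := (x(j := x j + 1)) j + 1) = x \<and>
      (\<Prod>i\<in>S. (x(j := x j + 1)) i) = (\<Prod>i\<in>S. x i)"
      using x j by (auto simp: cube_def add.assoc)
  qed simp
  then show ?thesis using False by simp
qed

text \<open>Expanding the affine factors selects one summand for every index outside
  \<open>T\<close>. Only a selection that supplies all variables missing from the monomial of
  \<open>T\<close> survives, and since there are exactly as many factors as missing variables, it is
  a bijection onto them. No factor is left over for a constant, which is why \<rho>
  disappears.\<close>

lemma sum_cube_affine_product:
  fixes a :: "nat \<Rightarrow> nat \<Rightarrow> bit"
  assumes T: "T \<subseteq> {..<n}"
  shows "(\<Sum>x\<in>cube n. (\<Prod>i\<in>T. x i) * (\<Prod>i\<in>{..<n} - T. (\<Sum>v<n. a i v * x v) + \<rho> i))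
       = (\<Sum>q | q permutes ({..<n} - T). \<Prod>i\<in>{..<n} - T. a i (q i))"
proof -
  let ?U = "{..<n} - T"
  \<comment> \<open>Index \<open>n\<close> stands for the constant term, with the dummy value
    \<open>y x n = 1\<close>, so that each affine factor becomes one homogeneous sum over
    \<open>{..n}\<close>.\<close>
  define b where "b i w = (if w < n then a i w else \<rho> i)" for i w
  define y :: "(nat \<Rightarrow> bit) \<Rightarrow> nat \<Rightarrow> bit" where "y x w = (if w < n then x w else 1)" for x w
  define F where "F = Pi\<^sub>E ?U (\<lambda>_. {..n})"
  have finT: "finite T" using T finite_subset by blast
  have finF: "finite F" unfolding F_def by (intro finite_PiE) auto
  have lin: "(\<Sum>v<n. a i v * x v) + \<rho> i = (\<Sum>w\<in>{..n}. b i w * y x w)" for i x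
    unfolding lessThan_Suc_atMost[symmetric] by (simp add: b_def y_def)
  \<comment> \<open>Bits are idempotent, so a product of variables depends only on the set of their
    indices.\<close>
  have mono: "(\<Prod>i\<in>T. x i) * (\<Prod>i\<in>?U. y x (g i)) = (\<Prod>i\<in>(T \<union> g ` ?U) \<inter> {..<n}. x i)" for g and x :: "nat \<Rightarrow> bit"
  proof -
    have P: "(\<Prod>i\<in>S. f i) = (if \<forall>i\<in>S. f i = 1 then 1 else 0)" if "finite S" for S and f :: "nat \<Rightarrow> bit"
      using that by (induction S) auto
    show ?thesis using T finT by (auto simp: P y_def split: if_splits)
  qed
  have "(\<Sum>x\<in>cube n. (\<Prod>i\<in>T. x i) * (\<Prod>i\<in>?U. (\<Sum>v<n. a i v * x v) + \<rho> i))
     = (\<Sum>x\<in>cube n. \<Sum>g\<in>F. (\<Prod>i\<in>?U. b i (g i)) * (\<Prod>i\<in>(T \<union> g ` ?U) \<inter> {..<n}. x i))"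
  proof (rule sum.cong[OF refl])
    fix x :: "nat \<Rightarrow> bit"
    have "(\<Prod>i\<in>?U. \<Sum>w\<in>{..n}. b i w * y x w) = (\<Sum>g\<in>F. \<Prod>i\<in>?U. b i (g i) * y x (g i))"
      unfolding F_def by (rule prod_sum_PiE) auto
    then have "(\<Prod>i\<in>T. x i) * (\<Prod>i\<in>?U. (\<Sum>v<n. a i v * x v) + \<rho> i)
      = (\<Prod>i\<in>T. x i) * (\<Sum>g\<in>F. \<Prod>i\<in>?U. b i (g i) * y x (g i))"
      by (simp only: lin)
    also have "\<dots> = (\<Sum>g\<in>F. (\<Prod>i\<in>T. x i) * ((\<Prod>i\<in>?U. b i (g i)) * (\<Prod>i\<in>?U. y x (g i))))"
      by (simp only: sum_distrib_left prod.distrib)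
    also have "\<dots> = (\<Sum>g\<in>F. (\<Prod>i\<in>?U. b i (g i)) * (\<Prod>i\<in>(T \<union> g ` ?U) \<inter> {..<n}. x i))"
      by (intro sum.cong refl) (simp only: mono[symmetric] mult.left_commute)
    finally show "(\<Prod>i\<in>T. x i) * (\<Prod>i\<in>?U. (\<Sum>v<n. a i v * x v) + \<rho> i)
      = (\<Sum>g\<in>F. (\<Prod>i\<in>?U. b i (g i)) * (\<Prod>i\<in>(T \<union> g ` ?U) \<inter> {..<n}. x i))" .
  qed
  also have "\<dots> = (\<Sum>g\<in>F. (\<Prod>i\<in>?U. b i (g i)) * (\<Sum>x\<in>cube n. \<Prod>i\<in>(T \<union> g ` ?U) \<inter> {..<n}. x i))"
    unfolding sum_distrib_left by (rule sum.swap)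
  also have "\<dots> = (\<Sum>g\<in>F. if ?U \<subseteq> g ` ?U then (\<Prod>i\<in>?U. b i (g i)) else 0)"
  proof (rule sum.cong[OF refl])
    fix g assume "g \<in> F"
    have "(T \<union> g ` ?U) \<inter> {..<n} = {..<n} \<longleftrightarrow> ?U \<subseteq> g ` ?U" using T by blast
    then show "(\<Prod>i\<in>?U. b i (g i)) * (\<Sum>x\<in>cube n. \<Prod>i\<in>(T \<union> g ` ?U) \<inter> {..<n}. x i)
      = (if ?U \<subseteq> g ` ?U then (\<Prod>i\<in>?U. b i (g i)) else 0)"
      by (simp add: sum_cube_monomial)
  qed
  also have "\<dots> = (\<Sum>g\<in>{g \<in> F. ?U \<subseteq> g ` ?U}. \<Prod>i\<in>?U. b i (g i))"
    using finF by (simp add: sum.inter_filter)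
  also have "\<dots> = (\<Sum>q | q permutes ?U. \<Prod>i\<in>?U. a i (q i))"
  proof (rule sum.reindex_bij_witness[where j = "\<lambda>g i. if i \<in> ?U then g i else i" and i = "\<lambda>q. restrict q ?U"])
    fix g assume g: "g \<in> {g \<in> F. ?U \<subseteq> g ` ?U}"
    \<comment> \<open>The image of the finite set \<open>?U\<close> has at most as many elements as
      \<open>?U\<close>, so containing \<open>?U\<close> forces equality. This excludes both the
      dummy index \<open>n\<close> and indices in \<open>T\<close> as values.\<close>
    have gim: "g ` ?U = ?U" using g card_image_le[of ?U g] by (intro card_seteq[symmetric]) auto
    then have "inj_on g ?U" by (intro eq_card_imp_inj_on) auto
    then have "bij_betw g ?U ?U" using gim by (simp add: bij_betw_def)
    then have bij: "bij_betw (\<lambda>i. if i \<in> ?U then g i else i) ?U ?U" by (subst bij_betw_cong[of _ _ g]) auto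
    show "restrict (\<lambda>i. if i \<in> ?U then g i else i) ?U = g" using g unfolding F_def
      by (auto simp: PiE_def extensional_def fun_eq_iff)
    have "(\<lambda>i. if i \<in> ?U then g i else i) permutes ?U"
      by (rule bij_imp_permutes[OF bij]) (rule if_not_P)
    then show "(\<lambda>i. if i \<in> ?U then g i else i) \<in> {q. q permutes ?U}" by (simp only: mem_Collect_eq)
    have "g i \<in> ?U" if "i \<in> ?U" for i using gim that by blast
    then show "(\<Prod>i\<in>?U. a i (if i \<in> ?U then g i else i)) = (\<Prod>i\<in>?U. b i (g i))"
      by (intro prod.cong) (auto simp: b_def)
  next
    fix q assume "q \<in> {q. q permutes ?U}"
    then have q: "q permutes ?U" by simp
    show "(\<lambda>i. if i \<in> ?U then restrict q ?U i else i) = q" using q by (auto simp: fun_eq_iff permutes_not_in)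
    have "q i \<in> ?U" if "i \<in> ?U" for i using permutes_in_image[OF q] that by blast
    then have "restrict q ?U \<in> F" unfolding F_def by (auto simp: less_imp_le)
    moreover have "restrict q ?U ` ?U = ?U" using permutes_image[OF q] by auto
    ultimately show "restrict q ?U \<in> {g \<in> F. ?U \<subseteq> g ` ?U}" by auto
  qed
  finally show ?thesis .
qed

section \<open>Expansion of the summed determinants into permutations\<close>

lemma sum_permutes_split:
  fixes a :: "nat \<Rightarrow> nat \<Rightarrow> 'b::comm_semiring_1"
  assumes T: "T \<subseteq> V" and V: "finite V"
  shows "(\<Sum>p | p permutes T. \<Sum>q | q permutes (V - T). (\<Prod>i\<in>T. a i (p i)) * (\<Prod>i\<in>V - T. a i (q i)))
     = (\<Sum>r | r permutes V \<and> r ` T = T. \<Prod>i\<in>V. a i (r i))"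
  (is "?L = ?R")
proof -
  let ?r = "\<lambda>S r i. if i \<in> S then r i else i"
  let ?j = "\<lambda>pq i. if i \<in> T then fst pq i else snd pq i"
  have "?L = (\<Sum>pq\<in>{p. p permutes T} \<times> {q. q permutes (V - T)}.
      (\<Prod>i\<in>T. a i (fst pq i)) * (\<Prod>i\<in>V - T. a i (snd pq i)))"
    by (simp add: sum.cartesian_product case_prod_beta)
  also have "\<dots> = ?R"
  proof (rule sum.reindex_bij_witness[where i = "\<lambda>r. (?r T r, ?r (V - T) r)" and j = ?j])
    fix pq assume "pq \<in> {p. p permutes T} \<times> {q. q permutes (V - T)}"
    then obtain p q where pq: "pq = (p, q)" "p permutes T" "q permutes (V - T)" by auto
    have pT: "p ` T = T" and qT: "q ` (V - T) = V - T" using pq permutes_image by auto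
    have jT: "?j pq ` T = T" using pT pq by auto
    have jV: "?j pq ` (V - T) = V - T" using qT pq by auto
    have "inj_on p T" "inj_on q (V - T)" using pq permutes_inj_on by blast+
    then have "bij_betw (?j pq) T T" "bij_betw (?j pq) (V - T) (V - T)"
      using jT jV pq by (auto simp: bij_betw_def inj_on_def)
    then have "bij_betw (?j pq) (T \<union> (V - T)) (T \<union> (V - T))" by (rule bij_betw_combine) auto
    moreover have "T \<union> (V - T) = V" using T by auto
    ultimately have "?j pq permutes V" using T pq by (intro bij_imp_permutes) (auto simp: permutes_not_in)
    then show "?j pq \<in> {r. r permutes V \<and> r ` T = T}" using jT by simp
    show "(?r T (?j pq), ?r (V - T) (?j pq)) = pq" using pq T by (auto simp: fun_eq_iff permutes_not_in)
    have "(\<Prod>i\<in>V. a i (?j pq i)) = (\<Prod>i\<in>T. a i (?j pq i)) * (\<Prod>i\<in>V - T. a i (?j pq i))"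
      using T V by (simp add: mult.commute prod.subset_diff)
    then show "(\<Prod>i\<in>V. a i (?j pq i)) = (\<Prod>i\<in>T. a i (fst pq i)) * (\<Prod>i\<in>V - T. a i (snd pq i))"
      by simp
  next
    fix r assume "r \<in> {r. r permutes V \<and> r ` T = T}"
    then have r: "r permutes V" "r ` T = T" by auto
    have rV: "r ` (V - T) = V - T"
      using r T by (metis image_set_diff permutes_image permutes_inj)
    have inj: "inj_on r S" for S using r(1) permutes_inj_on by blast
    have "bij_betw (?r T r) T T" "bij_betw (?r (V - T) r) (V - T) (V - T)"
      using r(2) rV inj by (auto simp: bij_betw_def inj_on_def)
    then have "?r T r permutes T" "?r (V - T) r permutes (V - T)"
      by (auto intro!: bij_imp_permutes split: if_splits)
    then show "(?r T r, ?r (V - T) r) \<in> {p. p permutes T} \<times> {q. q permutes (V - T)}" by simp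
    show "?j (?r T r, ?r (V - T) r) = r" using r(1) T by (auto simp: fun_eq_iff permutes_not_in)
  qed
  finally show ?thesis .
qed

text \<open>For \<rho> = 0 and without the exception for column 0 this is the Laplacian of the
  digraph in which the arc from \<open>u\<close> to \<open>w\<close> has weight
  \<open>a u w * x w\<close>: the diagonal term is the row sum, and the usual minus sign is
  invisible over \<open>bit\<close>.\<close>

definition lap :: "nat \<Rightarrow> (nat \<Rightarrow> nat \<Rightarrow> bit) \<Rightarrow> (nat \<Rightarrow> bit) \<Rightarrow> (nat \<Rightarrow> bit) \<Rightarrow> nat \<Rightarrow> nat \<Rightarrow> bit" where
  "lap n a \<rho> x u w =
     (if w \<noteq> 0 then a u w * x w else 0) + (if u = w then (\<Sum>v<n. a u v * x v) + \<rho> u else 0)"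

text \<open>The permanent. Over \<open>bit\<close> all signs are 1, so it is the determinant
  (\<open>pdet_eq_det\<close>), in the form suited to the expansion.\<close>

definition pdet :: "nat \<Rightarrow> (nat \<Rightarrow> nat \<Rightarrow> 'b::comm_semiring_1) \<Rightarrow> 'b" where
  "pdet n M = (\<Sum>p | p permutes {..<n}. \<Prod>i<n. M i (p i))"

text \<open>The exponent 0 is included, so 0 belongs to the set for every \<open>r\<close>. For a
  permutation it is the library's \<open>orbit r 0\<close>.\<close>

definition orb :: "(nat \<Rightarrow> nat) \<Rightarrow> nat set" where
  "orb r = {(r ^^ k) 0 | k. True}"

lemma finite_permutes [simp]: "finite {p. p permutes {..<n::nat}}"
  by (rule finite_permutations) simp

text \<open>\<open>T\<close> collects the rows in which the summand containing \<open>x\<close> is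
  chosen. All other rows use the diagonal and must be fixed points, so \<open>p\<close> permutes
  \<open>T\<close>, and the factors \<open>x (p i)\<close> multiply to the product of
  \<open>x i\<close> over \<open>T\<close>. If 0 were in \<open>T\<close>, the row sent to 0 would
  contribute either an entry of the erased column or an off-diagonal zero.\<close>

lemma pdet_lap:
  "pdet n (lap n a \<rho> x) = (\<Sum>T\<in>{T \<in> Pow {..<n}. 0 \<notin> T}. \<Sum>p | p permutes T. (\<Prod>i\<in>T. a i (p i)) *
     ((\<Prod>i\<in>T. x i) * (\<Prod>i\<in>{..<n} - T. (\<Sum>v<n. a i v * x v) + \<rho> i)))"
proof -
  let ?f = "\<lambda>p i. if p i \<noteq> (0::nat) then a i (p i) * x (p i) else 0"
  let ?d = "\<lambda>i. (\<Sum>v<n. a i v * x v) + \<rho> i"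
  let ?g = "\<lambda>p i. if i = p i then ?d i else 0"
  let ?t = "\<lambda>T p. (\<Prod>i\<in>T. ?f p i) * (\<Prod>i\<in>{..<n} - T. ?g p i)"
  have "pdet n (lap n a \<rho> x) = (\<Sum>p | p permutes {..<n}. \<Sum>T\<in>Pow {..<n}. ?t T p)"
    unfolding pdet_def lap_def by (subst prod_add_eq_sum_Pow) (rule finite_lessThan, rule refl)
  also have "\<dots> = (\<Sum>T\<in>Pow {..<n}. \<Sum>p | p permutes {..<n}. ?t T p)"
    by (rule sum.swap)
  also have "\<dots> = (\<Sum>T\<in>{T \<in> Pow {..<n}. 0 \<notin> T}. \<Sum>p | p permutes {..<n}. ?t T p)"
  proof (rule sum.mono_neutral_right)
    show "\<forall>T\<in>Pow {..<n} - {T \<in> Pow {..<n}. 0 \<notin> T}. (\<Sum>p | p permutes {..<n}. ?t T p) = 0"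
    proof (intro ballI sum.neutral)
      fix T p assume "T \<in> Pow {..<n} - {T \<in> Pow {..<n}. 0 \<notin> T}" and "p \<in> {p. p permutes {..<n}}"
      then have T: "T \<subseteq> {..<n}" "0 \<in> T" and p: "p permutes {..<n}" by auto
      have fin: "finite T" using T(1) finite_subset by blast
      obtain i where i: "p i = 0" using p by (metis permutes_surj surjD)
      show "?t T p = 0"
      proof (cases "i \<in> T")
        case True
        have "?f p i = 0" by (simp add: i)
        then have "\<exists>i\<in>T. ?f p i = 0" by (rule bexI[OF _ True])
        then have "(\<Prod>i\<in>T. ?f p i) = 0" by (rule prod_zero[OF fin])
        then show ?thesis by (simp only: mult_zero_left)
      next
        case False
        have "i < n" using i p T by (metis permutes_not_in lessThan_iff subsetD)
        moreover have "i \<noteq> p i" using False T i by metis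
        ultimately have "(\<Prod>i\<in>{..<n} - T. ?g p i) = 0" using False by (intro prod_zero) auto
        then show ?thesis by (simp only: mult_zero_right)
      qed
    qed
  qed auto
  also have "\<dots> = (\<Sum>T\<in>{T \<in> Pow {..<n}. 0 \<notin> T}. \<Sum>p | p permutes T. (\<Prod>i\<in>T. a i (p i)) *
     ((\<Prod>i\<in>T. x i) * (\<Prod>i\<in>{..<n} - T. ?d i)))"
  proof (rule sum.cong[OF refl])
    fix T assume "T \<in> {T \<in> Pow {..<n}. 0 \<notin> T}"
    then have T: "T \<subseteq> {..<n}" "0 \<notin> T" by auto
    have "(\<Sum>p | p permutes {..<n}. ?t T p) = (\<Sum>p | p permutes T. ?t T p)"
    proof (rule sum.mono_neutral_right)
      show "{p. p permutes T} \<subseteq> {p. p permutes {..<n}}" using T permutes_subset by auto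
      show "\<forall>p\<in>{p. p permutes {..<n}} - {p. p permutes T}. ?t T p = 0"
      proof
        fix p assume p: "p \<in> {p. p permutes {..<n}} - {p. p permutes T}"
        then obtain i where "i \<notin> T" "p i \<noteq> i" using permutes_superset by blast
        moreover have "i < n" using p \<open>p i \<noteq> i\<close> by (auto simp: permutes_def)
        ultimately have "(\<Prod>i\<in>{..<n} - T. ?g p i) = 0"
          by (intro prod_zero) (auto intro!: bexI[of _ i])
        then show "?t T p = 0" by (simp only: mult_zero_right)
      qed
    qed simp
    also have "\<dots> = (\<Sum>p | p permutes T. (\<Prod>i\<in>T. a i (p i)) *
     ((\<Prod>i\<in>T. x i) * (\<Prod>i\<in>{..<n} - T. ?d i)))"
    proof (rule sum.cong[OF refl])
      fix p assume "p \<in> {p. p permutes T}"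
      then have p: "p permutes T" by simp
      have "p i \<noteq> 0" if "i \<in> T" for i using permutes_in_image[OF p, of i] T(2) that by metis
      then have "(\<Prod>i\<in>T. ?f p i) = (\<Prod>i\<in>T. a i (p i) * x (p i))"
        by (intro prod.cong refl if_P)
      also have "\<dots> = (\<Prod>i\<in>T. a i (p i)) * (\<Prod>i\<in>T. x i)"
        by (subst prod.distrib) (simp only: prod.permute[OF p, of x, unfolded comp_def])
      finally have f: "(\<Prod>i\<in>T. ?f p i) = (\<Prod>i\<in>T. a i (p i)) * (\<Prod>i\<in>T. x i)" .
      have g: "(\<Prod>i\<in>{..<n} - T. ?g p i) = (\<Prod>i\<in>{..<n} - T. ?d i)"
        by (intro prod.cong refl if_P) (use p in \<open>auto simp: permutes_not_in\<close>)
      show "?t T p = (\<Prod>i\<in>T. a i (p i)) * ((\<Prod>i\<in>T. x i) * (\<Prod>i\<in>{..<n} - T. ?d i))"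
        unfolding f g by (simp only: mult.assoc)
    qed
    finally show "(\<Sum>p | p permutes {..<n}. ?t T p) = (\<Sum>p | p permutes T. (\<Prod>i\<in>T. a i (p i)) *
     ((\<Prod>i\<in>T. x i) * (\<Prod>i\<in>{..<n} - T. ?d i)))" .
  qed
  finally show ?thesis .
qed

text \<open>Let \<open>C\<close> be the complement of the orbit of 0. An invariant set that avoids 0
  lies in \<open>C\<close>, and its complement within \<open>C\<close> is again invariant.
  Complementation has no fixed point unless \<open>C\<close> is empty, so the number of sets is even
  without any reference to the number of cycles.\<close>

lemma invariant_sets_parity:
  assumes r: "r permutes {..<n}" and n: "0 < n"
  shows "(\<Sum>T\<in>{T \<in> Pow {..<n}. 0 \<notin> T \<and> r ` T = T}. 1 :: bit) = (if orb r = {..<n} then 1 else 0)"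
proof -
  let ?V = "{..<n}"
  let ?I = "{T \<in> Pow ?V. 0 \<notin> T \<and> r ` T = T}"
  have inj: "inj r" using r permutes_inj by blast
  have sub: "orb r \<subseteq> ?V"
  proof -
    have "(r ^^ k) 0 \<in> ?V" for k
      by (induction k) (simp_all add: n permutes_in_image[OF r] del: lessThan_iff, simp add: n)
    then show ?thesis by (auto simp: orb_def)
  qed
  have im: "r ` orb r = orb r"
  proof (rule card_seteq)
    show "finite (orb r)" using sub finite_subset by blast
    show "r ` orb r \<subseteq> orb r" unfolding orb_def
    proof safe
      fix k show "\<exists>j. r ((r ^^ k) 0) = (r ^^ j) 0 \<and> True" by (intro exI[of _ "Suc k"]) simp
    qed
    show "card (orb r) \<le> card (r ` orb r)" using inj by (simp add: card_image inj_on_subset)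
  qed
  have zero: "0 \<in> orb r" unfolding orb_def by (auto intro: exI[of _ 0])
  let ?C = "?V - orb r"
  have imC: "r ` ?C = ?C" using im permutes_image[OF r] inj by (simp add: image_set_diff)
  have disj: "T \<inter> orb r = {}" if T: "T \<in> ?I" for T
  proof (rule ccontr)
    assume "T \<inter> orb r \<noteq> {}"
    then obtain k where "(r ^^ k) 0 \<in> T" by (auto simp: orb_def)
    then have "0 \<in> T"
    proof (induction k)
      case (Suc k)
      then have "r ((r ^^ k) 0) \<in> r ` T" using T by auto
      then have "(r ^^ k) 0 \<in> T" using inj by (simp add: inj_image_mem_iff)
      then show ?case by (rule Suc.IH)
    qed simp
    then show False using T by simp
  qed
  show ?thesis
  proof (cases "orb r = ?V")
    case True
    have "?I = {{}}" using disj True by auto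
    then show ?thesis using True by (simp only: sum.insert sum.empty finite.emptyI) simp
  next
    case False
    have "(\<Sum>T\<in>?I. 1 :: bit) = 0"
    proof (rule sum_involution_bit[where h = "\<lambda>T. ?C - T"])
      fix T assume T: "T \<in> ?I"
      then have TC: "T \<subseteq> ?C" using disj by auto
      have "r ` (?C - T) = ?C - T" using imC T inj by (simp add: image_set_diff)
      moreover have "?C - T \<noteq> T" using False sub by blast
      ultimately show "?C - T \<in> ?I \<and> ?C - T \<noteq> T \<and> ?C - (?C - T) = T \<and> (1::bit) = 1"
        using TC zero by auto
    qed simp
    then show ?thesis using False by simp
  qed
qed

text \<open>The determinant supplies a permutation of \<open>T\<close>, and the sum over the cube
  supplies one of the complement of \<open>T\<close>. Glued together they are a permutation of all
  vertices that preserves \<open>T\<close>; after exchanging the sums, each permutation is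
  multiplied by the parity of its invariant sets.\<close>

theorem sum_pdet_lap:
  assumes n: "0 < n"
  shows "(\<Sum>x\<in>cube n. pdet n (lap n a \<rho> x))
    = (\<Sum>r | r permutes {..<n} \<and> orb r = {..<n}. \<Prod>i<n. a i (r i))"
proof -
  let ?V = "{..<n}"
  let ?Q = "{T \<in> Pow ?V. 0 \<notin> T}"
  have finp: "finite {p. p permutes T}" if "T \<subseteq> ?V" for T
    using finite_permutations[OF finite_subset[OF that finite_lessThan]] .
  have "(\<Sum>x\<in>cube n. pdet n (lap n a \<rho> x)) = (\<Sum>T\<in>?Q. \<Sum>p | p permutes T. (\<Prod>i\<in>T. a i (p i)) *
     (\<Sum>x\<in>cube n. (\<Prod>i\<in>T. x i) * (\<Prod>i\<in>?V - T. (\<Sum>v<n. a i v * x v) + \<rho> i)))"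
    unfolding pdet_lap sum_distrib_left
    by (subst sum.swap, rule sum.cong[OF refl], rule sum.swap)
  also have "\<dots> = (\<Sum>T\<in>?Q. \<Sum>p | p permutes T. (\<Prod>i\<in>T. a i (p i)) *
     (\<Sum>q | q permutes (?V - T). \<Prod>i\<in>?V - T. a i (q i)))"
    by (intro sum.cong refl arg_cong2[where f = "(*)"] sum_cube_affine_product) auto
  also have "\<dots> = (\<Sum>T\<in>?Q. \<Sum>r | r permutes ?V \<and> r ` T = T. \<Prod>i\<in>?V. a i (r i))"
    unfolding sum_distrib_left by (intro sum.cong refl sum_permutes_split) auto
  also have "\<dots> = (\<Sum>r | r permutes ?V. \<Sum>T\<in>{T \<in> ?Q. r ` T = T}. \<Prod>i\<in>?V. a i (r i))"
  proof -
    have "finite ?Q" by simp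
    from sum.swap_restrict[OF this finp[OF order_refl], of "\<lambda>T r. \<Prod>i\<in>?V. a i (r i)" "\<lambda>T r. r ` T = T"]
    show ?thesis unfolding mem_Collect_eq .
  qed
  also have "\<dots> = (\<Sum>r | r permutes ?V. (\<Prod>i\<in>?V. a i (r i)) * (if orb r = ?V then 1 else 0))"
  proof (rule sum.cong[OF refl])
    fix r assume "r \<in> {r. r permutes ?V}"
    then have r: "r permutes ?V" by simp
    have "{T \<in> ?Q. r ` T = T} = {T \<in> Pow ?V. 0 \<notin> T \<and> r ` T = T}" by auto
    then have "(\<Sum>T\<in>{T \<in> ?Q. r ` T = T}. 1 :: bit) = (if orb r = ?V then 1 else 0)"
      by (simp only: invariant_sets_parity[OF r n])
    moreover have "(\<Sum>T\<in>{T \<in> ?Q. r ` T = T}. \<Prod>i\<in>?V. a i (r i))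
      = (\<Prod>i\<in>?V. a i (r i)) * (\<Sum>T\<in>{T \<in> ?Q. r ` T = T}. 1)"
      by (simp only: sum_distrib_left mult_1_right)
    ultimately show "(\<Sum>T\<in>{T \<in> ?Q. r ` T = T}. \<Prod>i\<in>?V. a i (r i))
      = (\<Prod>i\<in>?V. a i (r i)) * (if orb r = ?V then 1 else 0)"
      by (simp only:)
  qed
  also have "\<dots> = (\<Sum>r\<in>{r \<in> {r. r permutes ?V}. orb r = ?V}. \<Prod>i\<in>?V. a i (r i))"
    unfolding sum.inter_filter[OF finp[OF order_refl]] by (rule sum.cong) auto
  finally show ?thesis by (simp only: mem_Collect_eq)
qed

section \<open>Hamiltonian cycles as cyclic permutations\<close>

lemma orb_eq_orbit:
  assumes "r permutes {..<n}"
  shows "orb r = orbit r 0"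
proof -
  have "permutation r" using assms finite_lessThan by (rule permutes_imp_permutation[rotated])
  from orbit_altdef_permutation[OF this] show ?thesis unfolding orb_def by simp
qed

lemma pcas_nth:
  "pcas u p v \<Longrightarrow> p \<noteq> [] \<Longrightarrow> fst (p ! 0) = u \<and> snd (p ! (length p - 1)) = v \<and>
     (\<forall>k. Suc k < length p \<longrightarrow> snd (p ! k) = fst (p ! Suc k))"
proof (induction u p v rule: pcas.induct)
  case (2 u e es v)
  show ?case
  proof (cases es)
    case (Cons e' es')
    then have "fst (es ! 0) = snd e \<and> snd (es ! (length es - 1)) = v \<and>
     (\<forall>k. Suc k < length es \<longrightarrow> snd (es ! k) = fst (es ! Suc k))" using 2 by auto
    then show ?thesis using 2(2) Cons by (auto simp: nth_Cons split: nat.splits)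
  qed (use 2 in auto)
qed auto

lemma pcas_map_upt:
  "pcas (f i) (map (\<lambda>k. (f k, f (Suc k))) [i..<i + m]) (f (i + m))"
proof (induction m arbitrary: i)
  case (Suc m)
  have "[i..<i + Suc m] = i # [Suc i..<Suc i + m]" by (simp add: upt_conv_Cons del: upt_Suc)
  then show ?case using Suc.IH[of "Suc i"] by (simp only: list.map pcas.simps fst_conv snd_conv simp_thms add_Suc_right add_Suc)
qed simp

text \<open>The arc set of a Hamiltonian cycle is the graph of its successor map. Conversely, the
  iterates of a permutation from 0 trace a closed walk, and it meets every vertex because the orbit
  of 0 is everything.\<close>

lemma hamiltonian_cycles_eq:
  assumes "pair_fin_digraph G" and V: "pverts G = {0..<n}" and n: "0 < n"
  shows "hamiltonian_cycles G = (\<lambda>r. (\<lambda>i. (i, r i)) ` {..<n}) `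
     {r. r permutes {..<n} \<and> orb r = {..<n} \<and> (\<forall>i<n. (i, r i) \<in> parcs G)}" (is "_ = ?g ` ?R")
proof -
  interpret pair_fin_digraph G by fact
  have cyc: "cycle p \<longleftrightarrow> (\<exists>u. u < n \<and> set p \<subseteq> parcs G \<and> pcas u p u \<and> distinct (map snd p) \<and> p \<noteq> [])" for p
    unfolding cycle_def awalk_def using awalk_verts_conv'[of _ p] V by (auto 4 3)
  show ?thesis
  proof (intro equalityI subsetI)
    fix C assume "C \<in> hamiltonian_cycles G"
    then obtain p where p: "C = set p" "cycle p" "fst ` set p = {..<n}"
      unfolding hamiltonian_cycles_def V lessThan_atLeast0 by blast
    then obtain u where u: "set p \<subseteq> parcs G" "pcas u p u" "distinct (map snd p)" "p \<noteq> []"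
      unfolding cyc by auto
    \<comment> \<open>The sequence of tails is continued periodically, so that the closing arc is
      treated like all others.\<close>
    define t where "t k = fst (p ! (k mod length p))" for k
    let ?m = "length p"
    have m: "0 < ?m" using u by simp
    have nth: "p ! k = (t k, t (Suc k))" if "k < ?m" for k
    proof (cases "Suc k < ?m")
      case True
      then show ?thesis using pcas_nth[OF u(2,4)] by (simp add: t_def prod_eq_iff)
    next
      case False
      then have "k = ?m - 1" "Suc k = ?m" using that by auto
      then show ?thesis using pcas_nth[OF u(2,4)] by (simp add: t_def prod_eq_iff)
    qed
    \<comment> \<open>A cycle has distinct heads, so one period repeats no vertex. Together with
      surjectivity this forces the period to be \<open>n\<close>.\<close>
    have inj: "inj_on (\<lambda>k. t (Suc k)) {..<?m}"
      using u(3) nth by (auto simp: inj_on_def distinct_conv_nth)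
    have tmod: "t (k mod ?m) = t k" for k by (simp add: t_def)
    have setp: "set p = (\<lambda>k. (t k, t (Suc k))) ` {..<?m}"
    proof -
      have "set p = (\<lambda>k. p ! k) ` {..<?m}" unfolding set_conv_nth by blast
      also have "\<dots> = (\<lambda>k. (t k, t (Suc k))) ` {..<?m}" by (rule image_cong[OF refl]) (simp only: nth lessThan_iff)
      finally show ?thesis .
    qed
    have im: "t ` {..<?m} = {..<n}" using p(3) unfolding setp by (simp add: image_image)
    have "(\<lambda>k. t (Suc k)) ` {..<?m} = t ` {..<?m}"
    proof -
      have "t (Suc k) \<in> t ` {..<?m}" for k using tmod[of "Suc k", symmetric] m by auto
      moreover have "t k \<in> (\<lambda>k. t (Suc k)) ` {..<?m}" if "k < ?m" for k
      proof (cases k)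
        case 0
        have "t ?m = t 0" by (simp add: t_def)
        then show ?thesis using m 0 by (intro image_eqI[of _ _ "?m - 1"]) auto
      qed (use that in auto)
      ultimately show ?thesis by auto
    qed
    then have mn: "?m = n" using card_image[OF inj] im by simp
    then have injt: "inj_on t {..<n}" using im by (intro eq_card_imp_inj_on) auto
    define r where "r i = (if i < n then t (Suc (the_inv_into {..<n} t i)) else i)" for i
    have rt: "r (t k) = t (Suc k)" for k
    proof -
      have k: "k mod n < n" using n by simp
      then have "t k < n" using tmod[of k] im mn by (metis image_eqI lessThan_iff)
      moreover have "the_inv_into {..<n} t (t k) = k mod n"
        using the_inv_into_f_f[OF injt, of "k mod n"] k tmod[of k] mn by simp
      ultimately show ?thesis using mn unfolding r_def t_def by (simp add: mod_Suc_eq)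
    qed
    have "bij_betw r {..<n} {..<n}"
    proof -
      have "r ` {..<n} = {..<n}"
      proof -
        have "r ` {..<n} = (\<lambda>k. t (Suc k)) ` {..<?m}" unfolding im[symmetric] by (simp add: image_image rt)
        then show ?thesis using \<open>(\<lambda>k. t (Suc k)) ` {..<?m} = t ` {..<?m}\<close> im by simp
      qed
      then show ?thesis by (simp add: bij_betw_def eq_card_imp_inj_on)
    qed
    then have rp: "r permutes {..<n}" by (rule bij_imp_permutes) (simp add: r_def)
    obtain k0 where k0: "k0 < n" "t k0 = 0" using im mn n by (metis imageE lessThan_iff)
    have pow: "(r ^^ j) 0 = t (k0 + j)" for j
      by (induction j) (simp_all add: k0 rt)
    have "{..<n} \<subseteq> orb r"
    proof
      fix i assume "i \<in> {..<n}"
      then obtain k where k: "k < n" "t k = i" using im mn by (metis imageE lessThan_iff)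
      \<comment> \<open>The number of steps \<open>n - k0 + k\<close> is \<open>k - k0\<close>
        modulo \<open>n\<close>, written so that truncated subtraction does no harm.\<close>
      have "t (k0 + (n - k0 + k)) = i" using k k0 mn by (simp add: t_def)
      then show "i \<in> orb r" using pow unfolding orb_def by (metis (mono_tags, lifting) mem_Collect_eq)
    qed
    moreover have "orb r \<subseteq> {..<n}" unfolding orb_def pow using im tmod mn n
      by (auto, metis image_eqI lessThan_iff mod_less_divisor)
    moreover have g: "?g r = set p" unfolding setp im[symmetric] by (simp add: image_image rt)
    ultimately show "C \<in> ?g ` ?R" using rp u(1) p(1) by (intro image_eqI[of _ _ r]) auto
  next
    fix C assume "C \<in> ?g ` ?R"
    then obtain r where C: "C = ?g r" and r: "r permutes {..<n}" "orb r = {..<n}" "\<forall>i<n. (i, r i) \<in> parcs G"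
      by auto
    let ?f = "\<lambda>k. (r ^^ k) 0"
    let ?p = "map (\<lambda>k. (?f k, ?f (Suc k))) [0..<0 + n]"
    have self: "0 \<in> orbit r 0" using r(2) orb_eq_orbit[OF r(1)] n by auto
    have orbit: "orbit r 0 = {..<n}" using r(2) orb_eq_orbit[OF r(1)] by simp
    \<comment> \<open>The least positive number of steps after which 0 recurs. The full orbit makes
      it \<open>n\<close>.\<close>
    let ?d = "funpow_dist1 r 0 0"
    have inj: "inj_on ?f {0..<?d}" by (rule inj_on_funpow_dist1[OF self])
    have im: "{..<n} = ?f ` {0..<?d}" using orbit_conv_funpow_dist1[OF self] orbit by simp
    have d: "?d = n" using card_image[OF inj] im by (metis card_atLeastLessThan card_lessThan diff_zero)
    have fn: "?f n = 0" using funpow_dist1_prop[OF self] d by simp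
    have im': "?f ` {0..<n} = {..<n}" and inj': "inj_on ?f {0..<n}" using im inj unfolding d by auto
    have "pcas (?f 0) ?p (?f (0 + n))" by (rule pcas_map_upt)
    then have "pcas 0 ?p 0" using fn by simp
    moreover have setp: "set ?p = ?g r"
      unfolding im'[symmetric] by (auto simp: image_image)
    moreover have "?g r \<subseteq> parcs G" using r(3) by auto
    moreover have "distinct (map snd ?p)"
    proof -
      have "inj r" using r(1) permutes_inj by blast
      then have "inj_on (\<lambda>k. r (?f k)) {0..<n}" using comp_inj_on[OF inj' inj_on_subset[OF _ subset_UNIV], of r]
        by (simp only: comp_def)
      then show ?thesis by (simp add: distinct_map comp_def)
    qed
    moreover have "?p \<noteq> []" using n by simp
    ultimately have "cycle ?p" unfolding cyc using n by (intro exI[of _ 0]) simp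
    moreover have "fst ` set ?p = pverts G" unfolding setp V by (auto simp: image_image)
    ultimately show "C \<in> hamiltonian_cycles G" unfolding hamiltonian_cycles_def C setp[symmetric] by blast
  qed
qed

lemma card_hamiltonian_cycles:
  assumes "pair_fin_digraph G" and V: "pverts G = {0..<n}" and n: "0 < n"
  shows "card (hamiltonian_cycles G) =
     card {r. r permutes {..<n} \<and> orb r = {..<n} \<and> (\<forall>i<n. (i, r i) \<in> parcs G)}"
  unfolding hamiltonian_cycles_eq[OF assms]
proof (rule card_image, rule inj_onI)
  fix r s assume rs: "r \<in> {r. r permutes {..<n} \<and> orb r = {..<n} \<and> (\<forall>i<n. (i, r i) \<in> parcs G)}"
    "s \<in> {r. r permutes {..<n} \<and> orb r = {..<n} \<and> (\<forall>i<n. (i, r i) \<in> parcs G)}"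
    "(\<lambda>i. (i, r i)) ` {..<n} = (\<lambda>i. (i, s i)) ` {..<n}"
  have "r i = s i" for i
  proof (cases "i < n")
    case True
    then have "(i, r i) \<in> (\<lambda>i. (i, s i)) ` {..<n}" using rs(3) by blast
    then show ?thesis by auto
  next
    case False
    then show ?thesis using rs(1,2) by (auto simp: permutes_def)
  qed
  then show "r = s" by blast
qed

section \<open>Affine sets and Fibonacci weights\<close>

lemma bit_neq_0 [simp]: "(b :: bit) \<noteq> 0 \<longleftrightarrow> b = 1"
  by (cases b) auto

lemma card_cube: "card (cube n) = 2 ^ n"
proof -
  let ?h = "\<lambda>S i. if i \<in> S then 1 else 0 :: bit"
  have "cube n = ?h ` Pow {..<n}"
  proof (intro equalityI subsetI)
    fix x assume "x \<in> cube n"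
    then have "x = ?h {i. x i = 1}" "{i. x i = 1} \<in> Pow {..<n}"
      by (auto simp: cube_def fun_eq_iff not_less[symmetric] intro: ccontr)
    then show "x \<in> ?h ` Pow {..<n}" by blast
  qed (auto simp: cube_def)
  moreover have "inj_on ?h (Pow {..<n})"
    by (rule inj_on_inverseI[where g = "\<lambda>x. {i. x i = 1}"]) auto
  ultimately show ?thesis by (simp add: card_image card_Pow)
qed

definition vadd3 :: "(nat \<Rightarrow> bit) \<Rightarrow> (nat \<Rightarrow> bit) \<Rightarrow> (nat \<Rightarrow> bit) \<Rightarrow> nat \<Rightarrow> bit" where
  "vadd3 x y z i = x i + y i + z i"

text \<open>Over the two-element field this is closure under affine combinations; the empty set is included.\<close>

definition affine_set :: "(nat \<Rightarrow> bit) set \<Rightarrow> bool" where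
  "affine_set S \<longleftrightarrow> (\<forall>x\<in>S. \<forall>y\<in>S. \<forall>z\<in>S. vadd3 x y z \<in> S)"

definition affine_fun :: "((nat \<Rightarrow> bit) \<Rightarrow> bit) \<Rightarrow> bool" where
  "affine_fun l \<longleftrightarrow> (\<forall>x y z. l (vadd3 x y z) = l x + l y + l z)"

lemma affine_set_level:
  assumes "affine_set S" "affine_fun l"
  shows "affine_set {x \<in> S. l x = b}"
  using assms unfolding affine_set_def affine_fun_def by (auto simp: add.assoc)

lemma affine_fun_coord [simp]: "affine_fun (\<lambda>x. x i)"
  by (simp add: affine_fun_def vadd3_def)

lemma level_Un: "S = {x \<in> S. l x = (0::bit)} \<union> {x \<in> S. l x = 1}"
  using bit_neq_0 by blast

text \<open>Adding \<open>u + v\<close>, for a point \<open>u\<close> on level 0 and a point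
  \<open>v\<close> on level 1, stays in the affine set and exchanges the two levels.\<close>

lemma affine_level_cards:
  assumes S: "affine_set S" "finite S" and l: "affine_fun l"
    and ne: "{x \<in> S. l x = 0} \<noteq> {}" "{x \<in> S. l x = 1} \<noteq> {}"
  shows "card {x \<in> S. l x = 0} = card {x \<in> S. l x = 1}" "card S = 2 * card {x \<in> S. l x = 1}"
proof -
  obtain u v where u: "u \<in> S" "l u = 0" and v: "v \<in> S" "l v = 1" using ne by auto
  have "a + b + (a + b + c) = c" for a b c :: bit
    by (cases a; cases b; cases c) simp_all
  then have inv: "vadd3 u v (vadd3 u v x) = x" for x
    by (intro ext) (simp only: vadd3_def)
  have mem: "vadd3 u v x \<in> S" "l (vadd3 u v x) = l x + 1" if "x \<in> S" for x
    using S(1) l u v that unfolding affine_set_def affine_fun_def by (auto simp: add.commute)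
  have "bij_betw (vadd3 u v) {x \<in> S. l x = 0} {x \<in> S. l x = 1}"
    by (rule bij_betw_byWitness[where f' = "vadd3 u v"]) (use inv mem in auto)
  then show *: "card {x \<in> S. l x = 0} = card {x \<in> S. l x = 1}" by (rule bij_betw_same_card)
  have "S = {x \<in> S. l x = 0} \<union> {x \<in> S. l x = 1}" by (rule level_Un)
  then have "card S = card {x \<in> S. l x = 0} + card {x \<in> S. l x = 1}"
    using S(2) by (subst card_Un_disjoint[symmetric]) auto
  then show "card S = 2 * card {x \<in> S. l x = 1}" using * by simp
qed

text \<open>Fixing a coordinate either leaves an affine set unchanged or cuts it into two levels of
  equal size.\<close>

lemma affine_card_power2:
  assumes "affine_set S" "finite S" "S \<noteq> {}" "S \<subseteq> cube n"
  shows "\<exists>k. card S = 2 ^ k"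
proof -
  \<comment> \<open>Generalised to sets whose points agree from coordinate \<open>m\<close> on, so
    that fixing coordinate \<open>m\<close> of the step case lowers the induction parameter.\<close>
  have "\<lbrakk>affine_set S; finite S; S \<noteq> {}; \<forall>x\<in>S. \<forall>y\<in>S. \<forall>i\<ge>m. x i = y i\<rbrakk> \<Longrightarrow> \<exists>k. card S = 2 ^ k" for m
  proof (induction m arbitrary: S)
    case 0
    then obtain x where x: "x \<in> S" by blast
    have "y = x" if "y \<in> S" for y
    proof (rule ext)
      show "y i = x i" for i using 0(4) that x le0 by blast
    qed
    then have "S = {x}" using x by blast
    then show ?case by (intro exI[of _ 0]) simp
  next
    case (Suc m)
    let ?S = "\<lambda>b. {x \<in> S. x m = b}"
    have agree: "\<forall>x\<in>?S b. \<forall>y\<in>?S b. \<forall>i\<ge>m. x i = y i" for b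
      using Suc.prems(4) by (metis (mono_tags, lifting) Suc_leI le_neq_implies_less mem_Collect_eq)
    have aff: "affine_set (?S b)" for b
      using affine_set_level[OF Suc.prems(1) affine_fun_coord] .
    have IH: "?S b \<noteq> {} \<Longrightarrow> \<exists>k. card (?S b) = 2 ^ k" for b
      using Suc.IH[OF aff _ _ agree] Suc.prems(2) by simp
    have split: "S = ?S 0 \<union> ?S 1" by (rule level_Un)
    show ?case
    proof (cases "?S 0 = {} \<or> ?S 1 = {}")
      case True
      then show ?thesis
      proof
        assume "?S 0 = {}"
        then have "S = ?S 1" using split by (simp only: Un_empty_left)
        then show ?thesis using IH[of 1] Suc.prems(3) by (simp only: simp_thms)
      next
        assume "?S 1 = {}"
        then have "S = ?S 0" using split by (simp only: Un_empty_right)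
        then show ?thesis using IH[of 0] Suc.prems(3) by (simp only: simp_thms)
      qed
    next
      case False
      then have ne: "?S 0 \<noteq> {}" "?S 1 \<noteq> {}" by blast+
      obtain k where "card (?S 1) = 2 ^ k" using IH[OF ne(2)] by blast
      moreover have "card S = 2 * card (?S 1)"
        by (rule affine_level_cards(2)[OF Suc.prems(1,2) affine_fun_coord ne])
      ultimately show ?thesis by (intro exI[of _ "Suc k"]) simp
    qed
  qed
  moreover have "x i = 0" if "x \<in> S" "n \<le> i" for x i
    using that assms(4) by (auto simp: cube_def)
  then have "\<forall>x\<in>S. \<forall>y\<in>S. \<forall>i\<ge>n. x i = y i" by metis
  ultimately show ?thesis using assms(1-3) by blast
qed

text \<open>As \<open>floorlog 2 (2 ^ k)\<close> is \<open>k + 1\<close>, a set of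
  \<open>2 ^ k\<close> points weighs \<open>fib (k + 2)\<close>. The offset 2 gives a singleton the
  weight 1, so that the total weight of a level bounds its number of nonempty nodes.\<close>

definition weight :: "nat \<Rightarrow> nat" where
  "weight c = (if c = 0 then 0 else fib (floorlog 2 c + 1))"

lemma weight_0 [simp]: "weight 0 = 0"
  by (simp add: weight_def)

lemma weight_power2 [simp]: "weight (2 ^ k) = fib (k + 2)"
proof -
  have "floorlog 2 (2 ^ k :: nat) = k + 1"
    by (simp add: floorlog_def log_nat_power)
  then show ?thesis by (simp add: weight_def)
qed

lemma weight_pos: "0 < c \<Longrightarrow> 1 \<le> weight c"
  unfolding weight_def using fib_neq_0_nat[of "floorlog 2 c + 1"] by (simp add: Suc_le_eq)

text \<open>The left side is the weight of a constrained branch, added up over both values of the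
  shift bit. If \<open>l\<close> is constant on the set, one summand is 0 and the other is the
  weight of the parent; otherwise both are halves, which weigh less than the whole.\<close>

lemma weight_split_le:
  assumes S: "affine_set S" "finite S" "S \<subseteq> cube n" and l: "affine_fun l"
  shows "weight (card {x \<in> S. l x = 0}) + weight (card {x \<in> S. l x = 1}) \<le> 2 * weight (card S)"
proof (cases "{x \<in> S. l x = 0} = {} \<or> {x \<in> S. l x = 1} = {}")
  case True
  moreover have "S = {x \<in> S. l x = 0} \<union> {x \<in> S. l x = 1}" by (rule level_Un)
  ultimately have "{x \<in> S. l x = 0} = {} \<and> {x \<in> S. l x = 1} = S \<or>
      {x \<in> S. l x = 1} = {} \<and> {x \<in> S. l x = 0} = S" by blast
  then show ?thesis by (elim disjE conjE) (simp_all only: card.empty weight_0)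
next
  case False
  then have ne: "{x \<in> S. l x = 0} \<noteq> {}" "{x \<in> S. l x = 1} \<noteq> {}" by auto
  have "affine_set {x \<in> S. l x = 1}" by (rule affine_set_level[OF S(1) l])
  then obtain k where k: "card {x \<in> S. l x = 1} = 2 ^ k"
    using affine_card_power2[of "{x \<in> S. l x = 1}" n] ne S by auto
  have "card {x \<in> S. l x = 0} = 2 ^ k" "card S = 2 ^ Suc k"
    using affine_level_cards[OF S(1,2) l ne] k by simp_all
  then have "weight (card {x \<in> S. l x = 0}) = fib (k + 2)" "weight (card {x \<in> S. l x = 1}) = fib (k + 2)"
    "weight (card S) = fib (Suc k + 2)" using k by (simp_all only: weight_power2)
  then show ?thesis by simp
qed

text \<open>The Fibonacci inequality of a single branching. \<open>h\<close> is the coordinate being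
  fixed, and \<open>l\<close> is the affine form whose required value on the branch
  \<open>h = 0\<close> changes with the shift bit. The branch \<open>h = 1\<close> is present under
  both values, hence its factor 2.\<close>

lemma weight_branch_le:
  assumes S: "affine_set S" "finite S" "S \<subseteq> cube n" and l: "affine_fun l" and h: "affine_fun h"
  shows "2 * weight (card {x \<in> S. h x = 1}) + weight (card {x \<in> S. h x = 0 \<and> l x = 0})
     + weight (card {x \<in> S. h x = 0 \<and> l x = 1}) \<le> 2 * weight (card S)"
proof -
  let ?A = "{x \<in> S. h x = 0}" and ?B = "{x \<in> S. h x = 1}"
  have eq: "{x \<in> S. h x = 0 \<and> l x = b} = {x \<in> ?A. l x = b}" for b by blast
  have A: "affine_set ?A" "finite ?A" "?A \<subseteq> cube n"
    using affine_set_level[OF S(1) h] S by auto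
  have sp: "S = ?A \<union> ?B" by (rule level_Un)
  consider "?B = {}" | "?A = {}" | "?A \<noteq> {}" "?B \<noteq> {}" by blast
  then show ?thesis
  proof cases
    case 1
    then have "?A = S" using sp by blast
    then show ?thesis using weight_split_le[OF A l] unfolding eq 1
      by (simp only: card.empty weight_0 mult_0_right add_0_left)
  next
    case 2
    then have "?B = S" using sp by blast
    moreover have "{x \<in> S. h x = 0 \<and> l x = b} = {}" for b using 2 by blast
    ultimately show ?thesis by (simp only: card.empty weight_0 add_0_right order_refl)
  next
    case 3
    obtain j where j: "card ?A = 2 ^ j" using affine_card_power2[OF A(1,2) 3(1) A(3)] by blast
    then have B: "card ?B = 2 ^ j" and cS: "card S = 2 ^ Suc j"
      using affine_level_cards[OF S(1,2) h 3] by auto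
    let ?AL = "{x \<in> ?A. l x = 0}" and ?AR = "{x \<in> ?A. l x = 1}"
    have w: "weight (card ?B) = fib (j + 2)" "weight (card S) = fib (j + 3)"
      unfolding B cS weight_power2 by (simp_all add: numeral_eq_Suc)
    have spA: "?A = ?AL \<union> ?AR" by (rule level_Un[of ?A l])
    show ?thesis
    proof (cases "?AL = {} \<or> ?AR = {}")
      case True
      then have "weight (card ?AL) + weight (card ?AR) = fib (j + 2)"
      proof
        assume e: "?AL = {}"
        then have "?AR = ?A" using spA by blast
        then show ?thesis using e j by (simp only: card.empty weight_0 weight_power2)
      next
        assume e: "?AR = {}"
        then have "?AL = ?A" using spA by blast
        then show ?thesis using e j by (simp only: card.empty weight_0 weight_power2)
      qed
      \<comment> \<open>One shift kills the constrained branch. What remains is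
        \<open>3 * fib (j + 2) \<le> 2 * fib (j + 3)\<close>, which reduces to this inequality by
        the recurrence.\<close>
      moreover have "fib j \<le> fib (Suc j)" by (rule fib_mono) simp
      ultimately show ?thesis unfolding w eq by (simp add: numeral_eq_Suc)
    next
      case False
      then have ne: "?AL \<noteq> {}" "?AR \<noteq> {}" by auto
      have "affine_set ?AR" by (rule affine_set_level[OF A(1) l])
      then obtain i where i: "card ?AR = 2 ^ i"
        using affine_card_power2[OF _ finite_subset[OF _ A(2)] ne(2) subset_trans[OF _ A(3)]] by blast
      have i0: "card ?AL = 2 ^ i" and "card ?A = 2 ^ Suc i"
        using affine_level_cards[OF A(1,2) l ne] i by simp_all
      \<comment> \<open>The tight case: both sides equal \<open>2 * fib (i + 4)\<close>.\<close>
      then have "j = Suc i" using j by (metis power_inject_exp one_less_numeral_iff semiring_norm(76))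
      then show ?thesis unfolding w eq i i0 weight_power2 by (simp add: numeral_eq_Suc)
    qed
  qed
qed

section \<open>The search tree\<close>

fun tsum :: "(bit list \<Rightarrow> bool) \<Rightarrow> (bit list \<Rightarrow> nat) \<Rightarrow> nat \<Rightarrow> bit list \<Rightarrow> nat" where
  "tsum N L 0 p = (if N p then L p else 0)"
| "tsum N L (Suc d) p = (if N p then tsum N L d (0 # p) + tsum N L d (1 # p) else 0)"

text \<open>Empty nodes are counted as well, since reaching one costs an elimination before it is
  recognised as empty.\<close>

fun tcount :: "(bit list \<Rightarrow> bool) \<Rightarrow> nat \<Rightarrow> bit list \<Rightarrow> nat" where
  "tcount N 0 p = 1"
| "tcount N (Suc d) p = 1 + (if N p then tcount N d (0 # p) + tcount N d (1 # p) else 0)"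

lemma tsum_mono:
  assumes "\<And>p. N p \<Longrightarrow> L p \<le> L' p"
  shows "tsum N L d p \<le> tsum N L' d p"
  by (induction d arbitrary: p) (auto simp: assms add_mono)

lemma tsum_cong:
  assumes "\<And>q. length q \<le> length p + d \<Longrightarrow> N q = N' q \<and> L q = L' q"
  shows "tsum N L d p = tsum N' L' d p"
  using assms
proof (induction d arbitrary: p)
  case (Suc d)
  have "tsum N L d (b # p) = tsum N' L' d (b # p)" for b
    by (rule Suc.IH) (use Suc.prems in auto)
  then show ?case using Suc.prems[of p] by simp
qed simp

text \<open>Every visited node except the root is one of the two children of a nonempty node on one
  of the levels below \<open>d\<close>.\<close>

lemma tcount_le: "tcount N d p \<le> 1 + 2 * (\<Sum>j<d. tsum N (\<lambda>_. 1) j p)"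
proof (induction d arbitrary: p)
  case (Suc d)
  show ?case
  proof (cases "N p")
    case True
    have "tcount N (Suc d) p \<le> 3 + 2 * ((\<Sum>j<d. tsum N (\<lambda>_. 1) j (0 # p)) + (\<Sum>j<d. tsum N (\<lambda>_. 1) j (1 # p)))"
      using Suc[of "0 # p"] Suc[of "1 # p"] True by simp
    also have "\<dots> = 3 + 2 * (\<Sum>j<d. tsum N (\<lambda>_. 1) (Suc j) p)"
      using True by (simp add: sum.distrib)
    also have "\<dots> = 1 + 2 * (\<Sum>j<Suc d. tsum N (\<lambda>_. 1) j p)"
      using True by (simp add: sum.lessThan_Suc_shift del: sum.lessThan_Suc tsum.simps(2))
    finally show ?thesis .
  qed simp
qed simp

section \<open>Solution sets of prefixes and the potential of a level\<close>

definition dval :: "nat \<Rightarrow> (nat \<Rightarrow> nat \<Rightarrow> bit) \<Rightarrow> (nat \<Rightarrow> bit) \<Rightarrow> (nat \<Rightarrow> bit) \<Rightarrow> nat \<Rightarrow> bit" where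
  "dval n a \<rho> x u = (\<Sum>v<n. a u v * x v) + \<rho> u"

text \<open>
  A prefix is stored in reverse, so the head of \<open>b # p\<close> is the value at coordinate \<open>length p\<close>.
\<close>

fun cylinder :: "nat \<Rightarrow> bit list \<Rightarrow> (nat \<Rightarrow> bit) set" where
  "cylinder n [] = cube n"
| "cylinder n (b # p) = {x \<in> cylinder n p. x (length p) = b}"

fun sol :: "nat \<Rightarrow> (nat \<Rightarrow> nat \<Rightarrow> bit) \<Rightarrow> (nat \<Rightarrow> bit) \<Rightarrow> bit list \<Rightarrow> (nat \<Rightarrow> bit) set" where
  "sol n a \<rho> [] = cube n"
| "sol n a \<rho> (b # p) = {x \<in> sol n a \<rho> p. x (length p) = b \<and>
     (length p = 0 \<or> b = 0 \<longrightarrow> dval n a \<rho> x (length p) = 1)}"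

lemma sol_subset_cube: "sol n a \<rho> p \<subseteq> cube n"
  by (induction p) auto

lemma finite_sol [simp]: "finite (sol n a \<rho> p)"
  using finite_subset[OF sol_subset_cube finite_cube] .

lemma affine_fun_dval: "affine_fun (\<lambda>x. dval n a \<rho> x u)"
proof -
  have "(\<Sum>v<n. a u v * vadd3 x y z v) + \<rho> u =
    ((\<Sum>v<n. a u v * x v) + \<rho> u) + ((\<Sum>v<n. a u v * y v) + \<rho> u) + ((\<Sum>v<n. a u v * z v) + \<rho> u)" for x y z
  proof -
    have "(\<Sum>v<n. a u v * vadd3 x y z v) = (\<Sum>v<n. a u v * x v) + (\<Sum>v<n. a u v * y v) + (\<Sum>v<n. a u v * z v)"
      by (simp only: vadd3_def distrib_left sum.distrib)
    moreover have "p + q + s + r = (p + r) + (q + r) + (s + r)" for p q r s :: bit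
      by (cases p; cases q; cases r; cases s) simp_all
    ultimately show ?thesis by (simp only:)
  qed
  then show ?thesis unfolding affine_fun_def dval_def by blast
qed

lemma affine_sol: "affine_set (sol n a \<rho> p)"
proof (induction p)
  case Nil
  show ?case by (auto simp: affine_set_def vadd3_def cube_def)
next
  case (Cons b p)
  let ?S = "{x \<in> sol n a \<rho> p. x (length p) = b}"
  have S: "affine_set ?S" by (rule affine_set_level[OF Cons.IH affine_fun_coord])
  show ?case
  proof (cases "length p = 0 \<or> b = 0")
    case True
    then have "sol n a \<rho> (b # p) = {x \<in> ?S. dval n a \<rho> x (length p) = 1}" by auto
    then show ?thesis using affine_set_level[OF S affine_fun_dval] by (simp only:)
  next
    case False
    then have "sol n a \<rho> (b # p) = ?S" by auto
    then show ?thesis using S by (simp only:)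
  qed
qed

text \<open>The equation at coordinate \<open>i\<close> involves the shift only through \<rho> i, so
  bit \<open>t\<close> first matters for prefixes of length \<open>t + 1\<close>. This is what
  permits committing to the bits in order.\<close>

lemma sol_cong: "(\<And>i. i < length p \<Longrightarrow> \<rho> i = \<rho>' i) \<Longrightarrow> sol n a \<rho> p = sol n a \<rho>' p"
  by (induction p) (auto simp: dval_def)

abbreviation "node n a \<rho> p \<equiv> sol n a \<rho> p \<noteq> {}"
abbreviation "wleaf n a \<rho> p \<equiv> weight (card (sol n a \<rho> p))"

definition pot :: "nat \<Rightarrow> (nat \<Rightarrow> nat \<Rightarrow> bit) \<Rightarrow> (nat \<Rightarrow> bit) \<Rightarrow> nat \<Rightarrow> nat" where
  "pot n a \<rho> t = tsum (node n a \<rho>) (wleaf n a \<rho>) t []"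

lemma pot_0: "pot n a \<rho> 0 = fib (n + 2)"
proof -
  have "cube n \<noteq> {}" using card_cube[of n] by force
  then show ?thesis by (simp add: pot_def card_cube)
qed

lemma pot_upd: "t \<le> m \<Longrightarrow> pot n a (\<rho>(m := r)) t = pot n a \<rho> t"
  unfolding pot_def
proof (rule tsum_cong)
  fix q :: "bit list" assume "t \<le> m" "length q \<le> length ([] :: bit list) + t"
  then have "sol n a (\<rho>(m := r)) q = sol n a \<rho> q" by (intro sol_cong) auto
  then show "node n a (\<rho>(m := r)) q = node n a \<rho> q \<and> wleaf n a (\<rho>(m := r)) q = wleaf n a \<rho> q"
    by simp
qed

text \<open>Changing the shift bit \<open>m\<close> exchanges the two levels of the form
  \<open>d\<close> at coordinate \<open>m\<close>, so the two shifts together realise the terms of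
  \<open>weight_branch_le\<close>. At coordinate 0 the child with bit 1 is constrained too; by
  \<open>weight_split_le\<close> this does not increase the sum.\<close>

lemma wleaf_children:
  assumes "length p = m"
  shows "(\<Sum>r\<in>{0, 1}. wleaf n a (\<rho>(m := r)) (0 # p) + wleaf n a (\<rho>(m := r)) (1 # p)) \<le> 2 * wleaf n a \<rho> p"
proof -
  let ?S = "sol n a \<rho> p"
  let ?l = "\<lambda>x. dval n a (\<rho>(m := 0)) x m"
  have S: "sol n a (\<rho>(m := r)) p = ?S" for r using assms by (intro sol_cong) auto
  have l: "affine_fun ?l" by (rule affine_fun_dval)
  have l0: "dval n a (\<rho>(m := 0)) x m = 1 \<longleftrightarrow> ?l x = 1" for x by simp
  have l1: "dval n a (\<rho>(m := 1)) x m = 1 \<longleftrightarrow> ?l x = 0" for x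
    by (cases "\<Sum>v<n. a m v * x v") (simp_all add: dval_def del: sum_mult_of_bool_eq)
  let ?c = "\<lambda>b c. card {x \<in> ?S. x m = b \<and> ?l x = c}"
  have A: "sol n a (\<rho>(m := 0)) (0 # p) = {x \<in> ?S. x m = 0 \<and> ?l x = 1}"
    "sol n a (\<rho>(m := 1)) (0 # p) = {x \<in> ?S. x m = 0 \<and> ?l x = 0}"
    by (simp_all only: sol.simps S assms l1 simp_thms)
  show ?thesis
  proof (cases "m = 0")
    case False
    then have B: "sol n a (\<rho>(m := r)) (1 # p) = {x \<in> ?S. x m = 1}" for r
      by (simp only: sol.simps S assms simp_thms zero_neq_one one_neq_zero)
    have "(\<Sum>r\<in>{0, 1}. wleaf n a (\<rho>(m := r)) (0 # p) + wleaf n a (\<rho>(m := r)) (1 # p))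
      = weight (?c 0 1) + weight (card {x \<in> ?S. x m = 1}) + (weight (?c 0 0) + weight (card {x \<in> ?S. x m = 1}))"
      by (simp only: A B sum.insert sum.empty finite.intros zero_neq_one insert_iff empty_iff simp_thms add_0_right)
    then show ?thesis
      using weight_branch_le[OF affine_sol finite_sol sol_subset_cube l affine_fun_coord, of n a \<rho> p m] by simp
  next
    case True
    have B: "sol n a (\<rho>(m := 0)) (1 # p) = {x \<in> ?S. x m = 1 \<and> ?l x = 1}"
      "sol n a (\<rho>(m := 1)) (1 # p) = {x \<in> ?S. x m = 1 \<and> ?l x = 0}"
      by (simp_all only: sol.simps S assms l1 simp_thms True[symmetric])
    have half: "weight (?c b 0) + weight (?c b 1) \<le> 2 * weight (card {x \<in> ?S. x m = b})" for b
    proof -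
      let ?B = "{x \<in> ?S. x m = b}"
      have "{x \<in> ?B. ?l x = c} = {x \<in> ?S. x m = b \<and> ?l x = c}" for c by blast
      moreover have "affine_set ?B" by (rule affine_set_level[OF affine_sol affine_fun_coord])
      ultimately show ?thesis
        using weight_split_le[of ?B n ?l] sol_subset_cube[of n a \<rho> p] l finite_sol by auto
    qed
    have "(\<Sum>r\<in>{0, 1}. wleaf n a (\<rho>(m := r)) (0 # p) + wleaf n a (\<rho>(m := r)) (1 # p))
      = weight (?c 0 1) + weight (?c 1 1) + (weight (?c 0 0) + weight (?c 1 0))"
      by (simp only: A B sum.insert sum.empty finite.intros zero_neq_one insert_iff empty_iff simp_thms add_0_right)
    also have "\<dots> \<le> 2 * weight (card {x \<in> ?S. x m = 1}) + weight (?c 0 0) + weight (?c 0 1)"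
      using half[of 1] by simp
    also have "\<dots> \<le> 2 * weight (card ?S)"
      using weight_branch_le[OF affine_sol finite_sol sol_subset_cube l affine_fun_coord, of n a \<rho> p m] by simp
    finally show ?thesis .
  qed
qed

text \<open>Shift bit \<open>m\<close> is invisible down to prefixes of length \<open>m\<close>, so
  both trees have the same parents and the inequality for one parent adds up over the level.\<close>

lemma tsum_wleaf_step:
  assumes "length p + d = m"
  shows "(\<Sum>r\<in>{0, 1}. tsum (node n a (\<rho>(m := r))) (wleaf n a (\<rho>(m := r))) (Suc d) p)
    \<le> 2 * tsum (node n a \<rho>) (wleaf n a \<rho>) d p"
  using assms
proof (induction d arbitrary: p)
  case 0
  then have m: "length p = m" by simp
  have S: "sol n a (\<rho>(m := r)) p = sol n a \<rho> p" for r using m by (intro sol_cong) auto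
  have z: "tsum (node n a \<rho>') (wleaf n a \<rho>') 0 q = wleaf n a \<rho>' q" for \<rho>' q by simp
  show ?case
  proof (cases "sol n a \<rho> p = {}")
    case True
    then have "\<not> node n a (\<rho>(m := r)) p" for r by (simp only: S simp_thms)
    then show ?thesis by (simp only: tsum.simps(2) if_False sum.neutral_const le0)
  next
    case False
    then show ?thesis
      using wleaf_children[OF m, of n a \<rho>] unfolding tsum.simps(2) z S by (simp only: if_True simp_thms not_False_eq_True)
  qed
next
  case (Suc d)
  have S: "sol n a (\<rho>(m := r)) p = sol n a \<rho> p" for r using Suc.prems by (intro sol_cong) auto
  let ?t = "\<lambda>d \<rho> p. tsum (node n a \<rho>) (wleaf n a \<rho>) d p"
  have IH: "?t (Suc d) (\<rho>(m := 0)) (b # p) + ?t (Suc d) (\<rho>(m := 1)) (b # p) \<le> 2 * ?t d \<rho> (b # p)" for b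
    using Suc.IH[of "b # p"] Suc.prems by (simp del: tsum.simps sol.simps fun_upd_apply)
  have two: "sum f {0, 1 :: bit} = f 0 + f 1" for f :: "bit \<Rightarrow> nat" by simp
  show ?case
  proof (cases "sol n a \<rho> p = {}")
    case False
    then have "?t (Suc (Suc d)) (\<rho>(m := r)) p = ?t (Suc d) (\<rho>(m := r)) (0 # p) + ?t (Suc d) (\<rho>(m := r)) (1 # p)" for r
      using S by (subst tsum.simps(2)) (simp only: if_True not_False_eq_True)
    moreover have "?t (Suc d) \<rho> p = ?t d \<rho> (0 # p) + ?t d \<rho> (1 # p)" using False by simp
    ultimately show ?thesis unfolding two using IH[of 0] IH[of 1] by (simp del: tsum.simps)
  next
    case True
    then have "\<not> node n a (\<rho>(m := r)) p" for r by (simp only: S simp_thms)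
    then show ?thesis by (subst tsum.simps(2)) (simp only: if_False sum.neutral_const le0)
  qed
qed

text \<open>The mean over both values of the bit does not exceed the present potential; hence the
  better value does not increase it.\<close>

lemma pot_step: "pot n a (\<rho>(m := 0)) (Suc m) + pot n a (\<rho>(m := 1)) (Suc m) \<le> 2 * pot n a \<rho> m"
  using tsum_wleaf_step[of "[]" m m n a \<rho>] unfolding pot_def by (simp del: tsum.simps)

text \<open>A nonempty node weighs at least \<open>fib 2 = 1\<close>.\<close>

lemma level_le_pot: "tsum (node n a \<rho>) (\<lambda>_. 1) t [] \<le> pot n a \<rho> t"
  unfolding pot_def by (rule tsum_mono) (rule weight_pos, simp only: card_gt_0_iff finite_sol simp_thms)

lemma tcount_bound:
  assumes "\<And>j. j < d \<Longrightarrow> pot n a \<rho> j \<le> K"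
  shows "tcount (node n a \<rho>) d [] \<le> 1 + 2 * (d * K)"
proof -
  have "(\<Sum>j<d. tsum (node n a \<rho>) (\<lambda>_. 1) j []) \<le> (\<Sum>j<d. K)"
    using level_le_pot assms by (intro sum_mono) (meson lessThan_iff order_trans)
  then show ?thesis using tcount_le[of "node n a \<rho>" d "[]"] by simp
qed

section \<open>The determinants at the leaves of the pruned tree\<close>

definition point :: "bit list \<Rightarrow> nat \<Rightarrow> bit" where
  "point p i = (if i < length p then rev p ! i else 0)"

lemma cylinder_eq: "cylinder n p = {x \<in> cube n. \<forall>i<length p. x i = point p i}"
proof (induction p)
  case (Cons b p)
  have "point (b # p) i = point p i" if "i < length p" for i using that by (simp add: point_def nth_append)
  moreover have "point (b # p) (length p) = b" by (simp add: point_def nth_append)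
  ultimately show ?case unfolding cylinder.simps Cons.IH by (auto simp: less_Suc_eq)
qed simp

lemma cylinder_full: "length p = n \<Longrightarrow> cylinder n p = {point p}"
proof (intro equalityI subsetI)
  fix x assume n: "length p = n" and x: "x \<in> cylinder n p"
  have "x i = point p i" for i
  proof (cases "i < n")
    case False
    then have "x i = 0" using x by (simp add: cylinder_eq cube_def)
    then show ?thesis using False n by (simp add: point_def)
  qed (use x n in \<open>simp add: cylinder_eq\<close>)
  then show "x \<in> {point p}" by blast
qed (simp add: cylinder_eq cube_def point_def)

lemma cylinder_not_sol:
  "x \<in> cylinder n p \<Longrightarrow> x \<notin> sol n a \<rho> p \<Longrightarrow>
     \<exists>u<length p. (u = 0 \<or> x u = 0) \<and> dval n a \<rho> x u = 0"
proof (induction p)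
  case (Cons b p)
  show ?case
  proof (cases "x \<in> sol n a \<rho> p")
    case True
    then show ?thesis using Cons.prems by (intro exI[of _ "length p"]) auto
  next
    case False
    then obtain u where "u < length p" "u = 0 \<or> x u = 0" "dval n a \<rho> x u = 0"
      using Cons by (auto simp del: bit_neq_0)
    then show ?thesis by (intro exI[of _ u]) simp
  qed
qed simp

lemma pdet_lap_zero_column:
  assumes u: "u < n" "u = 0 \<or> x u = 0" "dval n a \<rho> x u = 0"
  shows "pdet n (lap n a \<rho> x) = 0"
  unfolding pdet_def
proof (rule sum.neutral, rule ballI)
  fix p assume "p \<in> {p. p permutes {..<n}}"
  then have p: "p permutes {..<n}" by simp
  obtain i where i: "p i = u" using p by (metis permutes_surj surjD)
  have "i < n" using i u(1) permutes_in_image[OF p, of i] by simp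
  moreover have "lap n a \<rho> x i (p i) = 0" unfolding i lap_def
    using u(2,3) unfolding dval_def by auto
  ultimately have "\<exists>i\<in>{..<n}. lap n a \<rho> x i (p i) = 0" by blast
  then show "(\<Prod>i<n. lap n a \<rho> x i (p i)) = 0" by (rule prod_zero[OF finite_lessThan])
qed

text \<open>A natural number, because the machine adds the determinants as numbers and reduces
  modulo 2 only at the end.\<close>

definition dleaf :: "nat \<Rightarrow> (nat \<Rightarrow> nat \<Rightarrow> bit) \<Rightarrow> (nat \<Rightarrow> bit) \<Rightarrow> bit list \<Rightarrow> nat" where
  "dleaf n a \<rho> p = (if pdet n (lap n a \<rho> (point p)) = 1 then 1 else 0)"

text \<open>Pruning loses nothing: every point that extends an empty node violates one of its
  equations, which makes a column zero and the determinant 0.\<close>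

lemma tsum_dleaf:
  assumes "length p + d = n"
  shows "of_nat (tsum (node n a \<rho>) (dleaf n a \<rho>) d p) = (\<Sum>x\<in>cylinder n p. pdet n (lap n a \<rho> x))"
  using assms
proof (induction d arbitrary: p)
  case 0
  then have cylinder: "cylinder n p = {point p}" by (simp add: cylinder_full)
  show ?case
  proof (cases "point p \<in> sol n a \<rho> p")
    case True
    then have "node n a \<rho> p" by blast
    then show ?thesis unfolding cylinder dleaf_def tsum.simps(1)
      by (cases "pdet n (lap n a \<rho> (point p))") simp_all
  next
    case False
    have "sol n a \<rho> p \<subseteq> cylinder n p" by (induction p) auto
    then have "\<not> node n a \<rho> p" using cylinder False by auto
    moreover have "pdet n (lap n a \<rho> (point p)) = 0"
    proof -
      obtain u where "u < length p" "u = 0 \<or> point p u = 0" "dval n a \<rho> (point p) u = 0"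
        using cylinder_not_sol[of "point p" n p a \<rho>] cylinder False by blast
      then show ?thesis using 0 by (intro pdet_lap_zero_column[of u]) auto
    qed
    ultimately show ?thesis unfolding cylinder by simp
  qed
next
  case (Suc d)
  have sub: "sol n a \<rho> p \<subseteq> cylinder n p" by (induction p) auto
  have fin: "finite (cylinder n q)" for q unfolding cylinder_eq by simp
  show ?case
  proof (cases "node n a \<rho> p")
    case True
    have "cylinder n p = cylinder n (0 # p) \<union> cylinder n (1 # p)" using level_Un[of "cylinder n p" "\<lambda>x. x (length p)"] by simp
    then have "(\<Sum>x\<in>cylinder n p. pdet n (lap n a \<rho> x)) =
      (\<Sum>x\<in>cylinder n (0 # p). pdet n (lap n a \<rho> x)) + (\<Sum>x\<in>cylinder n (1 # p). pdet n (lap n a \<rho> x))"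
      using sum.union_disjoint[OF fin fin, of "0 # p" "1 # p" "\<lambda>x. pdet n (lap n a \<rho> x)"] by force
    also have "\<dots> = of_nat (tsum (node n a \<rho>) (dleaf n a \<rho>) (Suc d) p)"
      using Suc.IH[of "0 # p"] Suc.IH[of "1 # p"] Suc.prems True
      by (simp only: tsum.simps if_True of_nat_add list.size add_Suc_right add_0_right add_Suc simp_thms)
    finally show ?thesis by (rule sym)
  next
    case False
    have "pdet n (lap n a \<rho> x) = 0" if x: "x \<in> cylinder n p" for x
    proof -
      have "x \<notin> sol n a \<rho> p" using False by blast
      then obtain u where "u < length p" "u = 0 \<or> x u = 0" "dval n a \<rho> x u = 0" using cylinder_not_sol[OF x] by blast
      then show ?thesis using Suc.prems by (intro pdet_lap_zero_column[of u]) auto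
    qed
    then have "(\<Sum>x\<in>cylinder n p. pdet n (lap n a \<rho> x)) = 0" by (rule sum.neutral[OF ballI])
    then show ?thesis using False by simp
  qed
qed

definition adj :: "nat pair_pre_digraph \<Rightarrow> nat \<Rightarrow> nat \<Rightarrow> bit" where
  "adj G u v = (if (u, v) \<in> parcs G then 1 else 0)"

text \<open>Valid for every shift: \<rho> influences the size of the tree, never the parity.\<close>

theorem tsum_dleaf_parity:
  assumes G: "pair_fin_digraph G" "pverts G = {0..<n}" and n: "0 < n"
  shows "tsum (node n (adj G) \<rho>) (dleaf n (adj G) \<rho>) n [] mod 2 = card (hamiltonian_cycles G) mod 2"
proof -
  let ?C = "{r. r permutes {..<n} \<and> orb r = {..<n}}"
  let ?t = "tsum (node n (adj G) \<rho>) (dleaf n (adj G) \<rho>) n []"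
  have fin: "finite ?C" using finite_subset[OF _ finite_permutes] by simp
  have P: "(\<Prod>i<n. adj G i (r i)) = (if \<forall>i<n. (i, r i) \<in> parcs G then 1 else 0)" for r
  proof (cases "\<forall>i<n. (i, r i) \<in> parcs G")
    case True
    then show ?thesis by (simp add: adj_def)
  next
    case False
    then have "\<exists>i\<in>{..<n}. adj G i (r i) = 0" by (auto simp: adj_def)
    then have "(\<Prod>i<n. adj G i (r i)) = 0" by (rule prod_zero[OF finite_lessThan])
    then show ?thesis using False by (simp only: if_False)
  qed
  have "(of_nat ?t :: bit) = (\<Sum>r\<in>?C. if \<forall>i<n. (i, r i) \<in> parcs G then 1 else 0)"
    using tsum_dleaf[of "[]" n n "adj G" \<rho>] sum_pdet_lap[OF n, of "adj G" \<rho>] unfolding P by simp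
  also have "\<dots> = (\<Sum>r\<in>{r \<in> ?C. \<forall>i<n. (i, r i) \<in> parcs G}. 1)"
    unfolding sum.inter_filter[OF fin] ..
  also have "\<dots> = of_nat (card {r \<in> ?C. \<forall>i<n. (i, r i) \<in> parcs G})"
    by (simp only: card_eq_sum of_nat_sum of_nat_1)
  also have "{r \<in> ?C. \<forall>i<n. (i, r i) \<in> parcs G} = {r. r permutes {..<n} \<and> orb r = {..<n} \<and> (\<forall>i<n. (i, r i) \<in> parcs G)}"
    by blast
  also have "card \<dots> = card (hamiltonian_cycles G)" by (rule card_hamiltonian_cycles[OF G n, symmetric])
  finally have "(of_nat ?t :: bit) = of_nat (card (hamiltonian_cycles G))" .
  moreover have "(of_nat k :: bit) = (if odd k then 1 else 0)" for k by (induction k) auto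
  ultimately have "odd ?t = odd (card (hamiltonian_cycles G))" by (metis zero_neq_one)
  then show ?thesis by (metis odd_iff_mod_2_eq_one even_iff_mod_2_eq_zero)
qed

section \<open>Counting solutions by elimination\<close>

text \<open>
  Column \<open>n\<close> of \<open>B\<close> is the right-hand side. Fixing \<open>y c = 0\<close> halves the number of solutions if no row of \<open>U\<close>
  has a pivot in column \<open>c\<close>, and otherwise preserves it once the pivot row is dropped from \<open>U\<close>; no back
  substitution is needed.
\<close>

definition lsol :: "nat \<Rightarrow> nat \<Rightarrow> nat set \<Rightarrow> (nat \<Rightarrow> nat \<Rightarrow> bit) \<Rightarrow> (nat \<Rightarrow> bit) set" where
  "lsol n c U B = {y \<in> cube n. (\<forall>j<c. y j = 0) \<and> (\<forall>i\<in>U. (\<Sum>j<n. B i j * y j) = B i n)}"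

lemma finite_lsol [simp]: "finite (lsol n c U B)"
  by (simp add: lsol_def)

lemma sum_upd_bit:
  fixes b y :: "nat \<Rightarrow> bit"
  assumes "c < n"
  shows "(\<Sum>j<n. b j * (y(c := v)) j) = (\<Sum>j<n. b j * y j) + b c * (y c + v)"
proof -
  have S: "(\<Sum>j<n. f j) = f c + (\<Sum>j\<in>{..<n} - {c}. f j)" for f :: "nat \<Rightarrow> bit"
    using assms by (intro sum.remove) auto
  have E: "(\<Sum>j\<in>{..<n} - {c}. b j * (y(c := v)) j) = (\<Sum>j\<in>{..<n} - {c}. b j * y j)"
    by (rule sum.cong) auto
  have "r * v + s = (r * w + s) + r * (w + v)" for r s w :: bit
    by (cases r; cases s; cases v; cases w) simp_all
  then show ?thesis unfolding S[of "\<lambda>j. b j * (y(c := v)) j"] S[of "\<lambda>j. b j * y j"] E fun_upd_same .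
qed

text \<open>No equation involves \<open>y c\<close>, so the solutions come in pairs that differ only
  there.\<close>

lemma lsol_no_pivot:
  assumes c: "c < n" and B: "\<And>i. i \<in> U \<Longrightarrow> B i c = 0"
  shows "card (lsol n c U B) = 2 * card (lsol n (Suc c) U B)"
proof -
  let ?A = "lsol n (Suc c) U B" and ?f = "\<lambda>y::nat \<Rightarrow> bit. y(c := 1)"
  have inv: "(\<Sum>j<n. B i j * (y(c := v)) j) = (\<Sum>j<n. B i j * y j)" if "i \<in> U" for i y v
    using sum_upd_bit[OF c, of "B i" y v] B[OF that] by (simp only: mult_zero_left add_0_right)
  have mem: "y(c := v) \<in> lsol n c U B" if "y \<in> ?A" for y v
    using that inv c unfolding lsol_def by (auto simp: cube_def simp del: sum_mult_of_bool_eq)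
  have "lsol n c U B = ?A \<union> ?f ` ?A"
  proof (intro equalityI subsetI)
    fix y assume y: "y \<in> lsol n c U B"
    then have y0: "y(c := 0) \<in> ?A"
      using inv c unfolding lsol_def by (auto simp: cube_def less_Suc_eq)
    show "y \<in> ?A \<union> ?f ` ?A"
    proof (cases "y c = 0")
      case True
      then have "y(c := 0) = y" by auto
      then show ?thesis using y0 by simp
    next
      case False
      then have "y = ?f (y(c := 0))" by auto
      then show ?thesis using y0 by blast
    qed
  next
    fix y assume "y \<in> ?A \<union> ?f ` ?A"
    then show "y \<in> lsol n c U B"
    proof
      assume y: "y \<in> ?A"
      then have "y(c := 0) = y" by (auto simp: lsol_def fun_eq_iff)
      then show ?thesis using mem[OF y, of 0] by simp
    qed (use mem in auto)
  qed
  moreover have "?A \<inter> ?f ` ?A = {}" unfolding lsol_def by auto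
  moreover have "inj_on ?f ?A"
  proof (rule inj_on_inverseI[where g = "\<lambda>y. y(c := 0)"])
    fix y assume "y \<in> ?A" then show "(?f y)(c := 0) = y" by (auto simp: lsol_def fun_eq_iff)
  qed
  ultimately show ?thesis by (simp add: card_Un_disjoint card_image)
qed

text \<open>Row \<open>q\<close> expresses \<open>y c\<close> through the other coordinates.
  Substituting this into the remaining rows amounts to adding row \<open>q\<close> to those with
  entry 1 in column \<open>c\<close>; afterwards column \<open>c\<close> is zero in all of them, and
  \<open>y c\<close> can be normalised to 0.\<close>

lemma lsol_pivot:
  assumes c: "c < n" and q: "q \<in> U" "B q c = 1"
    and B': "\<And>i j. i \<in> U - {q} \<Longrightarrow> j \<le> n \<Longrightarrow> B' i j = (if B i c = 1 then B i j + B q j else B i j)"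
  shows "card (lsol n c U B) = card (lsol n (Suc c) (U - {q}) B')"
proof -
  let ?s = "\<lambda>B i y. \<Sum>j<n. B i j * y j"
  \<comment> \<open>The value that row \<open>q\<close> forces on coordinate \<open>c\<close>, when
    \<open>y\<close> has been cleared there.\<close>
  let ?v = "\<lambda>y. B q n + ?s B q y"
  have s': "?s B' i y = (if B i c = 1 then ?s B i y + ?s B q y else ?s B i y)" if "i \<in> U - {q}" for i y
  proof -
    have "?s B' i y = (\<Sum>j<n. (if B i c = 1 then B i j + B q j else B i j) * y j)"
      by (rule sum.cong[OF refl]) (simp only: B'[OF that] less_imp_le lessThan_iff)
    then show ?thesis
      by (cases "B i c = 1") (simp_all only: if_True if_False simp_thms distrib_right sum.distrib)
  qed
  have upd: "?s B i (y(c := v)) = ?s B i y + B i c * (y c + v)" for i y v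
    by (rule sum_upd_bit[OF c])
  have fwd: "y(c := 0) \<in> lsol n (Suc c) (U - {q}) B'" if y: "y \<in> lsol n c U B" for y
  proof -
    have "?s B' i (y(c := 0)) = B' i n" if i: "i \<in> U - {q}" for i
    proof -
      have e: "?s B i y = B i n" "?s B q y = B q n" using y i q unfolding lsol_def by auto
      show ?thesis unfolding s'[OF i] upd e B'[OF i order_refl] q(2)
        by (cases "B i c"; cases "y c"; cases "B i n"; cases "B q n") simp_all
    qed
    then show ?thesis using y c unfolding lsol_def by (auto simp: cube_def less_Suc_eq)
  qed
  have bwd: "y(c := ?v y) \<in> lsol n c U B" if y: "y \<in> lsol n (Suc c) (U - {q}) B'" for y
  proof -
    have yc: "y c = 0" using y by (simp add: lsol_def)
    have "?s B i (y(c := ?v y)) = B i n" if i: "i \<in> U" for i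
    proof (cases "i = q")
      case True
      show ?thesis unfolding True upd q(2) yc
        by (cases "?s B q y"; cases "B q n") (simp_all only: mult_1 add_0 add_0_right bit_add_self)
    next
      case False
      then have i': "i \<in> U - {q}" using i by simp
      then have "?s B' i y = B' i n" using y unfolding lsol_def by blast
      then show ?thesis unfolding s'[OF i'] B'[OF i' order_refl] upd yc
        by (cases "B i c"; cases "?s B i y"; cases "?s B q y"; cases "B i n"; cases "B q n")
          (simp_all only: mult_1 mult_zero_left add_0 add_0_right bit_add_self if_True if_False simp_thms zero_neq_one one_neq_zero)
    qed
    then show ?thesis using y c unfolding lsol_def by (auto simp: cube_def)
  qed
  have "bij_betw (\<lambda>y. y(c := 0)) (lsol n c U B) (lsol n (Suc c) (U - {q}) B')"
  proof (rule bij_betw_byWitness[where f' = "\<lambda>y. y(c := ?v y)"])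
    show "\<forall>y\<in>lsol n c U B. (y(c := 0))(c := ?v (y(c := 0))) = y"
    proof
      fix y assume "y \<in> lsol n c U B"
      then have e: "?s B q y = B q n" using q unfolding lsol_def by auto
      have "?v (y(c := 0)) = y c" unfolding upd q(2) e
        by (cases "B q n"; cases "y c") simp_all
      then show "(y(c := 0))(c := ?v (y(c := 0))) = y" by (simp only: fun_upd_upd fun_upd_triv)
    qed
    show "\<forall>y\<in>lsol n (Suc c) (U - {q}) B'. (y(c := ?v y))(c := 0) = y"
    proof
      fix y assume "y \<in> lsol n (Suc c) (U - {q}) B'"
      then have "y c = 0" by (simp add: lsol_def)
      then show "(y(c := ?v y))(c := 0) = y" by (metis fun_upd_upd fun_upd_triv)
    qed
  qed (use fwd bwd in auto)
  then show ?thesis by (rule bij_betw_same_card)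
qed

text \<open>The zero vector is the only candidate left, and it solves exactly the rows with
  right-hand side 0.\<close>

lemma lsol_final: "card (lsol n n U B) = (if \<forall>i\<in>U. B i n = 0 then 1 else 0)"
proof -
  have "lsol n n U B = (if \<forall>i\<in>U. B i n = 0 then {\<lambda>_. 0} else {})"
  proof -
    have z: "y = (\<lambda>_. 0)" if "y \<in> cube n" "\<forall>j<n. y j = 0" for y
      using that by (auto simp: cube_def fun_eq_iff not_less[symmetric] simp del: bit_neq_0)
    have "y = (\<lambda>_. 0) \<and> (\<forall>i\<in>U. B i n = 0)" if y: "y \<in> lsol n n U B" for y
    proof -
      have y0: "y = (\<lambda>_. 0)" by (rule z) (use y in \<open>simp_all add: lsol_def\<close>)
      have "\<forall>i\<in>U. (\<Sum>j<n. B i j * y j) = B i n" using y unfolding lsol_def by blast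
      then show ?thesis unfolding y0 by simp
    qed
    moreover have "(\<lambda>_. 0) \<in> lsol n n U B" if "\<forall>i\<in>U. B i n = 0"
      using that by (simp add: lsol_def cube_def)
    ultimately show ?thesis by auto
  qed
  then show ?thesis by simp
qed

lemma sol_eq: "sol n a \<rho> p = {x \<in> cube n. \<forall>i<length p. x i = point p i \<and>
    (i = 0 \<or> point p i = 0 \<longrightarrow> dval n a \<rho> x i = 1)}"
proof (induction p)
  case (Cons b p)
  have "point (b # p) i = point p i" if "i < length p" for i using that by (simp add: point_def nth_append)
  moreover have "point (b # p) (length p) = b" by (simp add: point_def nth_append)
  ultimately show ?case unfolding sol.simps Cons.IH by (auto simp: less_Suc_eq)
qed simp

text \<open>The system has \<open>2 * n\<close> rows whatever the length of the prefix: row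
  \<open>i\<close> fixes coordinate \<open>i\<close>, and row \<open>n + i\<close> is the forced
  equation with \<rho> i moved to the right-hand side. Rows without a task are zero and hold
  trivially.\<close>

lemma lsol_prefix_system:
  assumes m: "length p \<le> n"
    and unit: "\<And>i j. i < length p \<Longrightarrow> j < n \<Longrightarrow> B i j = (if j = i then 1 else 0)"
      "\<And>i. i < length p \<Longrightarrow> B i n = point p i"
    and con: "\<And>i j. i < length p \<Longrightarrow> i = 0 \<or> point p i = 0 \<Longrightarrow> j < n \<Longrightarrow> B (n + i) j = a i j"
      "\<And>i. i < length p \<Longrightarrow> i = 0 \<or> point p i = 0 \<Longrightarrow> B (n + i) n = 1 + \<rho> i"
    and zero: "\<And>i j. i < n \<Longrightarrow> \<not> i < length p \<Longrightarrow> j \<le> n \<Longrightarrow> B i j = 0"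
      "\<And>i j. i < n \<Longrightarrow> \<not> (i < length p \<and> (i = 0 \<or> point p i = 0)) \<Longrightarrow> j \<le> n \<Longrightarrow> B (n + i) j = 0"
  shows "lsol n 0 {..<n + n} B = sol n a \<rho> p"
proof -
  let ?s = "\<lambda>i y. \<Sum>j<n. B i j * y j"
  have u: "?s i y = B i n \<longleftrightarrow> y i = point p i" if i: "i < length p" for i y
  proof -
    have "?s i y = (\<Sum>j<n. if j = i then y j else 0)"
      by (rule sum.cong[OF refl]) (use unit i in auto)
    also have "\<dots> = y i" using i m by (subst sum.delta) auto
    finally show ?thesis using unit(2)[OF i] by simp
  qed
  have z: "?s i y = B i n" if "\<And>j. j \<le> n \<Longrightarrow> B i j = 0" for i y
  proof -
    have "?s i y = 0" by (rule sum.neutral) (simp add: that)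
    then show ?thesis using that[OF order_refl] by (simp only:)
  qed
  have k: "?s (n + i) y = B (n + i) n \<longleftrightarrow> dval n a \<rho> y i = 1" if i: "i < length p" "i = 0 \<or> point p i = 0" for i y
  proof -
    have "?s (n + i) y = (\<Sum>j<n. a i j * y j)"
      by (rule sum.cong[OF refl]) (simp only: con(1)[OF i] lessThan_iff)
    moreover have "s = 1 + r \<longleftrightarrow> s + r = 1" for s r :: bit by (cases s; cases r) simp_all
    ultimately show ?thesis unfolding con(2)[OF i] dval_def by (simp only:)
  qed
  have "(\<forall>i\<in>{..<n + n}. ?s i y = B i n) \<longleftrightarrow> (\<forall>i<length p. y i = point p i \<and>
    (i = 0 \<or> point p i = 0 \<longrightarrow> dval n a \<rho> y i = 1))" (is "?L \<longleftrightarrow> ?R") for y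
  proof
    assume L: ?L
    show ?R
    proof (intro allI impI conjI)
      fix i assume i: "i < length p"
      then have i2: "i \<in> {..<n + n}" "n + i \<in> {..<n + n}" using m by auto
      show "y i = point p i" using bspec[OF L i2(1)] u[OF i] by (simp only:)
      assume "i = 0 \<or> point p i = 0"
      then show "dval n a \<rho> y i = 1" using bspec[OF L i2(2)] k[OF i] by (simp only: simp_thms)
    qed
  next
    assume R: ?R
    show ?L
    proof
      fix i assume "i \<in> {..<n + n}"
      then consider "i < n" | k where "i = n + k" "k < n" by (metis add_diff_inverse lessThan_iff nat_add_left_cancel_less)
      then show "?s i y = B i n"
      proof cases
        case 1
        show ?thesis
        proof (cases "i < length p")
          case True
          then show ?thesis using u R by blast
        next
          case False
          show ?thesis by (rule z) (rule zero(1)[OF 1 False])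
        qed
      next
        case (2 l)
        show ?thesis
        proof (cases "l < length p \<and> (l = 0 \<or> point p l = 0)")
          case True
          then show ?thesis using k[of l y] R 2 by blast
        next
          case False
          show ?thesis unfolding 2 by (rule z) (rule zero(2)[OF 2(2) False])
        qed
      qed
    qed
  qed
  then show ?thesis unfolding lsol_def sol_eq by auto
qed

section \<open>Determinants by counting kernel vectors\<close>

lemma pdet_eq_det: "pdet n M = det (mat n n (\<lambda>(i, j). M i j))" for M :: "nat \<Rightarrow> nat \<Rightarrow> bit"
proof -
  have sg: "(of_int (sign p) :: bit) = 1" for p :: "nat \<Rightarrow> nat" by (simp add: sign_def)
  have A: "mat n n (\<lambda>(i, j). M i j) \<in> carrier_mat n n" by simp
  show ?thesis unfolding det_def'[OF A] pdet_def sg lessThan_atLeast0 mult_1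
  proof (rule sum.cong[OF refl], rule prod.cong[OF refl])
    fix p i assume "p \<in> {p. p permutes {0..<n}}" "i \<in> {0..<n}"
    then have "i < n" "p i < n" using permutes_in_image[of p "{0..<n}" i] by auto
    then show "M i (p i) = mat n n (\<lambda>(i, j). M i j) $$ (i, p i)" by simp
  qed
qed

lemma card_eq_1_iff_mem:
  assumes "z \<in> K"
  shows "card K = 1 \<longleftrightarrow> (\<forall>y\<in>K. y = z)"
proof
  assume "card K = 1"
  then obtain w where "K = {w}" by (rule card_1_singletonE)
  then show "\<forall>y\<in>K. y = z" using assms by blast
next
  assume "\<forall>y\<in>K. y = z"
  then have "K = {z}" using assms by blast
  then show "card K = 1" by simp
qed

text \<open>A determinant over a field is nonzero iff the kernel is trivial, that is, iff the
  homogeneous system has exactly one solution. Thus the elimination used at the nodes also evaluates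
  the leaves. \<open>B\<close> is \<open>M\<close> padded with \<open>n\<close> zero rows and a zero
  right-hand side to the common format.\<close>

lemma pdet_lsol:
  assumes "\<And>i. i < n \<Longrightarrow> B i n = 0" "\<And>i j. i < n \<Longrightarrow> j \<le> n \<Longrightarrow> B (n + i) j = 0"
    "\<And>i j. i < n \<Longrightarrow> j < n \<Longrightarrow> B i j = M i j"
  shows "pdet n M = 1 \<longleftrightarrow> card (lsol n 0 {..<n + n} B) = 1"
proof -
  let ?A = "mat n n (\<lambda>(i, j). M i j)"
  let ?K = "{y \<in> cube n. \<forall>i<n. (\<Sum>j<n. M i j * y j) = 0}"
  have K: "lsol n 0 {..<n + n} B = ?K"
  proof -
    have 1: "(\<Sum>j<n. B i j * y j) = (\<Sum>j<n. M i j * y j)" if "i < n" for i y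
      by (rule sum.cong[OF refl]) (use assms(3) that in \<open>simp only: lessThan_iff\<close>)
    have 2: "(\<Sum>j<n. B (n + i) j * y j) = 0" if "i < n" for i y
      by (rule sum.neutral) (use assms(2) that in auto)
    have "(\<forall>i\<in>{..<n + n}. (\<Sum>j<n. B i j * y j) = B i n) \<longleftrightarrow> (\<forall>i<n. (\<Sum>j<n. M i j * y j) = 0)" for y
    proof
      assume *: "\<forall>i<n. (\<Sum>j<n. M i j * y j) = 0"
      show "\<forall>i\<in>{..<n + n}. (\<Sum>j<n. B i j * y j) = B i n"
      proof
        fix i assume "i \<in> {..<n + n}"
        then consider "i < n" | k where "i = n + k" "k < n" by (metis add_diff_inverse lessThan_iff nat_add_left_cancel_less)
        then show "(\<Sum>j<n. B i j * y j) = B i n"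
          using 1 2 * assms(1,2) by cases (metis, metis order_refl)
      qed
    qed (metis 1 assms(1) lessThan_iff trans_less_add1)
    then show ?thesis unfolding lsol_def by auto
  qed
  have zero: "(\<lambda>_. 0) \<in> ?K" by (simp add: cube_def)
  have mv: "?A *\<^sub>v v = 0\<^sub>v n \<longleftrightarrow> (\<forall>i<n. (\<Sum>j<n. M i j * v $ j) = 0)" if "v \<in> carrier_vec n" for v
  proof -
    have "(?A *\<^sub>v v) $ i = (\<Sum>j<n. M i j * v $ j)" if "i < n" for i
      using that \<open>v \<in> carrier_vec n\<close> by (auto simp: scalar_prod_def lessThan_atLeast0 intro!: sum.cong)
    then show ?thesis by (auto simp: vec_eq_iff)
  qed
  have det: "pdet n M = 0 \<longleftrightarrow> (\<exists>v. v \<in> carrier_vec n \<and> v \<noteq> 0\<^sub>v n \<and> ?A *\<^sub>v v = 0\<^sub>v n)"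
    unfolding pdet_eq_det by (rule det_0_iff_vec_prod_zero_field) simp
  have "pdet n M = 0 \<longleftrightarrow> (\<exists>y\<in>?K. y \<noteq> (\<lambda>_. 0))"
  proof
    assume "pdet n M = 0"
    then obtain v where v: "v \<in> carrier_vec n" "v \<noteq> 0\<^sub>v n" "?A *\<^sub>v v = 0\<^sub>v n" using det by blast
    define y where "y j = (if j < n then v $ j else 0)" for j
    obtain j where "j < n" "v $ j \<noteq> 0" using v(1,2) by (auto simp: vec_eq_iff)
    then have "y \<noteq> (\<lambda>_. 0)" by (metis y_def)
    have "(\<Sum>j<n. M i j * y j) = (\<Sum>j<n. M i j * v $ j)" for i
      by (rule sum.cong[OF refl]) (simp only: y_def lessThan_iff if_True)
    then have "\<forall>i<n. (\<Sum>j<n. M i j * y j) = 0" using v(3) mv[OF v(1)] by (simp only:)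
    moreover have "y \<in> cube n" by (simp add: cube_def y_def)
    ultimately have "y \<in> ?K" by blast
    with \<open>y \<noteq> (\<lambda>_. 0)\<close> show "\<exists>y\<in>?K. y \<noteq> (\<lambda>_. 0)" by blast
  next
    assume "\<exists>y\<in>?K. y \<noteq> (\<lambda>_. 0)"
    then obtain y where y: "y \<in> ?K" "y \<noteq> (\<lambda>_. 0)" by blast
    let ?v = "vec n y"
    have "(\<Sum>j<n. M i j * ?v $ j) = (\<Sum>j<n. M i j * y j)" for i
      by (rule sum.cong[OF refl]) (simp only: index_vec lessThan_iff)
    then have "?A *\<^sub>v ?v = 0\<^sub>v n" using y(1) by (subst mv) auto
    moreover obtain j where "y j \<noteq> 0" using y(2) by (metis ext)
    then have "j < n" using y(1) by (auto simp: cube_def not_less[symmetric])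
    then have "?v \<noteq> 0\<^sub>v n" using \<open>y j \<noteq> 0\<close> by (metis index_vec index_zero_vec(1))
    ultimately show "pdet n M = 0" unfolding det by (intro exI[of _ ?v]) simp
  qed
  moreover have "card ?K = 1 \<longleftrightarrow> (\<forall>y\<in>?K. y = (\<lambda>_. 0))"
    using zero by (rule card_eq_1_iff_mem)
  moreover have "pdet n M = 1 \<longleftrightarrow> \<not> pdet n M = 0" by (rule bit_neq_0[symmetric])
  ultimately show ?thesis unfolding K by (simp only: bex_simps ball_simps) blast
qed

section \<open>A structured language compiled to the machine\<close>

datatype exp = N nat | Ix nat exp | Plus exp exp | Minus exp exp

datatype com =
    Skip
  | Put nat exp exp
  | Get nat exp
  | Out exp
  | Seq com com  (infixr ";;" 60)
  | If exp com com
  | While exp com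

record st =
  mm :: "nat \<Rightarrow> nat \<Rightarrow> nat"
  ins :: "nat list"
  outs :: "nat list"
  tm :: nat

fun val :: "(nat \<Rightarrow> nat \<Rightarrow> nat) \<Rightarrow> exp \<Rightarrow> nat" where
  "val m (N c) = c"
| "val m (Ix k e) = m k (val m e)"
| "val m (Plus a b) = val m a + val m b"
| "val m (Minus a b) = val m a - val m b"

definition tick :: "st \<Rightarrow> st" where
  "tick s = s\<lparr>tm := tm s + 1\<rparr>"

definition put :: "nat \<Rightarrow> nat \<Rightarrow> nat \<Rightarrow> st \<Rightarrow> st" where
  "put k i v s = s\<lparr>mm := (mm s)(k := (mm s k)(i := v)), tm := tm s + 1\<rparr>"

definition hd0 :: "nat list \<Rightarrow> nat" where
  "hd0 xs = (case xs of [] \<Rightarrow> 0 | x # _ \<Rightarrow> x)"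

text \<open>Only \<open>Put\<close> and \<open>Get\<close> check the bounds \<open>B\<close> on
  values and \<open>S\<close> on indices, as they alone write to the arrays. \<open>Skip\<close> and
  sequencing take no time because they compile to no instructions of their own.\<close>

inductive ev :: "nat \<Rightarrow> nat \<Rightarrow> com \<Rightarrow> st \<Rightarrow> st \<Rightarrow> bool" for B S where
  Skip: "ev B S Skip s s"
| Put: "val (mm s) e \<le> B \<Longrightarrow> val (mm s) i < S \<Longrightarrow> ev B S (Put k i e) s (put k (val (mm s) i) (val (mm s) e) s)"
| Get: "hd0 (ins s) \<le> B \<Longrightarrow> val (mm s) i < S \<Longrightarrow>
    ev B S (Get k i) s ((put k (val (mm s) i) (hd0 (ins s)) s)\<lparr>ins := tl (ins s)\<rparr>)"
| Out: "ev B S (Out e) s ((tick s)\<lparr>outs := outs s @ [val (mm s) e]\<rparr>)"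
| Seq: "ev B S c s s' \<Longrightarrow> ev B S d s' s'' \<Longrightarrow> ev B S (c ;; d) s s''"
| IfT: "0 < val (mm s) e \<Longrightarrow> ev B S c (tick s) s' \<Longrightarrow> ev B S (If e c d) s s'"
| IfF: "val (mm s) e = 0 \<Longrightarrow> ev B S d (tick s) s' \<Longrightarrow> ev B S (If e c d) s s'"
| WhileF: "val (mm s) e = 0 \<Longrightarrow> ev B S (While e c) s (tick s)"
| WhileT: "0 < val (mm s) e \<Longrightarrow> ev B S c (tick s) s' \<Longrightarrow> ev B S (While e c) s' s'' \<Longrightarrow>
    ev B S (While e c) s s''"

text \<open>
  Entry \<open>i\<close> of array \<open>k < 15\<close> lives at address \<open>16 * i + k\<close>; the addresses \<open>16 * d + 15\<close> hold
  intermediate values of expressions.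
\<close>

abbreviation tmp :: "nat \<Rightarrow> nat" where "tmp d \<equiv> 16 * d + 15"

text \<open>The value is left in \<open>tmp d\<close>, and no temporary below depth \<open>d\<close>
  is touched, so \<open>d\<close> acts as a stack pointer. The four additions double an index four
  times, which replaces the missing multiplication by 16.\<close>

fun cexp :: "exp \<Rightarrow> nat \<Rightarrow> instr list" where
  "cexp (N c) d = [Const (tmp d) c]"
| "cexp (Ix k e) d = cexp e d @ replicate 4 (Add (tmp d) (tmp d) (tmp d)) @
     [Const (tmp (Suc d)) k, Add (tmp d) (tmp d) (tmp (Suc d)), Load (tmp d) (tmp d)]"
| "cexp (Plus a b) d = cexp a d @ cexp b (Suc d) @ [Add (tmp d) (tmp d) (tmp (Suc d))]"
| "cexp (Minus a b) d = cexp a d @ cexp b (Suc d) @ [Sub (tmp d) (tmp d) (tmp (Suc d))]"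

definition caddr :: "nat \<Rightarrow> exp \<Rightarrow> instr list" where
  "caddr k e = cexp e 0 @ replicate 4 (Add (tmp 0) (tmp 0) (tmp 0)) @
     [Const (tmp 1) k, Add (tmp 0) (tmp 0) (tmp 1)]"

text \<open>Jump targets in \<open>comp\<close> depend on the lengths of the pieces, and these are
  the same for every start address.\<close>

fun clen :: "com \<Rightarrow> nat" where
  "clen Skip = 0"
| "clen (Put k i e) = length (caddr k i) + length (cexp e 1) + 1"
| "clen (Get k i) = length (caddr k i) + 2"
| "clen (Out e) = length (cexp e 0) + 1"
| "clen (c ;; d) = clen c + clen d"
| "clen (If e c d) = length (cexp e 0) + 3 + clen c + clen d"
| "clen (While e c) = length (cexp e 0) + 5 + clen c"

text \<open>Jump targets are absolute, hence the start address \<open>a\<close>. An unconditional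
  jump is a \<open>JumpPos\<close> on a temporary just set to 1. The else branch is placed before
  the then branch because falling through means that the test was 0.\<close>

fun comp :: "nat \<Rightarrow> com \<Rightarrow> instr list" where
  "comp a Skip = []"
| "comp a (Put k i e) = caddr k i @ cexp e 1 @ [Store (tmp 0) (tmp 1)]"
| "comp a (Get k i) = caddr k i @ [Read (tmp 1), Store (tmp 0) (tmp 1)]"
| "comp a (Out e) = cexp e 0 @ [Print (tmp 0)]"
| "comp a (c ;; d) = comp a c @ comp (a + clen c) d"
| "comp a (If e c d) = (let l = length (cexp e 0) in
     cexp e 0 @ [JumpPos (a + l + 3 + clen d) (tmp 0)] @ comp (a + l + 1) d @
     [Const (tmp 0) 1, JumpPos (a + l + 3 + clen d + clen c) (tmp 0)] @ comp (a + l + 3 + clen d) c)"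
| "comp a (While e c) = (let l = length (cexp e 0) in
     cexp e 0 @ [JumpPos (a + l + 3) (tmp 0), Const (tmp 0) 1, JumpPos (a + l + 5 + clen c) (tmp 0)] @
     comp (a + l + 3) c @ [Const (tmp 0) 1, JumpPos a (tmp 0)])"

lemma length_comp [simp]: "length (comp a c) = clen c"
  by (induction c arbitrary: a) (auto simp: Let_def)

text \<open>A bound, in units of \<open>B + 1\<close>, on every number that arises while the
  expression is evaluated. For an array access it has to cover the address \<open>16 * i + k\<close>
  as well as the entry.\<close>

fun emag :: "exp \<Rightarrow> nat" where
  "emag (N c) = c"
| "emag (Ix k e) = 16 * emag e + k + 1"
| "emag (Plus a b) = emag a + emag b"
| "emag (Minus a b) = emag a + emag b"

text \<open>Levels of temporaries reserved for the expression. The second operand is evaluated one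
  level higher, above the stored value of the first, hence the successor of a maximum.\<close>

fun esize :: "exp \<Rightarrow> nat" where
  "esize (N c) = 1"
| "esize (Ix k e) = esize e + 2"
| "esize (Plus a b) = Suc (max (esize a) (esize b))"
| "esize (Minus a b) = Suc (max (esize a) (esize b))"

fun ewf :: "exp \<Rightarrow> bool" where
  "ewf (N c) = True"
| "ewf (Ix k e) = (k < 15 \<and> ewf e)"
| "ewf (Plus a b) = (ewf a \<and> ewf b)"
| "ewf (Minus a b) = (ewf a \<and> ewf b)"

fun cmag :: "com \<Rightarrow> nat" where
  "cmag Skip = 1"
| "cmag (Put k i e) = 16 * emag i + emag e + k + 1"
| "cmag (Get k i) = 16 * emag i + k + 1"
| "cmag (Out e) = emag e + 1"
| "cmag (c ;; d) = cmag c + cmag d"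
| "cmag (If e c d) = emag e + cmag c + cmag d"
| "cmag (While e c) = emag e + cmag c"

fun csize :: "com \<Rightarrow> nat" where
  "csize Skip = 2"
| "csize (Put k i e) = esize i + esize e + 2"
| "csize (Get k i) = esize i + 2"
| "csize (Out e) = esize e + 2"
| "csize (c ;; d) = csize c + csize d"
| "csize (If e c d) = esize e + csize c + csize d"
| "csize (While e c) = esize e + csize c"

fun cwf :: "com \<Rightarrow> bool" where
  "cwf Skip = True"
| "cwf (Put k i e) = (k < 15 \<and> ewf i \<and> ewf e)"
| "cwf (Get k i) = (k < 15 \<and> ewf i)"
| "cwf (Out e) = ewf e"
| "cwf (c ;; d) = (cwf c \<and> cwf d)"
| "cwf (If e c d) = (ewf e \<and> cwf c \<and> cwf d)"
| "cwf (While e c) = (ewf e \<and> cwf c)"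

section \<open>Correctness of the compiler\<close>

text \<open>\<open>X\<close> bounds the register contents and inputs, \<open>A\<close> the addresses in use.\<close>

definition good :: "nat \<Rightarrow> nat \<Rightarrow> config \<Rightarrow> bool" where
  "good X A s \<longleftrightarrow> (\<forall>r. mem s r \<le> X \<and> (mem s r \<noteq> 0 \<longrightarrow> r < A)) \<and> (\<forall>x\<in>set (inp s). x \<le> X)"

text \<open>Goodness is demanded at every intermediate configuration, because the cost of each step
  and the maximum of the memory sizes are both derived from it.\<close>

definition reach :: "nat \<Rightarrow> nat \<Rightarrow> instr list \<Rightarrow> config \<Rightarrow> nat \<Rightarrow> config \<Rightarrow> bool" where
  "reach X A P s t s' \<longleftrightarrow> s' = (step P ^^ t) s \<and>
     (\<forall>k\<le>t. good X A ((step P ^^ k) s)) \<and> (\<forall>k<t. \<not> halted P ((step P ^^ k) s))"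

lemma reach_0: "good X A s \<Longrightarrow> reach X A P s 0 s"
  by (simp add: reach_def)

lemma reach_trans:
  assumes "reach X A P s t s'" "reach X A P s' u s''"
  shows "reach X A P s (t + u) s''"
proof -
  have e: "(step P ^^ (t + j)) s = (step P ^^ j) s'" for j
    using assms(1) by (simp add: reach_def funpow_add add.commute[of t])
  have split: "k = t + (k - t)" if "\<not> k < t" for k using that by simp
  show ?thesis unfolding reach_def
  proof (intro conjI allI impI)
    show "s'' = (step P ^^ (t + u)) s" using assms(2) e by (simp add: reach_def)
    fix k
    {
      assume "k \<le> t + u"
      show "good X A ((step P ^^ k) s)"
      proof (cases "k < t")
        case True then show ?thesis using assms(1) by (simp add: reach_def)
      next
        case False
        have "k - t \<le> u" using \<open>k \<le> t + u\<close> False by simp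
        then show ?thesis using assms(2) e[of "k - t"] split[OF False] by (simp add: reach_def)
      qed
    next
      assume "k < t + u"
      show "\<not> halted P ((step P ^^ k) s)"
      proof (cases "k < t")
        case True then show ?thesis using assms(1) by (simp add: reach_def)
      next
        case False
        have "k - t < u" using \<open>k < t + u\<close> False by simp
        then show ?thesis using assms(2) e[of "k - t"] split[OF False] by (simp add: reach_def)
      qed
    }
  qed
qed

lemma reach_step:
  assumes "pc s < length P" "P ! pc s = i" "good X A s" "good X A (exec i s)"
  shows "reach X A P s 1 (exec i s)"
proof -
  have s: "step P s = exec i s" using assms by (simp add: step_def halted_def)
  have "good X A ((step P ^^ k) s)" if "k \<le> 1" for k
    using that assms s by (cases k) auto
  then show ?thesis unfolding reach_def using assms s by (auto simp: halted_def)
qed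

definition code_at :: "instr list \<Rightarrow> nat \<Rightarrow> instr list \<Rightarrow> bool" where
  "code_at P a c \<longleftrightarrow> a + length c \<le> length P \<and> (\<forall>j<length c. P ! (a + j) = c ! j)"

lemma code_at_append: "code_at P a (c @ d) \<longleftrightarrow> code_at P a c \<and> code_at P (a + length c) d"
proof
  assume "code_at P a (c @ d)"
  then show "code_at P a c \<and> code_at P (a + length c) d" unfolding code_at_def
    by (auto simp: nth_append) (metis add.assoc add_diff_cancel_left' nat_add_left_cancel_less not_add_less1)
next
  assume L: "code_at P a c \<and> code_at P (a + length c) d"
  have "P ! (a + j) = (c @ d) ! j" if "j < length c + length d" for j
  proof (cases "j < length c")
    case False
    then have "j - length c < length d" and e: "a + j = a + length c + (j - length c)" using that by auto
    then have "P ! (a + length c + (j - length c)) = d ! (j - length c)" using L unfolding code_at_def by blast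
    then have "P ! (a + j) = d ! (j - length c)" by (subst e)
    then show ?thesis using False by (simp add: nth_append)
  qed (use L in \<open>auto simp: code_at_def nth_append\<close>)
  then show "code_at P a (c @ d)" using L by (auto simp: code_at_def)
qed

lemma code_at_Cons: "code_at P a (i # c) \<longleftrightarrow> a < length P \<and> P ! a = i \<and> code_at P (Suc a) c"
  using code_at_append[of P a "[i]" c] by (auto simp: code_at_def)

lemma code_at_Nil: "code_at P a [] \<longleftrightarrow> a \<le> length P"
  by (simp add: code_at_def)

definition rel :: "(nat \<Rightarrow> nat \<Rightarrow> nat) \<Rightarrow> (nat \<Rightarrow> nat) \<Rightarrow> bool" where
  "rel M m \<longleftrightarrow> (\<forall>k<15. \<forall>i. m (16 * i + k) = M k i)"

lemma good_upd:
  "good X A s \<Longrightarrow> v \<le> X \<Longrightarrow> r < A \<Longrightarrow> good X A (s\<lparr>pc := p, mem := (mem s)(r := v)\<rparr>)"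
  by (auto simp: good_def)

lemma val_le_emag:
  assumes "\<And>k i. M k i \<le> B"
  shows "val M e \<le> emag e * (B + 1)"
proof (induction e)
  case (Ix k e)
  have "M k (val M e) \<le> B" by (rule assms)
  also have "B \<le> emag (Ix k e) * (B + 1)" by simp
  finally show ?case by simp
qed (auto simp: algebra_simps intro: add_mono le_trans[OF diff_le_self])

lemma tmp_neq [simp]: "tmp d = tmp d' \<longleftrightarrow> d = d'"
  by auto

lemma scaled_neq_tmp: "k < 15 \<Longrightarrow> 16 * i + k \<noteq> tmp d"
proof
  assume k: "k < 15" and "16 * i + k = tmp d"
  then have "(16 * i + k) mod 16 = (16 * d + 15) mod 16" by simp
  then show False using k by simp
qed

text \<open>What an evaluation at depth \<open>d\<close> leaves alone: all arrays, the input and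
  output, and the temporaries of smaller depth.\<close>

definition keeps :: "nat \<Rightarrow> config \<Rightarrow> config \<Rightarrow> bool" where
  "keeps d s s' \<longleftrightarrow> (\<forall>r. (\<forall>d'\<ge>d. r \<noteq> tmp d') \<longrightarrow> mem s' r = mem s r) \<and> inp s' = inp s \<and> out s' = out s"

lemma keeps_trans: "keeps d s s' \<Longrightarrow> keeps d' s' s'' \<Longrightarrow> d \<le> d' \<Longrightarrow> keeps d s s''"
  unfolding keeps_def by (metis le_trans)

lemma keeps_rel: "keeps d s s' \<Longrightarrow> rel M (mem s) \<Longrightarrow> rel M (mem s')"
  unfolding keeps_def rel_def by (metis scaled_neq_tmp)

lemma keeps_tmp: "keeps d s s' \<Longrightarrow> d' < d \<Longrightarrow> mem s' (tmp d') = mem s (tmp d')"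
  unfolding keeps_def by (metis tmp_neq not_le)

lemma reach_set_tmp:
  assumes "code_at P (pc s) [i]" "good X A s"
    and i: "exec i s = s\<lparr>pc := Suc (pc s), mem := (mem s)(tmp d := v)\<rparr>"
    and "v \<le> X" "tmp d < A"
  shows "\<exists>s'. reach X A P s 1 s' \<and> pc s' = Suc (pc s) \<and> mem s' = (mem s)(tmp d := v) \<and>
    inp s' = inp s \<and> out s' = out s \<and> good X A s'"
proof -
  have g: "good X A (exec i s)" unfolding i by (rule good_upd) (use assms in auto)
  have "reach X A P s 1 (exec i s)"
    using assms(1) by (intro reach_step g assms(2)) (auto simp: code_at_Cons)
  then show ?thesis using g unfolding i by (intro exI[of _ "exec i s"]) (simp add: i)
qed

lemma reach_scale:
  assumes "code_at P (pc s) (replicate 4 (Add (tmp d) (tmp d) (tmp d)) @ [Const (tmp (Suc d)) k, Add (tmp d) (tmp d) (tmp (Suc d))])"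
    and g: "good X A s" and v: "mem s (tmp d) = v" "16 * v + k \<le> X" and A: "tmp (Suc d) < A"
  shows "\<exists>s'. reach X A P s 6 s' \<and> pc s' = pc s + 6 \<and> mem s' (tmp d) = 16 * v + k \<and>
    keeps d s s' \<and> good X A s'"
proof -
  have c: "code_at P (pc s) [Add (tmp d) (tmp d) (tmp d)]" "code_at P (Suc (pc s)) [Add (tmp d) (tmp d) (tmp d)]"
    "code_at P (Suc (Suc (pc s))) [Add (tmp d) (tmp d) (tmp d)]"
    "code_at P (Suc (Suc (Suc (pc s)))) [Add (tmp d) (tmp d) (tmp d)]"
    "code_at P (Suc (Suc (Suc (Suc (pc s))))) [Const (tmp (Suc d)) k]"
    "code_at P (Suc (Suc (Suc (Suc (Suc (pc s)))))) [Add (tmp d) (tmp d) (tmp (Suc d))]"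
    using assms(1) by (auto simp: code_at_Cons code_at_Nil numeral_eq_Suc)
  have d: "tmp d < A" using A by simp
  obtain s1 where 1: "reach X A P s 1 s1" "pc s1 = Suc (pc s)" "mem s1 = (mem s)(tmp d := 2 * v)"
    "inp s1 = inp s" "out s1 = out s" "good X A s1"
    using reach_set_tmp[OF c(1) g, where d = d and v = "2 * v"] v d by (auto simp: mult_2)
  obtain s2 where 2: "reach X A P s1 1 s2" "pc s2 = Suc (pc s1)" "mem s2 = (mem s1)(tmp d := 4 * v)"
    "inp s2 = inp s1" "out s2 = out s1" "good X A s2"
    using reach_set_tmp[OF c(2)[folded 1(2)] 1(6), where d = d and v = "4 * v"] v d 1(3) by auto
  obtain s3 where 3: "reach X A P s2 1 s3" "pc s3 = Suc (pc s2)" "mem s3 = (mem s2)(tmp d := 8 * v)"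
    "inp s3 = inp s2" "out s3 = out s2" "good X A s3"
    using reach_set_tmp[OF c(3)[folded 1(2) 2(2)] 2(6), where d = d and v = "8 * v"] v d 2(3) by auto
  obtain s4 where 4: "reach X A P s3 1 s4" "pc s4 = Suc (pc s3)" "mem s4 = (mem s3)(tmp d := 16 * v)"
    "inp s4 = inp s3" "out s4 = out s3" "good X A s4"
    using reach_set_tmp[OF c(4)[folded 1(2) 2(2) 3(2)] 3(6), where d = d and v = "16 * v"] v d 3(3) by auto
  obtain s5 where 5: "reach X A P s4 1 s5" "pc s5 = Suc (pc s4)" "mem s5 = (mem s4)(tmp (Suc d) := k)"
    "inp s5 = inp s4" "out s5 = out s4" "good X A s5"
    using reach_set_tmp[OF c(5)[folded 1(2) 2(2) 3(2) 4(2)] 4(6), where d = "Suc d" and v = k] v A by auto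
  obtain s6 where 6: "reach X A P s5 1 s6" "pc s6 = Suc (pc s5)" "mem s6 = (mem s5)(tmp d := 16 * v + k)"
    "inp s6 = inp s5" "out s6 = out s5" "good X A s6"
    using reach_set_tmp[OF c(6)[folded 1(2) 2(2) 3(2) 4(2) 5(2)] 5(6), where d = d and v = "16 * v + k"] v d 5(3) 4(3) by auto
  have "reach X A P s (1 + (1 + (1 + (1 + (1 + 1))))) s6"
    using 1(1) 2(1) 3(1) 4(1) 5(1) 6(1) by (blast intro: reach_trans)
  moreover have "keeps d s s6" unfolding keeps_def
  proof (intro conjI allI impI)
    fix r assume r: "\<forall>d'\<ge>d. r \<noteq> tmp d'"
    have "r \<noteq> tmp d" by (rule r[rule_format, OF le_refl])
    moreover have "r \<noteq> tmp (Suc d)" by (rule r[rule_format, OF le_SucI[OF le_refl]])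
    ultimately have "r \<noteq> tmp d" "r \<noteq> tmp (Suc d)" .
    then show "mem s6 r = mem s r" unfolding 6(3) 5(3) 4(3) 3(3) 2(3) 1(3) by (simp only: fun_upd_apply if_False)
  qed (simp_all only: 6(4,5) 5(4,5) 4(4,5) 3(4,5) 2(4,5) 1(4,5))
  ultimately show ?thesis using 1(2) 2(2) 3(2) 4(2) 5(2) 6
    by (intro exI[of _ s6]) (simp add: numeral_eq_Suc)
qed

lemma reach_cexp:
  assumes "code_at P (pc s) (cexp e d)" "good X A s" "rel M (mem s)" "\<And>k i. M k i \<le> B"
    "ewf e" "emag e * (B + 1) \<le> X" "16 * (d + esize e) \<le> A"
  shows "\<exists>s'. reach X A P s (length (cexp e d)) s' \<and> pc s' = pc s + length (cexp e d) \<and>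
    mem s' (tmp d) = val M e \<and> keeps d s s' \<and> good X A s'"
  using assms
proof (induction e arbitrary: d s)
  case (N c)
  have "code_at P (pc s) [Const (tmp d) c]" using N.prems by simp
  from reach_set_tmp[OF this N.prems(2), where d = d and v = c] obtain s' where
    s': "reach X A P s 1 s'" "pc s' = Suc (pc s)" "mem s' = (mem s)(tmp d := c)"
    "inp s' = inp s" "out s' = out s" "good X A s'" using N.prems by auto
  moreover have "keeps d s s'" using s' by (auto simp: keeps_def)
  ultimately show ?case by (intro exI[of _ s']) auto
next
  case (Ix k e)
  let ?l = "length (cexp e d)"
  have c: "code_at P (pc s) (cexp e d)"
    "code_at P (pc s + ?l) (replicate 4 (Add (tmp d) (tmp d) (tmp d)) @ [Const (tmp (Suc d)) k, Add (tmp d) (tmp d) (tmp (Suc d))])"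
    "code_at P (pc s + ?l + 6) [Load (tmp d) (tmp d)]"
    using Ix.prems(1) by (auto simp: code_at_append code_at_Cons code_at_Nil numeral_eq_Suc)
  have mag: "emag e * (B + 1) \<le> X" "16 * (emag e * (B + 1)) + k \<le> X"
    using Ix.prems(6) by (auto simp: algebra_simps)
  have val: "val M e \<le> emag e * (B + 1)" by (rule val_le_emag) (rule Ix.prems(4))
  obtain s1 where 1: "reach X A P s ?l s1" "pc s1 = pc s + ?l"
    "mem s1 (tmp d) = val M e" "keeps d s s1" "good X A s1"
    using Ix.IH[OF c(1) Ix.prems(2,3,4)] Ix.prems(5,7) mag by auto
  obtain s2 where 2: "reach X A P s1 6 s2" "pc s2 = pc s1 + 6" "mem s2 (tmp d) = 16 * val M e + k"
    "keeps d s1 s2" "good X A s2"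
    using reach_scale[OF c(2)[folded 1(2)] 1(5) 1(3)] mag(2) val Ix.prems(7) by auto
  have k: "keeps d s s2" using keeps_trans[OF 1(4) 2(4)] by simp
  have "mem s2 (16 * val M e + k) = M k (val M e)"
    using keeps_rel[OF k Ix.prems(3)] Ix.prems(5) by (simp add: rel_def)
  then obtain s3 where 3: "reach X A P s2 1 s3" "pc s3 = Suc (pc s2)" "mem s3 = (mem s2)(tmp d := M k (val M e))"
    "inp s3 = inp s2" "out s3 = out s2" "good X A s3"
    using reach_set_tmp[OF c(3)[folded 1(2) 2(2)] 2(5), where d = d and v = "M k (val M e)"] 2(3)
      Ix.prems(4)[of k "val M e"] Ix.prems(6,7) by auto
  have "keeps d s2 s3" using 3 by (auto simp: keeps_def)
  then have "keeps d s s3" using keeps_trans[OF k] by simp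
  moreover have "reach X A P s (?l + (6 + 1)) s3" using 1(1) 2(1) 3(1) by (blast intro: reach_trans)
  ultimately show ?case using 1(2) 2(2) 3 by (intro exI[of _ s3]) (simp add: numeral_eq_Suc)
next
  case (Plus a b)
  let ?l = "length (cexp a d)" and ?r = "length (cexp b (Suc d))"
  have c: "code_at P (pc s) (cexp a d)" "code_at P (pc s + ?l) (cexp b (Suc d))"
    "code_at P (pc s + ?l + ?r) [Add (tmp d) (tmp d) (tmp (Suc d))]"
    using Plus.prems(1) by (auto simp: code_at_append add.assoc)
  have mag: "emag a * (B + 1) \<le> X" "emag b * (B + 1) \<le> X" "emag a * (B + 1) + emag b * (B + 1) \<le> X"
    using Plus.prems(6) by (auto simp: algebra_simps)
  have sz: "16 * (d + esize a) \<le> A" "16 * (Suc d + esize b) \<le> A" "tmp d < A"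
    using Plus.prems(7) by (auto simp: max_def split: if_splits)
  obtain s1 where 1: "reach X A P s ?l s1" "pc s1 = pc s + ?l"
    "mem s1 (tmp d) = val M a" "keeps d s s1" "good X A s1"
    using Plus.IH(1)[OF c(1) Plus.prems(2,3,4) _ _ sz(1)] Plus.prems(5) mag by auto
  obtain s2 where 2: "reach X A P s1 ?r s2" "pc s2 = pc s1 + ?r"
    "mem s2 (tmp (Suc d)) = val M b" "keeps (Suc d) s1 s2" "good X A s2"
    using Plus.IH(2)[OF c(2)[folded 1(2)] 1(5) keeps_rel[OF 1(4) Plus.prems(3)] Plus.prems(4) _ _ sz(2)] Plus.prems(5) mag by auto
  \<comment> \<open>The second operand was evaluated at depth \<open>Suc d\<close>, so the value of
    the first is still in place.\<close>
  have v: "mem s2 (tmp d) = val M a" using keeps_tmp[OF 2(4), of d] 1(3) by simp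
  have "val M a + val M b \<le> X"
    using val_le_emag[of M B a] val_le_emag[of M B b] Plus.prems(4) mag(3) by (meson add_mono le_trans)
  then obtain s3 where 3: "reach X A P s2 1 s3" "pc s3 = Suc (pc s2)" "mem s3 = (mem s2)(tmp d := val M a + val M b)"
    "inp s3 = inp s2" "out s3 = out s2" "good X A s3"
    using reach_set_tmp[OF c(3)[folded 1(2) 2(2)] 2(5), where d = d and v = "val M a + val M b"] v 2(3)
      sz(3) by auto
  have "keeps d s2 s3" using 3 by (auto simp: keeps_def)
  moreover have "keeps d s s2" using keeps_trans[OF 1(4) 2(4)] by simp
  ultimately have "keeps d s s3" using keeps_trans by blast
  moreover have "reach X A P s (?l + (?r + 1)) s3" using 1(1) 2(1) 3(1) by (blast intro: reach_trans)
  ultimately show ?case using 1(2) 2(2) 3 by (intro exI[of _ s3]) (simp add: add.assoc)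
next
  case (Minus a b)
  let ?l = "length (cexp a d)" and ?r = "length (cexp b (Suc d))"
  have c: "code_at P (pc s) (cexp a d)" "code_at P (pc s + ?l) (cexp b (Suc d))"
    "code_at P (pc s + ?l + ?r) [Sub (tmp d) (tmp d) (tmp (Suc d))]"
    using Minus.prems(1) by (auto simp: code_at_append add.assoc)
  have mag: "emag a * (B + 1) \<le> X" "emag b * (B + 1) \<le> X"
    using Minus.prems(6) by (auto simp: algebra_simps)
  have sz: "16 * (d + esize a) \<le> A" "16 * (Suc d + esize b) \<le> A" "tmp d < A"
    using Minus.prems(7) by (auto simp: max_def split: if_splits)
  obtain s1 where 1: "reach X A P s ?l s1" "pc s1 = pc s + ?l"
    "mem s1 (tmp d) = val M a" "keeps d s s1" "good X A s1"
    using Minus.IH(1)[OF c(1) Minus.prems(2,3,4) _ _ sz(1)] Minus.prems(5) mag by auto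
  obtain s2 where 2: "reach X A P s1 ?r s2" "pc s2 = pc s1 + ?r"
    "mem s2 (tmp (Suc d)) = val M b" "keeps (Suc d) s1 s2" "good X A s2"
    using Minus.IH(2)[OF c(2)[folded 1(2)] 1(5) keeps_rel[OF 1(4) Minus.prems(3)] Minus.prems(4) _ _ sz(2)] Minus.prems(5) mag by auto
  have v: "mem s2 (tmp d) = val M a" using keeps_tmp[OF 2(4), of d] 1(3) by simp
  have "val M a - val M b \<le> X"
    using val_le_emag[of M B a] Minus.prems(4) mag(1) by (meson diff_le_self le_trans)
  then obtain s3 where 3: "reach X A P s2 1 s3" "pc s3 = Suc (pc s2)" "mem s3 = (mem s2)(tmp d := val M a - val M b)"
    "inp s3 = inp s2" "out s3 = out s2" "good X A s3"
    using reach_set_tmp[OF c(3)[folded 1(2) 2(2)] 2(5), where d = d and v = "val M a - val M b"] v 2(3)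
      sz(3) by auto
  have "keeps d s2 s3" using 3 by (auto simp: keeps_def)
  moreover have "keeps d s s2" using keeps_trans[OF 1(4) 2(4)] by simp
  ultimately have "keeps d s s3" using keeps_trans by blast
  moreover have "reach X A P s (?l + (?r + 1)) s3" using 1(1) 2(1) 3(1) by (blast intro: reach_trans)
  ultimately show ?case using 1(2) 2(2) 3 by (intro exI[of _ s3]) (simp add: add.assoc)
qed

definition st_bounded :: "nat \<Rightarrow> nat \<Rightarrow> st \<Rightarrow> bool" where
  "st_bounded B S s \<longleftrightarrow> (\<forall>k i. mm s k i \<le> B \<and> (mm s k i \<noteq> 0 \<longrightarrow> i < S)) \<and> (\<forall>x\<in>set (ins s). x \<le> B)"

definition sim :: "nat \<Rightarrow> nat \<Rightarrow> st \<Rightarrow> config \<Rightarrow> bool" where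
  "sim X A s cf \<longleftrightarrow> rel (mm s) (mem cf) \<and> inp cf = ins s \<and> out cf = outs s \<and> good X A cf"

lemma sim_tick [simp]: "sim X A (tick s) cf \<longleftrightarrow> sim X A s cf"
  by (simp add: sim_def tick_def)

lemma st_bounded_tick [simp]: "st_bounded B S (tick s) \<longleftrightarrow> st_bounded B S s"
  by (simp add: st_bounded_def tick_def)

lemma st_bounded_put: "st_bounded B S s \<Longrightarrow> v \<le> B \<Longrightarrow> i < S \<Longrightarrow> st_bounded B S (put k i v s)"
  by (auto simp: st_bounded_def put_def)

lemma sim_keeps: "sim X A s cf \<Longrightarrow> keeps d cf cf' \<Longrightarrow> good X A cf' \<Longrightarrow> sim X A s cf'"
  using keeps_rel[of d cf cf' "mm s"] by (simp add: sim_def) (simp add: keeps_def)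

lemma addr_inj: "k < 15 \<Longrightarrow> k' < 15 \<Longrightarrow> 16 * i + k = 16 * i' + k' \<longleftrightarrow> i = i' \<and> k = (k' :: nat)"
proof
  assume k: "k < 15" "k' < 15" and e: "16 * i + k = 16 * i' + k'"
  have "(16 * i + k) mod 16 = k" "(16 * i' + k') mod 16 = k'" using k by simp_all
  then have "k = k'" using e by simp
  then show "i = i' \<and> k = k'" using e by simp
qed simp

lemma rel_upd:
  "rel M m \<Longrightarrow> k < 15 \<Longrightarrow> rel (M(k := (M k)(i := v))) (m(16 * i + k := v))"
  by (auto simp: rel_def addr_inj)

lemma reach_sim_exp:
  assumes "code_at P (pc cf) (cexp e d)" "sim X A s cf" "st_bounded B S s"
    "ewf e" "emag e * (B + 1) \<le> X" "16 * (d + esize e) \<le> A"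
  shows "\<exists>cf'. reach X A P cf (length (cexp e d)) cf' \<and> pc cf' = pc cf + length (cexp e d) \<and>
    mem cf' (tmp d) = val (mm s) e \<and> keeps d cf cf' \<and> sim X A s cf'"
proof -
  have "good X A cf" "rel (mm s) (mem cf)" using assms(2) by (auto simp: sim_def)
  moreover have "mm s k i \<le> B" for k i using assms(3) by (simp add: st_bounded_def)
  ultimately obtain cf' where "reach X A P cf (length (cexp e d)) cf'" "pc cf' = pc cf + length (cexp e d)"
    "mem cf' (tmp d) = val (mm s) e" "keeps d cf cf'" "good X A cf'"
    using reach_cexp[OF assms(1) _ _ _ assms(4-6), of "mm s"] by blast
  then show ?thesis using sim_keeps[OF assms(2)] by blast
qed

lemma reach_sim_addr:
  assumes "code_at P (pc cf) (caddr k e)" "sim X A s cf" "st_bounded B S s"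
    "ewf e" "(16 * emag e + k) * (B + 1) \<le> X" "16 * (esize e + 1) \<le> A"
  shows "\<exists>cf'. reach X A P cf (length (caddr k e)) cf' \<and> pc cf' = pc cf + length (caddr k e) \<and>
    mem cf' (tmp 0) = 16 * val (mm s) e + k \<and> sim X A s cf'"
proof -
  let ?l = "length (cexp e 0)"
  have c: "code_at P (pc cf) (cexp e 0)"
    "code_at P (pc cf + ?l) (replicate 4 (Add (tmp 0) (tmp 0) (tmp 0)) @ [Const (tmp (Suc 0)) k, Add (tmp 0) (tmp 0) (tmp (Suc 0))])"
    using assms(1) unfolding caddr_def code_at_append One_nat_def by blast+
  have X: "emag e * (B + 1) \<le> X" "16 * (emag e * (B + 1)) + k \<le> X"
    using assms(5) by (auto simp: algebra_simps)
  have es: "0 < esize e" by (cases e) auto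
  obtain c1 where 1: "reach X A P cf ?l c1" "pc c1 = pc cf + ?l" "mem c1 (tmp 0) = val (mm s) e"
    "keeps 0 cf c1" "sim X A s c1"
    using reach_sim_exp[OF c(1) assms(2-4) X(1)] assms(6) by auto
  have "val (mm s) e \<le> emag e * (B + 1)"
    by (rule val_le_emag) (use assms(3) in \<open>simp add: st_bounded_def\<close>)
  have "good X A c1" using 1(5) by (simp add: sim_def)
  obtain c2 where 2: "reach X A P c1 6 c2" "pc c2 = pc c1 + 6" "mem c2 (tmp 0) = 16 * val (mm s) e + k"
    "keeps 0 c1 c2" "good X A c2"
  proof -
    have "16 * val (mm s) e + k \<le> X"
      using \<open>val (mm s) e \<le> emag e * (B + 1)\<close> X(2) by linarith
    moreover have "31 < A" using assms(6) es by presburger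
    ultimately have "16 * val (mm s) e + k \<le> X" "tmp (Suc 0) < A" by simp_all
    then show ?thesis using that reach_scale[OF c(2)[folded 1(2)] \<open>good X A c1\<close> 1(3)] by blast
  qed
  have "length (caddr k e) = ?l + 6" by (simp add: caddr_def)
  then show ?thesis using reach_trans[OF 1(1) 2(1)] 1(2) 2 sim_keeps[OF 1(5) 2(4,5)]
    by (intro exI[of _ c2]) simp
qed

lemma reach_store:
  assumes c: "code_at P (pc cf) [Store (tmp 0) (tmp 1)]" and s: "sim X A s cf" and k: "k < 15"
    and m: "mem cf (tmp 0) = 16 * i + k" "mem cf (tmp 1) = v"
    and b: "v \<le> X" "16 * S \<le> A" "i < S"
  shows "\<exists>cf'. reach X A P cf 1 cf' \<and> pc cf' = Suc (pc cf) \<and> sim X A (put k i v s) cf'"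
proof -
  let ?cf = "exec (Store (tmp 0) (tmp 1)) cf"
  have "16 * i + k < A" using b k by simp
  then have g: "good X A ?cf" using s b(1) m unfolding exec.simps sim_def by (intro good_upd) simp_all
  have "reach X A P cf 1 ?cf"
    using c s by (intro reach_step g) (auto simp: code_at_Cons sim_def)
  moreover have "sim X A (put k i v s) ?cf"
    using s g rel_upd[OF _ k, of "mm s" "mem cf" i v] m by (simp add: sim_def put_def)
  ultimately show ?thesis by (intro exI[of _ ?cf]) simp
qed

lemma reach_jump:
  assumes c: "code_at P (pc cf) [JumpPos a (tmp d)]" and s: "sim X A s cf"
  shows "\<exists>cf'. reach X A P cf 1 cf' \<and> pc cf' = (if mem cf (tmp d) > 0 then a else Suc (pc cf)) \<and> sim X A s cf'"
proof -
  let ?cf = "exec (JumpPos a (tmp d)) cf"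
  have g: "good X A ?cf" using s by (simp add: sim_def good_def)
  have "reach X A P cf 1 ?cf"
    using c s by (intro reach_step g) (auto simp: code_at_Cons sim_def)
  moreover have "sim X A s ?cf" using s g by (simp add: sim_def)
  ultimately show ?thesis by (intro exI[of _ ?cf]) simp
qed

lemma reach_goto:
  assumes c: "code_at P (pc cf) [Const (tmp 0) 1, JumpPos a (tmp 0)]" and s: "sim X A s cf"
    and b: "1 \<le> X" "16 \<le> A"
  shows "\<exists>cf'. reach X A P cf 2 cf' \<and> pc cf' = a \<and> sim X A s cf'"
proof -
  have c': "code_at P (pc cf) [Const (tmp 0) 1]" "code_at P (Suc (pc cf)) [JumpPos a (tmp 0)]"
    using c by (auto simp: code_at_Cons code_at_Nil)
  obtain c1 where 1: "reach X A P cf 1 c1" "pc c1 = Suc (pc cf)" "mem c1 = (mem cf)(tmp 0 := 1)"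
    "inp c1 = inp cf" "out c1 = out cf" "good X A c1"
    using reach_set_tmp[OF c'(1), where d = 0 and v = 1 and X = X and A = A] s b by (auto simp: sim_def)
  have "keeps 0 cf c1" using 1 by (auto simp: keeps_def)
  then have s1: "sim X A s c1" using sim_keeps[OF s] 1 by blast
  from reach_jump[OF c'(2)[folded 1(2)] s1] obtain c2 where
    2: "reach X A P c1 1 c2" "pc c2 = a" "sim X A s c2" using 1(3) by auto
  show ?thesis using reach_trans[OF 1(1) 2(1)] 2 by (intro exI[of _ c2]) (simp add: numeral_eq_Suc)
qed

lemma cmag_pos: "1 \<le> cmag c"
  by (induction c) auto

lemma csize_pos: "2 \<le> csize c"
  by (induction c) auto

text \<open>The last conjunct says that at most \<open>L\<close> machine steps are made per tick,
  without using subtraction. Every tick pays for the command's own instructions, of which there are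
  at most \<open>L\<close>, and subcommands are paid for by their own ticks. The same
  \<open>L\<close> thus serves the whole induction.\<close>

theorem comp_correct:
  assumes "ev B S c s s'" "st_bounded B S s" "cwf c" "code_at P (pc cf) (comp (pc cf) c)" "sim X A s cf"
    "cmag c * (B + 1) \<le> X" "16 * (S + csize c) \<le> A" "clen c \<le> L"
  shows "\<exists>t cf'. reach X A P cf t cf' \<and> pc cf' = pc cf + clen c \<and> sim X A s' cf' \<and> st_bounded B S s' \<and>
    t + L * tm s \<le> L * tm s'"
  using assms
proof (induction arbitrary: cf rule: ev.induct)
  case (Skip s)
  then show ?case by (intro exI[of _ 0] exI[of _ cf]) (auto simp: sim_def intro: reach_0)
next
  case (Put s e i k)
  let ?l = "length (caddr k i)" and ?r = "length (cexp e 1)"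
  have c: "code_at P (pc cf) (caddr k i)" "code_at P (pc cf + ?l) (cexp e 1)"
    "code_at P (pc cf + ?l + ?r) [Store (tmp 0) (tmp 1)]"
    using Put.prems(3) by (auto simp: code_at_append add.assoc)
  have w: "k < 15" "ewf i" "ewf e" using Put.prems(2) by auto
  have X: "(16 * emag i + k) * (B + 1) \<le> X" "emag e * (B + 1) \<le> X" "B \<le> X"
    using Put.prems(5) by (auto simp: algebra_simps)
  have A: "16 * (esize i + 1) \<le> A" "16 * (1 + esize e) \<le> A" "16 * S \<le> A" using Put.prems(6) by auto
  obtain c1 where 1: "reach X A P cf ?l c1" "pc c1 = pc cf + ?l" "mem c1 (tmp 0) = 16 * val (mm s) i + k" "sim X A s c1"
    using reach_sim_addr[OF c(1) Put.prems(4,1) w(2) X(1) A(1)] by blast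
  obtain c2 where 2: "reach X A P c1 ?r c2" "pc c2 = pc c1 + ?r" "mem c2 (tmp 1) = val (mm s) e" "keeps 1 c1 c2" "sim X A s c2"
    using reach_sim_exp[OF c(2)[folded 1(2)] 1(4) Put.prems(1) w(3) X(2) A(2)] by blast
  have m: "mem c2 (tmp 0) = 16 * val (mm s) i + k" using keeps_tmp[OF 2(4), of 0] 1(3) by simp
  obtain c3 where 3: "reach X A P c2 1 c3" "pc c3 = Suc (pc c2)" "sim X A (put k (val (mm s) i) (val (mm s) e) s) c3"
    using reach_store[OF c(3)[folded 1(2) 2(2)] 2(5) w(1) m 2(3) _ A(3) Put.hyps(2)] Put.hyps(1) X(3) by auto
  have "reach X A P cf (?l + (?r + 1)) c3" using 1(1) 2(1) 3(1) by (blast intro: reach_trans)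
  then show ?case using 1(2) 2(2) 3 st_bounded_put[OF Put.prems(1) Put.hyps] Put.prems(7)
    by (intro exI[of _ "?l + (?r + 1)"] exI[of _ c3]) (simp add: put_def)
next
  case (Get s i k)
  let ?l = "length (caddr k i)"
  have c: "code_at P (pc cf) (caddr k i)" "code_at P (pc cf + ?l) [Read (tmp 1)]"
    "code_at P (Suc (pc cf + ?l)) [Store (tmp 0) (tmp 1)]"
    using Get.prems(3) by (auto simp: code_at_append code_at_Cons code_at_Nil)
  have w: "k < 15" "ewf i" using Get.prems(2) by auto
  have X: "(16 * emag i + k) * (B + 1) \<le> X" "B \<le> X"
    using Get.prems(5) by (auto simp: algebra_simps)
  have A: "16 * (esize i + 1) \<le> A" "16 * S \<le> A" "tmp 1 < A" using Get.prems(6) by auto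
  obtain c1 where 1: "reach X A P cf ?l c1" "pc c1 = pc cf + ?l" "mem c1 (tmp 0) = 16 * val (mm s) i + k" "sim X A s c1"
    using reach_sim_addr[OF c(1) Get.prems(4,1) w(2) X(1) A(1)] by blast
  \<comment> \<open>The state between the two instructions: the input is consumed, but the array is
    not yet written.\<close>
  let ?s = "s\<lparr>ins := tl (ins s)\<rparr>"
  let ?c = "exec (Read (tmp 1)) c1"
  have h: "st_bounded B S ?s" using Get.prems(1) by (cases "ins s") (auto simp: st_bounded_def)
  have inp: "inp c1 = ins s" "good X A c1" "rel (mm s) (mem c1)" using 1(4) by (auto simp: sim_def)
  have me: "mem ?c = (mem c1)(tmp 1 := hd0 (ins s))" by (simp add: inp hd0_def)
  have g: "good X A ?c" unfolding good_def
  proof (intro conjI allI)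
    have "set (inp ?c) \<subseteq> set (inp c1)" by (cases "inp c1") auto
    then show "\<forall>x\<in>set (inp ?c). x \<le> X" using inp(2) by (auto simp: good_def)
    show "mem ?c r \<le> X" "mem ?c r \<noteq> 0 \<longrightarrow> r < A" for r
      unfolding me using inp(2) Get.hyps(1) X(2) A(3) by (auto simp: good_def)
  qed
  have "reach X A P c1 1 ?c" using c(2)[folded 1(2)] inp(2) by (intro reach_step g) (auto simp: code_at_Cons)
  moreover have "sim X A ?s ?c"
  proof -
    have "rel (mm s) (mem ?c)" unfolding me rel_def
      using inp(3) scaled_neq_tmp[of _ _ 1] by (auto simp: rel_def)
    moreover have "inp ?c = tl (ins s)" "out ?c = outs s" using inp 1(4) by (auto simp: sim_def)
    ultimately show ?thesis using g by (simp add: sim_def del: exec.simps)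
  qed
  moreover have "mem ?c (tmp 0) = 16 * val (mm s) i + k" "mem ?c (tmp 1) = hd0 (ins s)" unfolding me using 1(3) by auto
  moreover have "pc ?c = Suc (pc cf + ?l)" using 1(2) by simp
  ultimately obtain c2 where 2: "reach X A P c1 1 c2" "pc c2 = Suc (pc cf + ?l)" "sim X A ?s c2"
    "mem c2 (tmp 0) = 16 * val (mm s) i + k" "mem c2 (tmp 1) = hd0 (ins s)" by blast
  obtain c3 where 3: "reach X A P c2 1 c3" "pc c3 = Suc (pc c2)" "sim X A (put k (val (mm s) i) (hd0 (ins s)) ?s) c3"
    using reach_store[OF c(3)[folded 2(2)] 2(3) w(1) 2(4,5) _ A(2) Get.hyps(2)] Get.hyps(1) X(2) by auto
  have e: "put k (val (mm s) i) (hd0 (ins s)) ?s = (put k (val (mm s) i) (hd0 (ins s)) s)\<lparr>ins := tl (ins s)\<rparr>"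
    by (simp add: put_def)
  have "st_bounded B S ((put k (val (mm s) i) (hd0 (ins s)) s)\<lparr>ins := tl (ins s)\<rparr>)"
    using st_bounded_put[OF h Get.hyps, of k] unfolding e .
  moreover have "reach X A P cf (?l + (1 + 1)) c3" using 1(1) 2(1) 3(1) by (blast intro: reach_trans)
  ultimately show ?case using 2(2) 3 Get.prems(7) unfolding e
    by (intro exI[of _ "?l + (1 + 1)"] exI[of _ c3]) (simp add: put_def)
next
  case (Out e s)
  let ?l = "length (cexp e 0)"
  have c: "code_at P (pc cf) (cexp e 0)" "code_at P (pc cf + ?l) [Print (tmp 0)]"
    using Out.prems(3) by (auto simp: code_at_append)
  have X: "emag e * (B + 1) \<le> X" using Out.prems(5) by (auto simp: algebra_simps)
  obtain c1 where 1: "reach X A P cf ?l c1" "pc c1 = pc cf + ?l" "mem c1 (tmp 0) = val (mm s) e" "sim X A s c1"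
    using reach_sim_exp[OF c(1) Out.prems(4,1) _ X] Out.prems(2,6) by auto
  let ?c = "exec (Print (tmp 0)) c1"
  have g: "good X A ?c" using 1(4) by (simp add: sim_def good_def)
  have "reach X A P c1 1 ?c" using c(2)[folded 1(2)] 1(4) by (intro reach_step g) (auto simp: code_at_Cons sim_def)
  then have "reach X A P cf (?l + 1) ?c" using 1(1) reach_trans by blast
  moreover have "sim X A ((tick s)\<lparr>outs := outs s @ [val (mm s) e]\<rparr>) ?c"
    using 1(3,4) g by (simp add: sim_def tick_def)
  moreover have "st_bounded B S ((tick s)\<lparr>outs := outs s @ [val (mm s) e]\<rparr>)"
    using Out.prems(1) by (simp add: st_bounded_def tick_def)
  ultimately show ?case using 1(2) Out.prems(7) by (intro exI[of _ "?l + 1"] exI[of _ ?c]) (simp add: tick_def)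
next
  case (Seq c s s' d s'')
  have c: "code_at P (pc cf) (comp (pc cf) c)" "code_at P (pc cf + clen c) (comp (pc cf + clen c) d)"
    using Seq.prems(3) by (auto simp: code_at_append)
  have X: "cmag c * (B + 1) \<le> X" "cmag d * (B + 1) \<le> X" using Seq.prems(5) by (auto simp: algebra_simps)
  obtain t c1 where 1: "reach X A P cf t c1" "pc c1 = pc cf + clen c" "sim X A s' c1" "st_bounded B S s'" "t + L * tm s \<le> L * tm s'"
    using Seq.IH(1)[OF Seq.prems(1) _ c(1) Seq.prems(4) X(1)] Seq.prems(2,6,7) by auto
  obtain u c2 where 2: "reach X A P c1 u c2" "pc c2 = pc c1 + clen d" "sim X A s'' c2" "st_bounded B S s''" "u + L * tm s' \<le> L * tm s''"
    using Seq.IH(2)[OF 1(4) _ c(2)[folded 1(2)] 1(3) X(2)] Seq.prems(2,6,7) by auto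
  show ?case using reach_trans[OF 1(1) 2(1)] 1 2 by (intro exI[of _ "t + u"] exI[of _ c2]) simp
next
  case (IfT s e c s' d)
  let ?l = "length (cexp e 0)"
  let ?a = "pc cf + ?l + 3 + clen d"
  have c: "code_at P (pc cf) (cexp e 0)" "code_at P (pc cf + ?l) [JumpPos ?a (tmp 0)]" "code_at P ?a (comp ?a c)"
    using IfT.prems(3) by (auto simp: code_at_append code_at_Cons code_at_Nil Let_def algebra_simps numeral_eq_Suc)
  have X: "emag e * (B + 1) \<le> X" "cmag c * (B + 1) \<le> X" using IfT.prems(5) by (auto simp: algebra_simps)
  obtain c1 where 1: "reach X A P cf ?l c1" "pc c1 = pc cf + ?l" "mem c1 (tmp 0) = val (mm s) e" "sim X A s c1"
    using reach_sim_exp[OF c(1) IfT.prems(4,1) _ X(1)] IfT.prems(2,6) by auto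
  obtain c2 where 2: "reach X A P c1 1 c2" "pc c2 = ?a" "sim X A s c2"
    using reach_jump[OF c(2)[folded 1(2)] 1(4)] 1(2,3) IfT.hyps(1) by auto
  obtain u c3 where 3: "reach X A P c2 u c3" "pc c3 = pc c2 + clen c" "sim X A s' c3" "st_bounded B S s'"
    "u + L * tm (tick s) \<le> L * tm s'"
    using IfT.IH[of c2] 2 c(3) X(2) IfT.prems(1,2,6,7) by (auto simp: 2(2))
  have "reach X A P cf (?l + (1 + u)) c3" using 1(1) 2(1) 3(1) by (blast intro: reach_trans)
  then show ?case using 2(2) 3 IfT.prems(7) by (intro exI[of _ "?l + (1 + u)"] exI[of _ c3]) (simp add: tick_def)
next
  case (IfF s e d s' c)
  let ?l = "length (cexp e 0)"
  let ?a = "pc cf + ?l + 3 + clen d"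
  have c: "code_at P (pc cf) (cexp e 0)" "code_at P (pc cf + ?l) [JumpPos ?a (tmp 0)]"
    "code_at P (Suc (pc cf + ?l)) (comp (Suc (pc cf + ?l)) d)"
    "code_at P (Suc (pc cf + ?l + clen d)) [Const (tmp 0) 1, JumpPos (?a + clen c) (tmp 0)]"
    using IfF.prems(3) by (auto simp: code_at_append code_at_Cons code_at_Nil Let_def algebra_simps numeral_eq_Suc)
  have X: "emag e * (B + 1) \<le> X" "cmag d * (B + 1) \<le> X" "1 \<le> X"
    using IfF.prems(5) cmag_pos[of c] by (auto simp: algebra_simps)
  obtain c1 where 1: "reach X A P cf ?l c1" "pc c1 = pc cf + ?l" "mem c1 (tmp 0) = val (mm s) e" "sim X A s c1"
    using reach_sim_exp[OF c(1) IfF.prems(4,1) _ X(1)] IfF.prems(2,6) by auto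
  obtain c2 where 2: "reach X A P c1 1 c2" "pc c2 = Suc (pc cf + ?l)" "sim X A s c2"
    using reach_jump[OF c(2)[folded 1(2)] 1(4)] 1(2,3) IfF.hyps(1) by auto
  obtain u c3 where 3: "reach X A P c2 u c3" "pc c3 = pc c2 + clen d" "sim X A s' c3" "st_bounded B S s'"
    "u + L * tm (tick s) \<le> L * tm s'"
    using IfF.IH[of c2] 2 c(3) X(2) IfF.prems(1,2,6,7) by (auto simp: 2(2))
  have p3: "pc c3 = Suc (pc cf + ?l + clen d)" using 3(2) 2(2) by simp
  obtain c4 where 4: "reach X A P c3 2 c4" "pc c4 = ?a + clen c" "sim X A s' c4"
    using reach_goto[OF c(4)[folded p3] 3(3) X(3)] IfF.prems(6) csize_pos[of c] by auto
  have "reach X A P cf (?l + (1 + (u + 2))) c4" using 1(1) 2(1) 3(1) 4(1) by (blast intro: reach_trans)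
  then show ?case using 3 4 IfF.prems(7) by (intro exI[of _ "?l + (1 + (u + 2))"] exI[of _ c4]) (simp add: tick_def)
next
  case (WhileF s e c)
  let ?l = "length (cexp e 0)"
  have c: "code_at P (pc cf) (cexp e 0)" "code_at P (pc cf + ?l) [JumpPos (pc cf + ?l + 3) (tmp 0)]"
    "code_at P (Suc (pc cf + ?l)) [Const (tmp 0) 1, JumpPos (pc cf + ?l + 5 + clen c) (tmp 0)]"
    using WhileF.prems(3) by (auto simp: code_at_append code_at_Cons code_at_Nil Let_def algebra_simps numeral_eq_Suc)
  have X: "emag e * (B + 1) \<le> X" "1 \<le> X"
    using WhileF.prems(5) cmag_pos[of c] by (auto simp: algebra_simps)
  obtain c1 where 1: "reach X A P cf ?l c1" "pc c1 = pc cf + ?l" "mem c1 (tmp 0) = val (mm s) e" "sim X A s c1"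
    using reach_sim_exp[OF c(1) WhileF.prems(4,1) _ X(1)] WhileF.prems(2,6) by auto
  obtain c2 where 2: "reach X A P c1 1 c2" "pc c2 = Suc (pc cf + ?l)" "sim X A s c2"
    using reach_jump[OF c(2)[folded 1(2)] 1(4)] 1(2,3) WhileF.hyps(1) by auto
  obtain c3 where 3: "reach X A P c2 2 c3" "pc c3 = pc cf + ?l + 5 + clen c" "sim X A s c3"
    using reach_goto[OF c(3)[folded 2(2)] 2(3) X(2)] WhileF.prems(6) csize_pos[of c] by auto
  have "reach X A P cf (?l + (1 + 2)) c3" using 1(1) 2(1) 3(1) by (blast intro: reach_trans)
  moreover have "tm (tick s) = Suc (tm s)" by (simp add: tick_def)
  ultimately show ?case using 3 WhileF.prems(1,7) by (intro exI[of _ "?l + (1 + 2)"] exI[of _ c3]) simp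
next
  case (WhileT s e c s' s'')
  let ?l = "length (cexp e 0)"
  let ?a = "pc cf + ?l + 3"
  have c: "code_at P (pc cf) (cexp e 0)" "code_at P (pc cf + ?l) [JumpPos ?a (tmp 0)]" "code_at P ?a (comp ?a c)"
    "code_at P (?a + clen c) [Const (tmp 0) 1, JumpPos (pc cf) (tmp 0)]"
    using WhileT.prems(3) by (auto simp: code_at_append code_at_Cons code_at_Nil Let_def algebra_simps numeral_eq_Suc)
  have X: "emag e * (B + 1) \<le> X" "cmag c * (B + 1) \<le> X" "1 \<le> X"
    using WhileT.prems(5) cmag_pos[of c] by (auto simp: algebra_simps)
  obtain c1 where 1: "reach X A P cf ?l c1" "pc c1 = pc cf + ?l" "mem c1 (tmp 0) = val (mm s) e" "sim X A s c1"
    using reach_sim_exp[OF c(1) WhileT.prems(4,1) _ X(1)] WhileT.prems(2,6) by auto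
  obtain c2 where 2: "reach X A P c1 1 c2" "pc c2 = ?a" "sim X A s c2"
    using reach_jump[OF c(2)[folded 1(2)] 1(4)] 1(2,3) WhileT.hyps(1) by auto
  obtain u c3 where 3: "reach X A P c2 u c3" "pc c3 = pc c2 + clen c" "sim X A s' c3" "st_bounded B S s'"
    "u + L * tm (tick s) \<le> L * tm s'"
    using WhileT.IH(1)[of c2] 2 c(3) X(2) WhileT.prems(1,2,6,7) by (auto simp: 2(2))
  have p3: "pc c3 = ?a + clen c" using 3(2) 2(2) by simp
  obtain c4 where 4: "reach X A P c3 2 c4" "pc c4 = pc cf" "sim X A s' c4"
    using reach_goto[OF c(4)[folded p3] 3(3) X(3)] WhileT.prems(6) csize_pos[of c] by auto
  obtain w c5 where 5: "reach X A P c4 w c5" "pc c5 = pc cf + clen (While e c)" "sim X A s'' c5" "st_bounded B S s''"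
    "w + L * tm s' \<le> L * tm s''"
    using WhileT.IH(2)[OF 3(4) WhileT.prems(2) _ 4(3) WhileT.prems(5-7)] WhileT.prems(3) unfolding 4(2) by blast
  have "reach X A P cf (?l + (1 + (u + (2 + w)))) c5" using 1(1) 2(1) 3(1) 4(1) 5(1) by (blast intro: reach_trans)
  moreover have "?l + (1 + (u + (2 + w))) + L * tm s \<le> L * tm s''"
    using 3(5) 5(5) WhileT.prems(7) by (simp add: tick_def)
  ultimately show ?case using 5 by blast
qed

section \<open>Logarithmic time and space of a simulated run\<close>

lemma bitsize_mono: "x \<le> y \<Longrightarrow> bitsize x \<le> bitsize y"
  unfolding bitsize_def using floorlog_mono[of x y 2] by auto

text \<open>Goodness after the step is used for \<open>Const\<close> and \<open>Read\<close>: the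
  number they are charged for is in memory only then.\<close>

lemma instr_cost_le:
  assumes "good X A s" "good X A (exec i s)"
  shows "instr_cost i s \<le> 2 * bitsize X"
proof -
  have m: "bitsize (mem s r) \<le> bitsize X" for r
    using assms(1) by (intro bitsize_mono) (simp add: good_def)
  have m2: "bitsize (mem s r) + bitsize (mem s r') \<le> 2 * bitsize X" for r r'
    using add_mono[OF m[of r] m[of r']] by simp
  have m1: "bitsize (mem s r) \<le> 2 * bitsize X" for r using m[of r] by simp
  show ?thesis
  proof (cases i)
    case (Const r c)
    have "mem (exec i s) r \<le> X" using assms(2) by (simp add: good_def)
    then have "bitsize c \<le> bitsize X" using Const by (intro bitsize_mono) simp
    then show ?thesis using Const by simp
  next
    case (Read r)
    have "mem (exec i s) r \<le> X" using assms(2) by (simp add: good_def)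
    then have "bitsize (case inp s of [] \<Rightarrow> 0 | x # _ \<Rightarrow> x) \<le> bitsize X" using Read by (intro bitsize_mono) simp
    then show ?thesis using Read by simp
  qed (simp_all add: m1 m2)
qed

lemma mem_size_le:
  assumes "good X A s"
  shows "mem_size (mem s) \<le> A * (bitsize A + bitsize X)"
proof -
  have sub: "{r. mem s r \<noteq> 0} \<subseteq> {..<A}" using assms by (auto simp: good_def)
  have "mem_size (mem s) \<le> (\<Sum>r | mem s r \<noteq> 0. bitsize A + bitsize X)"
    unfolding mem_size_def using assms sub by (intro sum_mono add_mono bitsize_mono) (auto simp: good_def intro: less_imp_le)
  also have "\<dots> = card {r. mem s r \<noteq> 0} * (bitsize A + bitsize X)" by simp
  also have "\<dots> \<le> A * (bitsize A + bitsize X)"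
    using card_mono[OF _ sub] by (intro mult_le_mono1) simp
  finally show ?thesis .
qed

definition init :: "nat list \<Rightarrow> st" where
  "init xs = \<lparr>mm = (\<lambda>_ _. 0), ins = xs, outs = [], tm = 0\<rparr>"

theorem run_correct:
  assumes "ev B S c (init xs) s'" "cwf c" "\<forall>x\<in>set xs. x \<le> B"
    and P: "P = comp 0 c" and X: "X = cmag c * (B + 1)" and A: "A = 16 * (S + csize c)"
  shows "\<exists>t. halted P (run P xs t) \<and> out (run P xs t) = outs s' \<and>
    time_used P xs t \<le> clen c * tm s' * (2 * bitsize X) \<and>
    space_used P xs t \<le> A * (bitsize A + bitsize X)"
proof -
  let ?cf = "\<lparr>pc = 0, mem = (\<lambda>_. 0), inp = xs, out = []\<rparr>"
  have BX: "B \<le> X"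
  proof -
    have "1 * (B + 1) \<le> X" unfolding X by (intro mult_le_mono1 cmag_pos)
    then show ?thesis by simp
  qed
  have h: "st_bounded B S (init xs)" using assms(3) by (simp add: st_bounded_def init_def)
  have s: "sim X A (init xs) ?cf" using assms(3) BX by (auto simp: sim_def init_def rel_def good_def)
  have cd: "code_at P (pc ?cf) (comp (pc ?cf) c)" by (simp add: P code_at_def)
  obtain t cf' where r: "reach X A P ?cf t cf'" "pc cf' = clen c" "sim X A s' cf'"
    "t + clen c * tm (init xs) \<le> clen c * tm s'"
    using comp_correct[OF assms(1) h assms(2) cd s, of "clen c"] X A by auto
  have t: "t \<le> clen c * tm s'" using r(4) by simp
  have run: "run P xs k = (step P ^^ k) ?cf" for k by (simp add: run_def)
  have good: "good X A (run P xs k)" if "k \<le> t" for k using r(1) that unfolding reach_def run by blast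
  have cf': "run P xs t = cf'" using r(1) unfolding reach_def run by simp
  have "time_used P xs t \<le> (\<Sum>k<t. 2 * bitsize X)" unfolding time_used_def Let_def
  proof (rule sum_mono)
    fix k assume k: "k \<in> {..<t}"
    have "run P xs (Suc k) = step P (run P xs k)" unfolding run by simp
    then have "instr_cost (P ! pc (run P xs k)) (run P xs k) \<le> 2 * bitsize X" if "\<not> halted P (run P xs k)"
      using instr_cost_le[of X A "run P xs k"] good[of k] good[of "Suc k"] k that by (simp add: step_def)
    then show "(if halted P (run P xs k) then 0 else instr_cost (P ! pc (run P xs k)) (run P xs k)) \<le> 2 * bitsize X"
      by simp
  qed
  also have "\<dots> = t * (2 * bitsize X)" by simp
  also have "\<dots> \<le> clen c * tm s' * (2 * bitsize X)" using t by (rule mult_le_mono1)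
  finally have "time_used P xs t \<le> clen c * tm s' * (2 * bitsize X)" .
  moreover have "space_used P xs t \<le> A * (bitsize A + bitsize X)"
    unfolding space_used_def using good mem_size_le by (subst Max_le_iff) auto
  moreover have "halted P (run P xs t)" unfolding cf' halted_def using r(2) by (simp add: P)
  moreover have "out (run P xs t) = outs s'" unfolding cf' using r(3) by (simp add: sim_def)
  ultimately show ?thesis by blast
qed

section \<open>Correctness with time bounds for structured programs\<close>

text \<open>Total correctness within \<open>K\<close> ticks, for commands that print nothing. The
  initial memory is a parameter and not a precondition, so the postcondition can refer to it;
  sequencing puts the \<open>W\<close> of the second command into the postcondition of the first, as
  in a weakest precondition calculus.\<close>

definition W :: "nat \<Rightarrow> nat \<Rightarrow> nat \<Rightarrow> com \<Rightarrow> ((nat \<Rightarrow> nat \<Rightarrow> nat) \<Rightarrow> nat list \<Rightarrow> bool) \<Rightarrow> (nat \<Rightarrow> nat \<Rightarrow> nat) \<Rightarrow> nat list \<Rightarrow> bool" where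
  "W B S K c Q m xs \<longleftrightarrow> (\<forall>s. mm s = m \<and> ins s = xs \<longrightarrow>
     (\<exists>s'. ev B S c s s' \<and> Q (mm s') (ins s') \<and> outs s' = outs s \<and> tm s' \<le> tm s + K))"

definition upd :: "nat \<Rightarrow> nat \<Rightarrow> nat \<Rightarrow> (nat \<Rightarrow> nat \<Rightarrow> nat) \<Rightarrow> nat \<Rightarrow> nat \<Rightarrow> nat" where
  "upd k i v m = m(k := (m k)(i := v))"

lemma upd_same [simp]: "upd k i v m k = (m k)(i := v)"
  and upd_other [simp]: "k' \<noteq> k \<Longrightarrow> upd k i v m k' = m k'"
  by (simp_all add: upd_def)

text \<open>The parameter \<open>L\<close> bounds the number of iterations of each loop.\<close>

fun cost :: "nat \<Rightarrow> com \<Rightarrow> nat" where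
  "cost L Skip = 0"
| "cost L (Put k i e) = 1"
| "cost L (Get k i) = 1"
| "cost L (Out e) = 1"
| "cost L (c ;; d) = cost L c + cost L d"
| "cost L (If e c d) = 1 + cost L c + cost L d"
| "cost L (While e c) = 1 + L * (1 + cost L c)"

lemma W_conseq: "W B S K c Q m xs \<Longrightarrow> K \<le> K' \<Longrightarrow> (\<And>m' xs'. Q m' xs' \<Longrightarrow> Q' m' xs') \<Longrightarrow> W B S K' c Q' m xs"
  unfolding W_def
proof (intro allI impI)
  fix s :: st assume a: "\<forall>s. mm s = m \<and> ins s = xs \<longrightarrow>
     (\<exists>s'. ev B S c s s' \<and> Q (mm s') (ins s') \<and> outs s' = outs s \<and> tm s' \<le> tm s + K)"
    "K \<le> K'" "\<And>m' xs'. Q m' xs' \<Longrightarrow> Q' m' xs'" "mm s = m \<and> ins s = xs"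
  then obtain s' where "ev B S c s s'" "Q (mm s') (ins s')" "outs s' = outs s" "tm s' \<le> tm s + K" by blast
  then show "\<exists>s'. ev B S c s s' \<and> Q' (mm s') (ins s') \<and> outs s' = outs s \<and> tm s' \<le> tm s + K'"
    using a(2,3) by (intro exI[of _ s']) simp
qed

lemma W_Skip: "Q m xs \<Longrightarrow> W B S (cost L Skip) Skip Q m xs"
  unfolding W_def by (auto intro: ev.Skip)

lemma W_Put: "val m e \<le> B \<Longrightarrow> val m i < S \<Longrightarrow> Q (upd k (val m i) (val m e) m) xs \<Longrightarrow>
    W B S (cost L (Put k i e)) (Put k i e) Q m xs"
  unfolding W_def
proof (intro allI impI)
  fix s :: st assume a: "val m e \<le> B" "val m i < S" "Q (upd k (val m i) (val m e) m) xs" "mm s = m \<and> ins s = xs"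
  then have "ev B S (Put k i e) s (put k (val (mm s) i) (val (mm s) e) s)" by (intro ev.Put) auto
  then show "\<exists>s'. ev B S (Put k i e) s s' \<and> Q (mm s') (ins s') \<and> outs s' = outs s \<and> tm s' \<le> tm s + cost L (Put k i e)"
    using a by (intro exI[of _ "put k (val (mm s) i) (val (mm s) e) s"]) (simp add: put_def upd_def)
qed

lemma W_Get: "hd0 xs \<le> B \<Longrightarrow> val m i < S \<Longrightarrow> Q (upd k (val m i) (hd0 xs) m) (tl xs) \<Longrightarrow>
    W B S (cost L (Get k i)) (Get k i) Q m xs"
  unfolding W_def
proof (intro allI impI)
  fix s :: st assume a: "hd0 xs \<le> B" "val m i < S" "Q (upd k (val m i) (hd0 xs) m) (tl xs)" "mm s = m \<and> ins s = xs"
  then have "ev B S (Get k i) s ((put k (val (mm s) i) (hd0 (ins s)) s)\<lparr>ins := tl (ins s)\<rparr>)" by (intro ev.Get) auto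
  then show "\<exists>s'. ev B S (Get k i) s s' \<and> Q (mm s') (ins s') \<and> outs s' = outs s \<and> tm s' \<le> tm s + cost L (Get k i)"
    using a by (intro exI[of _ "(put k (val (mm s) i) (hd0 (ins s)) s)\<lparr>ins := tl (ins s)\<rparr>"])
      (simp add: put_def upd_def)
qed

lemma W_Seq_gen: "W B S K c (\<lambda>m xs. W B S K' d Q m xs) m xs \<Longrightarrow> W B S (K + K') (c ;; d) Q m xs"
  unfolding W_def
proof (intro allI impI)
  fix s :: st assume a: "\<forall>s. mm s = m \<and> ins s = xs \<longrightarrow> (\<exists>s'. ev B S c s s' \<and>
      (\<forall>s. mm s = mm s' \<and> ins s = ins s' \<longrightarrow> (\<exists>s'. ev B S d s s' \<and> Q (mm s') (ins s') \<and> outs s' = outs s \<and> tm s' \<le> tm s + K')) \<and>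
      outs s' = outs s \<and> tm s' \<le> tm s + K)" and s: "mm s = m \<and> ins s = xs"
  from a[rule_format, OF s] obtain s1 where 1: "ev B S c s s1" "outs s1 = outs s" "tm s1 \<le> tm s + K"
    "\<forall>s. mm s = mm s1 \<and> ins s = ins s1 \<longrightarrow> (\<exists>s'. ev B S d s s' \<and> Q (mm s') (ins s') \<and> outs s' = outs s \<and> tm s' \<le> tm s + K')"
    by (elim exE conjE) (rule that)
  then obtain s2 where 2: "ev B S d s1 s2" "Q (mm s2) (ins s2)" "outs s2 = outs s1" "tm s2 \<le> tm s1 + K'" by blast
  then show "\<exists>s'. ev B S (c ;; d) s s' \<and> Q (mm s') (ins s') \<and> outs s' = outs s \<and> tm s' \<le> tm s + (K + K')"
    using 1 ev.Seq[OF 1(1) 2(1)] by (intro exI[of _ s2]) simp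
qed

lemma W_Seq: "W B S (cost L c) c (\<lambda>m xs. W B S (cost L d) d Q m xs) m xs \<Longrightarrow> W B S (cost L (c ;; d)) (c ;; d) Q m xs"
  using W_Seq_gen by simp

lemma mm_tick [simp]: "mm (tick s) = mm s" "ins (tick s) = ins s" "outs (tick s) = outs s" "tm (tick s) = Suc (tm s)"
  by (simp_all add: tick_def)

lemma W_If:
  assumes "0 < val m e \<Longrightarrow> W B S (cost L c) c Q m xs" "val m e = 0 \<Longrightarrow> W B S (cost L d) d Q m xs"
  shows "W B S (cost L (If e c d)) (If e c d) Q m xs"
  unfolding W_def
proof (intro allI impI)
  fix s :: st assume s: "mm s = m \<and> ins s = xs"
  then have t: "mm (tick s) = m \<and> ins (tick s) = xs" by simp
  show "\<exists>s'. ev B S (If e c d) s s' \<and> Q (mm s') (ins s') \<and> outs s' = outs s \<and> tm s' \<le> tm s + cost L (If e c d)"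
  proof (cases "0 < val m e")
    case True
    then obtain s' where "ev B S c (tick s) s'" "Q (mm s') (ins s')" "outs s' = outs s" "tm s' \<le> Suc (tm s) + cost L c"
      using assms(1)[unfolded W_def, rule_format, OF _ t] by auto
    then show ?thesis using True s ev.IfT[of s e B S c s' d] by (intro exI[of _ s']) simp
  next
    case False
    then obtain s' where "ev B S d (tick s) s'" "Q (mm s') (ins s')" "outs s' = outs s" "tm s' \<le> Suc (tm s) + cost L d"
      using assms(2)[unfolded W_def, rule_format, OF _ t] by auto
    then show ?thesis using False s ev.IfF[of s e B S d s' c] by (intro exI[of _ s']) simp
  qed
qed

text \<open>The function \<open>f\<close> bounds the remaining number of iterations.\<close>

lemma W_While:
  assumes I: "I m xs" and body: "\<And>m xs. I m xs \<Longrightarrow> 0 < val m e \<Longrightarrow>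
      0 < f m \<and> W B S K c (\<lambda>m' xs'. I m' xs' \<and> f m' < f m) m xs"
    and fin: "\<And>m xs. I m xs \<Longrightarrow> val m e = 0 \<Longrightarrow> Q m xs"
  shows "W B S (1 + f m * (1 + K)) (While e c) Q m xs"
  using I
proof (induction "f m" arbitrary: m xs rule: less_induct)
  case less
  show ?case unfolding W_def
  proof (intro allI impI)
    fix s :: st assume s: "mm s = m \<and> ins s = xs"
    then have t: "mm (tick s) = m \<and> ins (tick s) = xs" by simp
    show "\<exists>s'. ev B S (While e c) s s' \<and> Q (mm s') (ins s') \<and> outs s' = outs s \<and> tm s' \<le> tm s + (1 + f m * (1 + K))"
    proof (cases "0 < val m e")
      case False
      then show ?thesis using fin[OF less.prems] s ev.WhileF[of s e B S c]
        by (intro exI[of _ "tick s"]) simp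
    next
      case True
      obtain s1 where 1: "ev B S c (tick s) s1" "I (mm s1) (ins s1)" "f (mm s1) < f m" "outs s1 = outs s"
        "tm s1 \<le> Suc (tm s) + K"
        using body[OF less.prems True] t unfolding W_def by (metis mm_tick(3,4))
      obtain s2 where 2: "ev B S (While e c) s1 s2" "Q (mm s2) (ins s2)" "outs s2 = outs s1"
        "tm s2 \<le> tm s1 + (1 + f (mm s1) * (1 + K))"
        using less.hyps[OF 1(3,2)] unfolding W_def by blast
      have "Suc (f (mm s1)) * (1 + K) \<le> f m * (1 + K)" using 1(3) by (intro mult_le_mono1) simp
      then have "tm s2 \<le> tm s + (1 + f m * (1 + K))" using 1(5) 2(4) by simp
      then show ?thesis using 1 2 True s ev.WhileT[of s e B S c s1 s2] by (intro exI[of _ s2]) simp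
    qed
  qed
qed

abbreviation V :: "nat \<Rightarrow> exp" where "V v \<equiv> Ix 0 (N v)"
abbreviation SetV :: "nat \<Rightarrow> exp \<Rightarrow> com" where "SetV v e \<equiv> Put 0 (N v) e"

text \<open>The bound \<open>e\<close> is evaluated again before every round. Truncated subtraction
  makes its test positive iff the counter is below the bound.\<close>

definition For :: "nat \<Rightarrow> exp \<Rightarrow> com \<Rightarrow> com" where
  "For v e c = (SetV v (N 0) ;; While (Minus e (V v)) (c ;; SetV v (Plus (V v) (N 1))))"

text \<open>The obligation for the body ends before the increment: it leaves the counter at
  \<open>i\<close> and establishes the invariant for the memory in which the counter has been
  raised. The free bound \<open>K\<close> is meant for the selection of the shift bits, where one
  round takes exponential time; \<open>W_For\<close> is the version for polynomial bodies.\<close>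

lemma W_For_gen:
  assumes I0: "I 0 (upd 0 v 0 m) xs"
    and eq: "\<And>i m xs. I i m xs \<Longrightarrow> m 0 v = i \<and> val m e = k"
    and body: "\<And>i m xs. i < k \<Longrightarrow> I i m xs \<Longrightarrow>
      W B S K c (\<lambda>m' xs'. m' 0 v = i \<and> I (Suc i) (upd 0 v (Suc i) m') xs') m xs"
    and fin: "\<And>m xs. I k m xs \<Longrightarrow> Q m xs"
    and b: "k \<le> B" "v < S"
  shows "W B S (2 + k * (2 + K)) (For v e c) Q m xs"
proof -
  let ?c = "c ;; SetV v (Plus (V v) (N 1))"
  let ?J = "\<lambda>m xs. m 0 v \<le> k \<and> I (m 0 v) m xs"
  have W: "W B S (1 + (k - (upd 0 v 0 m) 0 v) * (1 + (K + 1))) (While (Minus e (V v)) ?c) Q (upd 0 v 0 m) xs"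
  proof (rule W_While[where I = ?J and f = "\<lambda>m. k - m 0 v"])
    show "?J (upd 0 v 0 m) xs" using I0 by simp
  next
    fix m xs assume J: "?J m xs" and pos: "0 < val m (Minus e (V v))"
    have lt: "m 0 v < k" using pos eq[of "m 0 v" m xs] J by simp
    have "W B S K c (\<lambda>m' xs'. m' 0 v = m 0 v \<and> I (Suc (m 0 v)) (upd 0 v (Suc (m 0 v)) m') xs') m xs"
      using body[OF lt] J by blast
    then have "W B S ((K + 1)) ?c (\<lambda>m' xs'. ?J m' xs' \<and> k - m' 0 v < k - m 0 v) m xs"
      by (intro W_Seq_gen, elim W_conseq[OF _ order_refl])
        (rule W_Put[where L = 0, unfolded cost.simps], use lt b in auto)
    then show "0 < k - m 0 v \<and> W B S ((K + 1)) ?c (\<lambda>m' xs'. ?J m' xs' \<and> k - m' 0 v < k - m 0 v) m xs"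
      using lt by simp
  next
    fix m xs assume J: "?J m xs" and z: "val m (Minus e (V v)) = 0"
    then have "m 0 v = k" using eq[of "m 0 v" m xs] by simp
    then show "Q m xs" using J fin by simp
  qed
  then have "W B S (1 + k * (2 + K)) (While (Minus e (V v)) ?c) Q (upd 0 v 0 m) xs"
    by (rule W_conseq) simp_all
  then have "W B S (1 + (1 + k * (2 + K))) (For v e c) Q m xs" unfolding For_def
    by (intro W_Seq_gen W_Put[where L = 0, unfolded cost.simps]) (use b in simp_all)
  then show ?thesis by simp
qed

lemma W_For:
  assumes "I 0 (upd 0 v 0 m) xs"
    and "\<And>i m xs. I i m xs \<Longrightarrow> m 0 v = i \<and> val m e = k"
    and "\<And>i m xs. i < k \<Longrightarrow> I i m xs \<Longrightarrow>
      W B S (cost L c) c (\<lambda>m' xs'. m' 0 v = i \<and> I (Suc i) (upd 0 v (Suc i) m') xs') m xs"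
    and "\<And>m xs. I k m xs \<Longrightarrow> Q m xs"
    and b: "k \<le> B" "v < S" "k \<le> L"
  shows "W B S (cost L (For v e c)) (For v e c) Q m xs"
proof (rule W_conseq[OF W_For_gen[where I = I and k = k and K = "cost L c", OF assms(1-6)]])
  show "2 + k * (2 + cost L c) \<le> cost L (For v e c)"
    using mult_le_mono1[OF b(3), of "2 + cost L c"] by (simp add: For_def)
qed

lemma cost_poly: "\<exists>p :: nat poly. \<forall>L. cost L c = poly p L"
proof (induction c)
  case (Seq c d)
  then obtain p q where "\<forall>L. cost L c = poly p L" "\<forall>L. cost L d = poly q L" by blast
  then show ?case by (intro exI[of _ "p + q"]) simp
next
  case (If e c d)
  then obtain p q where "\<forall>L. cost L c = poly p L" "\<forall>L. cost L d = poly q L" by blast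
  then show ?case by (intro exI[of _ "[:1:] + p + q"]) simp
next
  case (While e c)
  then obtain p where "\<forall>L. cost L c = poly p L" by blast
  then show ?case by (intro exI[of _ "[:1:] + [:0, 1:] * ([:1:] + p)"]) simp
next
  case Skip then show ?case by (intro exI[of _ 0]) simp
qed (intro exI[of _ "[:1:]"], simp)+

section \<open>The program\<close>

text \<open>
  Subtraction is truncated, so \<open>Xor\<close> is correct on bits. The arrays are:
  0 scalars, 1 adjacency matrix, 2 row offsets \<open>i * (n + 1)\<close>, 3 current prefix (shifted by one, with
  the sentinel 0 in front), 4 the vector \<open>\<rho>\<close>, 5 linear system with \<open>2 n\<close> rows and \<open>n + 1\<close> columns, 6 flags of
  used pivot rows, 7 values \<open>fib (k + 2)\<close>. The scalars are: 0 the number \<open>n\<close>, 1 row, 2 column, 3 index of the bit of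
  \<open>\<rho>\<close> being chosen, 4 pivot column, 5 pivot found, 6 pivot row, 7 rank, 8 solvable, 9 prefix length,
  10 search running, 11 sum over the leaves, 12 the sum for \<open>\<rho>\<^sub>t = 0\<close>, 13 search depth, 14 leaf mode
  (0 weights, 1 determinants), 15 the number \<open>2 n\<close>, 16 and 17 temporaries.
\<close>

abbreviation Xor :: "exp \<Rightarrow> exp \<Rightarrow> exp" where "Xor a b \<equiv> Plus (Minus a b) (Minus b a)"
abbreviation Aent :: "exp \<Rightarrow> exp \<Rightarrow> exp" where "Aent i j \<equiv> Ix 1 (Plus (Ix 2 i) j)"
abbreviation Bent :: "exp \<Rightarrow> exp \<Rightarrow> exp" where "Bent i j \<equiv> Ix 5 (Plus (Ix 2 i) j)"
abbreviation PutB :: "exp \<Rightarrow> exp \<Rightarrow> exp \<Rightarrow> com" where "PutB i j e \<equiv> Put 5 (Plus (Ix 2 i) j) e"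

definition bn :: "bit \<Rightarrow> nat" where "bn b = (if b = 1 then 1 else 0)"

lemma bn_simps [simp]: "bn 0 = 0" "bn 1 = 1"
  by (simp_all add: bn_def)

lemma bn_xor: "bn a - bn b + (bn b - bn a) = bn (a + b)"
  by (cases a; cases b) simp_all

lemma bn_and: "bn a + bn b - 1 = bn (a * b)"
  by (cases a; cases b) simp_all

lemma bn_not: "1 - bn a = bn (1 + a)"
  by (cases a) simp_all

lemma bn_eq_0: "bn b = 0 \<longleftrightarrow> b = 0"
  by (cases b) simp_all

lemma bn_pos: "0 < bn b \<longleftrightarrow> b = 1"
  by (cases b) simp_all

lemma bn_le: "bn b \<le> 1"
  by (cases b) simp_all

text \<open>The part of the memory that stays fixed once it is initialised. The adjacency matrix
  shares the row offsets of the linear system, so its rows have stride \<open>n + 1\<close>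
  too.\<close>

definition env :: "nat \<Rightarrow> (nat \<Rightarrow> nat \<Rightarrow> bit) \<Rightarrow> (nat \<Rightarrow> nat \<Rightarrow> nat) \<Rightarrow> bool" where
  "env n a m \<longleftrightarrow> m 0 0 = n \<and> m 0 15 = n + n \<and> (\<forall>i\<le>n + n. m 2 i = i * (n + 1)) \<and>
     (\<forall>i<n. \<forall>j<n. m 1 (i * (n + 1) + j) = bn (a i j)) \<and> (\<forall>i\<le>n. m 7 i = fib (i + 2))"

definition mat_at :: "nat \<Rightarrow> (nat \<Rightarrow> nat \<Rightarrow> bit) \<Rightarrow> (nat \<Rightarrow> nat \<Rightarrow> nat) \<Rightarrow> bool" where
  "mat_at n C m \<longleftrightarrow> (\<forall>i<n + n. \<forall>j\<le>n. m 5 (i * (n + 1) + j) = bn (C i j))"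

definition used_flags :: "nat \<Rightarrow> nat set \<Rightarrow> (nat \<Rightarrow> nat \<Rightarrow> nat) \<Rightarrow> bool" where
  "used_flags n U m \<longleftrightarrow> (\<forall>i<n + n. m 6 i = (if i \<in> U then 0 else 1))"

text \<open>\<open>X\<close> lists the scalars and \<open>Y\<close> the arrays that may have
  changed. Array 0 holds the scalars and is therefore treated entry by entry.\<close>

definition frame :: "nat set \<Rightarrow> nat set \<Rightarrow> (nat \<Rightarrow> nat \<Rightarrow> nat) \<Rightarrow> (nat \<Rightarrow> nat \<Rightarrow> nat) \<Rightarrow> bool" where
  "frame X Y m m' \<longleftrightarrow> (\<forall>v. v \<notin> X \<longrightarrow> m' 0 v = m 0 v) \<and> (\<forall>k. k \<noteq> 0 \<longrightarrow> k \<notin> Y \<longrightarrow> m' k = m k)"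

lemma frame_refl [simp]: "frame X Y m m"
  by (simp add: frame_def)

lemma frame_scalar [simp]: "v \<in> X \<Longrightarrow> frame X Y m (upd 0 v x m') \<longleftrightarrow> frame X Y m m'"
  by (auto simp: frame_def)

lemma frame_array [simp]: "k \<noteq> 0 \<Longrightarrow> k \<in> Y \<Longrightarrow> frame X Y m (upd k i x m') \<longleftrightarrow> frame X Y m m'"
  by (auto simp: frame_def upd_def)

lemma frame_sc: "frame X Y m m' \<Longrightarrow> v \<notin> X \<Longrightarrow> m' 0 v = m 0 v"
  and frame_ar: "frame X Y m m' \<Longrightarrow> k \<noteq> 0 \<Longrightarrow> k \<notin> Y \<Longrightarrow> m' k = m k"
  by (auto simp: frame_def)

lemma frame_trans: "frame X Y m m' \<Longrightarrow> frame X' Y' m' m'' \<Longrightarrow> X \<subseteq> Z \<Longrightarrow> X' \<subseteq> Z \<Longrightarrow> Y \<subseteq> R \<Longrightarrow> Y' \<subseteq> R \<Longrightarrow>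
    frame Z R m m''"
  unfolding frame_def by (metis subsetD)

lemma frame_env: "frame X Y m m' \<Longrightarrow> env n a m \<Longrightarrow> 0 \<notin> X \<Longrightarrow> 15 \<notin> X \<Longrightarrow> 1 \<notin> Y \<Longrightarrow> 2 \<notin> Y \<Longrightarrow> 7 \<notin> Y \<Longrightarrow> env n a m'"
  unfolding frame_def env_def by (simp del: One_nat_def)

lemma mat_at_upd_other [simp]: "k \<noteq> 5 \<Longrightarrow> mat_at n C (upd k i x m) \<longleftrightarrow> mat_at n C m"
  by (simp add: mat_at_def)

lemma used_flags_upd_other [simp]: "k \<noteq> 6 \<Longrightarrow> used_flags n U (upd k i x m) \<longleftrightarrow> used_flags n U m"
  by (simp add: used_flags_def)

lemma env_upd_other [simp]: "k \<notin> {0, 1, 2, 7} \<Longrightarrow> env n a (upd k i x m) \<longleftrightarrow> env n a m"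
  by (auto simp: env_def)

lemma env_upd_scalar [simp]: "v \<noteq> 0 \<Longrightarrow> v \<noteq> 15 \<Longrightarrow> env n a (upd 0 v x m) \<longleftrightarrow> env n a m"
  by (auto simp: env_def)

lemma envD: assumes "env n a m" shows "m 0 0 = n" "m 0 15 = n + n" "i \<le> n + n \<Longrightarrow> m 2 i = i * (n + 1)"
    "i < n \<Longrightarrow> j < n \<Longrightarrow> m 1 (i * (n + 1) + j) = bn (a i j)" "i \<le> n \<Longrightarrow> m 7 i = fib (i + 2)"
  using assms by (auto simp: env_def)

lemma mat_atD: "mat_at n C m \<Longrightarrow> i < n + n \<Longrightarrow> j \<le> n \<Longrightarrow> m 5 (i * (n + 1) + j) = bn (C i j)"
  by (simp add: mat_at_def)

lemma usdD: "used_flags n U m \<Longrightarrow> i < n + n \<Longrightarrow> m 6 i = (if i \<in> U then 0 else 1)"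
  by (simp add: used_flags_def)

lemma mat_at_cong: "mat_at n C m \<Longrightarrow> (\<And>i j. i < n + n \<Longrightarrow> j \<le> n \<Longrightarrow> C i j = C' i j) \<Longrightarrow> mat_at n C' m"
  by (simp add: mat_at_def)

lemma idx_inj: "j \<le> n \<Longrightarrow> j' \<le> n \<Longrightarrow> i * (n + 1) + j = i' * (n + 1) + j' \<longleftrightarrow> i = i' \<and> j = (j' :: nat)"
proof
  assume j: "j \<le> n" "j' \<le> n" and e: "i * (n + 1) + j = i' * (n + 1) + j'"
  have "(k * (n + 1) + l) div (n + 1) = k" if "l \<le> n" for k l
    using that by (subst div_mult_self3) auto
  then have "(i * (n + 1) + j) div (n + 1) = i" "(i' * (n + 1) + j') div (n + 1) = i'" using j by blast+
  then have "i = i'" using e by simp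
  then show "i = i' \<and> j = j'" using e by simp
qed simp

lemma mat_at_put:
  assumes "mat_at n C m" "i < n + n" "j \<le> n"
  shows "mat_at n (\<lambda>i' j'. if i' = i \<and> j' = j then b else C i' j') (upd 5 (i * (n + 1) + j) (bn b) m)"
  unfolding mat_at_def
proof (intro allI impI)
  fix i' j' assume *: "i' < n + n" "j' \<le> n"
  then show "upd 5 (i * (n + 1) + j) (bn b) m 5 (i' * (n + 1) + j') = bn (if i' = i \<and> j' = j then b else C i' j')"
    using assms(3) idx_inj[of j' n j i' i] mat_atD[OF assms(1) *] by (auto simp del: add_mult_distrib2 mult_Suc_right)
qed

lemma used_flags_put: "used_flags n U m \<Longrightarrow> used_flags n (U - {i}) (upd 6 i 1 m)"
  by (auto simp: used_flags_def)

definition row_com :: com where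
  "row_com = For 2 (Plus (V 0) (N 1)) (PutB (V 1) (V 2) (Xor (Bent (V 1) (V 2)) (Bent (V 6) (V 2))))"

definition col_com :: com where
  "col_com = SetV 5 (N 0) ;; For 1 (V 15) (If (Minus (Bent (V 1) (V 4)) (Ix 6 (V 1)))
     (If (V 5) row_com (SetV 5 (N 1) ;; SetV 6 (V 1) ;; Put 6 (V 1) (N 1) ;; SetV 7 (Plus (V 7) (N 1)))) Skip)"

text \<open>The system is unsolvable iff a row that never became a pivot row ends with right-hand
  side 1.\<close>

definition elim_com :: com where
  "elim_com = SetV 7 (N 0) ;; For 4 (V 0) col_com ;; SetV 8 (N 1) ;;
     For 1 (V 15) (If (Minus (Bent (V 1) (V 0)) (Ix 6 (V 1))) (SetV 8 (N 0)) Skip)"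

definition clear_com :: com where
  "clear_com = For 1 (V 15) (For 2 (Plus (V 0) (N 1)) (PutB (V 1) (V 2) (N 0)) ;; Put 6 (V 1) (N 0))"

definition copy_com :: com where
  "copy_com = For 2 (V 0) (PutB (Plus (V 0) (V 1)) (V 2) (Aent (V 1) (V 2)))"

text \<open>The condition is positive iff the coordinate is 0 or its bit is 0, which is when the
  equation \<open>d = 1\<close> is forced.\<close>

definition build_com :: com where
  "build_com = clear_com ;; For 1 (V 9) (PutB (V 1) (V 1) (N 1) ;; PutB (V 1) (V 0) (Ix 3 (Plus (V 1) (N 1))) ;;
     If (Plus (Minus (N 1) (V 1)) (Minus (N 1) (Ix 3 (Plus (V 1) (N 1)))))
       (copy_com ;; PutB (Plus (V 0) (V 1)) (V 0) (Minus (N 1) (Ix 4 (V 1)))) Skip)"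

text \<open>On bits, the truncated \<open>a + x - 1\<close> is the product. Scalar 16 accumulates
  the entry of \<open>d\<close> while the row is written; column 0 contributes to \<open>d\<close>
  but is not stored, which performs the erasure.\<close>

definition drow_com :: com where
  "drow_com = SetV 17 (Minus (Plus (Aent (V 1) (V 2)) (Ix 3 (Plus (V 2) (N 1)))) (N 1)) ;;
     SetV 16 (Xor (V 16) (V 17)) ;; If (V 2) (PutB (V 1) (V 2) (V 17)) Skip"

definition detb_com :: com where
  "detb_com = clear_com ;; For 1 (V 0) (SetV 16 (Ix 4 (V 1)) ;; For 2 (V 0) drow_com ;;
     PutB (V 1) (V 1) (Xor (Bent (V 1) (V 1)) (V 16)))"

text \<open>A binary counter: trailing ones belong to finished subtrees and are dropped, after which
  a 0 turns into 1. The sentinel stops the loop at the empty prefix, and that ends the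
  search.\<close>

definition adv_com :: com where
  "adv_com = While (Ix 3 (V 9)) (SetV 9 (Minus (V 9) (N 1))) ;; If (V 9) (Put 3 (V 9) (N 1)) (SetV 10 (N 0))"

text \<open>Truncation makes \<open>1 - (n - r)\<close> equal to 1 iff the rank \<open>r\<close> is
  full. In weight mode the rank is the one left by the test of the node, whose
  \<open>2 ^ (n - r)\<close> solutions have the weight at index \<open>n - r\<close> of the
  table.\<close>

definition leaf_com :: com where
  "leaf_com = If (V 14) ((detb_com ;; elim_com) ;; SetV 11 (Plus (V 11) (Minus (N 1) (Minus (V 0) (V 7)))))
     (SetV 11 (Plus (V 11) (Ix 7 (Minus (V 0) (V 7)))))"

definition body_com :: com where
  "body_com = (build_com ;; elim_com) ;; If (V 8)
     (If (Minus (V 13) (V 9)) (SetV 9 (Plus (V 9) (N 1)) ;; Put 3 (V 9) (N 0)) (leaf_com ;; adv_com)) adv_com"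

definition trav_com :: com where
  "trav_com = SetV 11 (N 0) ;; SetV 9 (N 0) ;; Put 3 (N 0) (N 0) ;; SetV 10 (N 1) ;; While (V 10) body_com"

definition head_com :: com where
  "head_com = Get 0 (N 0) ;; SetV 15 (Plus (V 0) (V 0)) ;; Put 2 (N 0) (N 0) ;;
     For 1 (V 15) (Put 2 (Plus (V 1) (N 1)) (Plus (Ix 2 (V 1)) (Plus (V 0) (N 1))))"

definition rows_com :: com where
  "rows_com = For 1 (V 0) (For 2 (V 0) (Get 1 (Plus (Ix 2 (V 1)) (V 2))))"

definition fibs_com :: com where
  "fibs_com = Put 7 (N 0) (N 1) ;; Put 7 (N 1) (N 2) ;;
     For 1 (V 0) (Put 7 (Plus (V 1) (N 2)) (Plus (Ix 7 (V 1)) (Ix 7 (Plus (V 1) (N 1)))))"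

text \<open>The traversals go to depth \<open>t + 1\<close>, the first level that bit
  \<open>t\<close> influences. The second one leaves the bit at 1, so it is reset only if 0 is
  strictly better.\<close>

definition sel_com :: com where
  "sel_com = Put 4 (V 3) (N 0) ;; SetV 13 (Plus (V 3) (N 1)) ;; trav_com ;; SetV 12 (V 11) ;;
     Put 4 (V 3) (N 1) ;; trav_com ;; If (Minus (V 11) (V 12)) (Put 4 (V 3) (N 0)) Skip"

text \<open>The sum is at most \<open>fib (n + 2)\<close>, so reducing it by repeated subtraction of
  2 is affordable. The case \<open>n = 0\<close> is separate: the empty determinant is 1, but there
  is no cycle on the empty vertex set.\<close>

definition final_com :: com where
  "final_com = If (V 0) (SetV 14 (N 1) ;; SetV 13 (V 0) ;; trav_com ;;
     While (Minus (V 11) (N 1)) (SetV 11 (Minus (V 11) (N 2)))) (SetV 11 (N 0))"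

definition main_com :: com where
  "main_com = head_com ;; rows_com ;; fibs_com ;; For 3 (V 0) sel_com ;; final_com"

section \<open>Verification of the program\<close>

text \<open>\<open>S\<close> has room for the \<open>2 * n\<close> rows of length
  \<open>n + 1\<close>, for the vectors and for the scalars. \<open>B\<close> must hold the sums
  over the leaves, which may reach \<open>2 * fib (n + 2)\<close> while a shift bit is being chosen.
  \<open>L\<close> limits the polynomial loops, none of which runs more than \<open>2 * n\<close>
  rounds apart from small additive constants.\<close>

locale bounds =
  fixes n B S L :: nat
  assumes S: "S = (n + n) * (n + 1) + n + 30" and SB: "S \<le> B" and FB: "4 * fib (n + 3) \<le> B" and L: "n + n + 2 \<le> L"
begin

abbreviation "WK \<equiv> \<lambda>c. W B S (cost L c) c"

lemma idx_lt: "i < n + n \<Longrightarrow> j \<le> n \<Longrightarrow> i * (n + 1) + j < S"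
proof -
  assume "i < n + n" "j \<le> n"
  then have "Suc i * (n + 1) \<le> (n + n) * (n + 1)" by (intro mult_le_mono1) simp
  then show ?thesis using \<open>j \<le> n\<close> unfolding S by simp
qed

lemma small [simp]: "v < 30 \<Longrightarrow> v < S" "n < S" "n + n < S" "v \<le> 30 \<Longrightarrow> v \<le> B" "n \<le> B" "n + n \<le> B" "n + 1 \<le> B" "Suc n \<le> B"
  "n + 1 \<le> L" "Suc n \<le> L" "n \<le> L" "n + n \<le> L"
  using S SB L by auto

lemma bn_le_B [simp]: "bn b \<le> B"
  using bn_le[of b] small(4)[of 1] by linarith

section \<open>Verification of the elimination\<close>

lemma W_row:
  assumes m: "env n a m" "mat_at n C m" "m 0 1 = i" "m 0 6 = q" "i < n + n" "q < n + n" "i \<noteq> q"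
    and Q: "\<And>m'. frame {2} {5} m m' \<Longrightarrow> mat_at n (\<lambda>i' j'. if i' = i then C i j' + C q j' else C i' j') m' \<Longrightarrow> Q m' xs"
  shows "WK row_com Q m xs"
  unfolding row_com_def
proof (rule W_For[where k = "n + 1" and I = "\<lambda>j m' xs'. xs' = xs \<and> frame {2} {5} m m' \<and> m' 0 2 = j \<and>
    mat_at n (\<lambda>i' j'. if i' = i \<and> j' < j then C i j' + C q j' else C i' j') m'"])
  show "xs = xs \<and> frame {2} {5} m (upd 0 2 0 m) \<and> (upd 0 2 0 m) 0 2 = 0 \<and>
    mat_at n (\<lambda>i' j'. if i' = i \<and> j' < 0 then C i j' + C q j' else C i' j') (upd 0 2 0 m)"
    using m(2) by simp
next
  fix j m' xs' assume I: "xs' = xs \<and> frame {2} {5} m m' \<and> m' 0 2 = j \<and>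
    mat_at n (\<lambda>i' j'. if i' = i \<and> j' < j then C i j' + C q j' else C i' j') m'"
  then have "env n a m'" using m(1) frame_env by auto
  then show "m' 0 2 = j \<and> val m' (Plus (V 0) (N 1)) = n + 1" using I by (simp add: envD)
next
  fix j m' xs' assume j: "j < n + 1" and I: "xs' = xs \<and> frame {2} {5} m m' \<and> m' 0 2 = j \<and>
    mat_at n (\<lambda>i' j'. if i' = i \<and> j' < j then C i j' + C q j' else C i' j') m'"
  then have e: "env n a m'" using m(1) frame_env by auto
  have sc: "m' 0 1 = i" "m' 0 6 = q" "m' 0 2 = j" using I m frame_sc[of "{2}" "{5}" m m'] by auto
  have b: "m' 5 (i * (n + 1) + j) = bn (C i j)" "m' 5 (q * (n + 1) + j) = bn (C q j)"
    using I m(5-7) j mat_atD[of n _ m'] by auto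
  have r: "m' 2 i = i * (n + 1)" "m' 2 q = q * (n + 1)" using envD(3)[OF e] m(5,6) by auto
  have v: "val m' (Plus (Ix 2 (V 1)) (V 2)) = i * (n + 1) + j" using sc r by simp
  have x: "val m' (Xor (Bent (V 1) (V 2)) (Bent (V 6) (V 2))) = bn (C i j + C q j)"
    by (simp only: val.simps sc r b bn_xor)
  have "mat_at n (\<lambda>i' j'. if i' = i \<and> j' = j then C i j + C q j else
     (if i' = i \<and> j' < j then C i j' + C q j' else C i' j')) (upd 5 (i * (n + 1) + j) (bn (C i j + C q j)) m')"
    using I m(5) j by (intro mat_at_put) auto
  then have M: "mat_at n (\<lambda>i' j'. if i' = i \<and> j' < Suc j then C i j' + C q j' else C i' j')
      (upd 5 (i * (n + 1) + j) (bn (C i j + C q j)) m')"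
    by (rule mat_at_cong) (auto simp: less_Suc_eq)
  show "WK (PutB (V 1) (V 2) (Xor (Bent (V 1) (V 2)) (Bent (V 6) (V 2))))
     (\<lambda>m'a xs'a. m'a 0 2 = j \<and> xs'a = xs \<and> frame {2} {5} m (upd 0 2 (Suc j) m'a) \<and>
        (upd 0 2 (Suc j) m'a) 0 2 = Suc j \<and>
        mat_at n (\<lambda>i' j'. if i' = i \<and> j' < Suc j then C i j' + C q j' else C i' j') (upd 0 2 (Suc j) m'a)) m' xs'"
    using I idx_lt[of i j] m(5) j M sc by (intro W_Put) (simp_all only: v x bn_le_B, auto)
next
  fix m' xs' assume "xs' = xs \<and> frame {2} {5} m m' \<and> m' 0 2 = n + 1 \<and>
    mat_at n (\<lambda>i' j'. if i' = i \<and> j' < n + 1 then C i j' + C q j' else C i' j') m'"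
  then show "Q m' xs'" using Q mat_at_cong[of n _ m' "\<lambda>i' j'. if i' = i then C i j' + C q j' else C i' j'"] by auto
qed simp_all


text \<open>Before a pivot is found the matrix is untouched and the rows of \<open>U\<close> seen so
  far have entry 0 in column \<open>c\<close>. Afterwards the rows seen so far are reduced; those of
  \<open>U\<close> before the pivot row need no change, as their entry was 0, so one formula
  describes all rows.\<close>

definition col_inv :: "(nat \<Rightarrow> nat \<Rightarrow> bit) \<Rightarrow> nat set \<Rightarrow> nat \<Rightarrow> nat \<Rightarrow> nat \<Rightarrow> (nat \<Rightarrow> nat \<Rightarrow> nat) \<Rightarrow> bool" where
  "col_inv C U c r i m \<longleftrightarrow>
     (m 0 5 = 0 \<and> m 0 7 = r \<and> mat_at n C m \<and> used_flags n U m \<and> (\<forall>l<i. l \<in> U \<longrightarrow> C l c = 0)) \<or>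
     (\<exists>q<i. q \<in> U \<and> C q c = 1 \<and> m 0 5 = 1 \<and> m 0 6 = q \<and> m 0 7 = r + 1 \<and> used_flags n (U - {q}) m \<and>
        mat_at n (\<lambda>l j. if l \<in> U - {q} \<and> l < i \<and> C l c = 1 then C l j + C q j else C l j) m)"

lemma col_inv_noI:
  "m 0 5 = 0 \<Longrightarrow> m 0 7 = r \<Longrightarrow> mat_at n C m \<Longrightarrow> used_flags n U m \<Longrightarrow> \<forall>l<i. l \<in> U \<longrightarrow> C l c = 0 \<Longrightarrow> col_inv C U c r i m"
  unfolding col_inv_def by (intro disjI1 conjI)

lemma col_inv_yesI:
  "q < i \<Longrightarrow> q \<in> U \<Longrightarrow> C q c = 1 \<Longrightarrow> m 0 5 = 1 \<Longrightarrow> m 0 6 = q \<Longrightarrow> m 0 7 = r + 1 \<Longrightarrow> used_flags n (U - {q}) m \<Longrightarrow>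
     mat_at n (\<lambda>l j. if l \<in> U - {q} \<and> l < i \<and> C l c = 1 then C l j + C q j else C l j) m \<Longrightarrow> col_inv C U c r i m"
  unfolding col_inv_def by (intro disjI2 exI[of _ q] conjI)

lemma col_inv_upd [simp]: "v \<notin> {5, 6, 7} \<Longrightarrow> col_inv C U c r i (upd 0 v x m) \<longleftrightarrow> col_inv C U c r i m"
  unfolding col_inv_def by simp

lemma col_invE:
  assumes "col_inv C U c r i m"
  obtains (no) "m 0 5 = 0" "m 0 7 = r" "mat_at n C m" "used_flags n U m" "\<forall>l<i. l \<in> U \<longrightarrow> C l c = 0"
    | (yes) q where "q < i" "q \<in> U" "C q c = 1" "m 0 5 = 1" "m 0 6 = q" "m 0 7 = r + 1" "used_flags n (U - {q}) m"
        "mat_at n (\<lambda>l j. if l \<in> U - {q} \<and> l < i \<and> C l c = 1 then C l j + C q j else C l j) m"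
  using assms unfolding col_inv_def
proof
  assume "m 0 5 = 0 \<and> m 0 7 = r \<and> mat_at n C m \<and> used_flags n U m \<and> (\<forall>l<i. l \<in> U \<longrightarrow> C l c = 0)"
  then show thesis by (elim conjE) (rule no)
next
  assume "\<exists>q<i. q \<in> U \<and> C q c = 1 \<and> m 0 5 = 1 \<and> m 0 6 = q \<and> m 0 7 = r + 1 \<and> used_flags n (U - {q}) m \<and>
        mat_at n (\<lambda>l j. if l \<in> U - {q} \<and> l < i \<and> C l c = 1 then C l j + C q j else C l j) m"
  then show thesis by (elim exE conjE) (rule yes)
qed

text \<open>The equation between the solution counts covers both cases: for \<open>r' = r\<close>
  the column is free and the count halves, for \<open>r' = r + 1\<close> a factor 2 cancels and the
  count is preserved.\<close>

lemma W_col: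
  assumes m: "env n a m" "mat_at n C m" "used_flags n U m" "m 0 4 = c" "c < n" "U \<subseteq> {..<n + n}" "m 0 7 = r" "r \<le> n"
    and Q: "\<And>m' C' U' r'. frame {1, 2, 5, 6, 7} {5, 6} m m' \<Longrightarrow> mat_at n C' m' \<Longrightarrow> used_flags n U' m' \<Longrightarrow> U' \<subseteq> {..<n + n} \<Longrightarrow>
      m' 0 7 = r' \<Longrightarrow> r \<le> r' \<Longrightarrow> r' \<le> r + 1 \<Longrightarrow>
      card (lsol n c U C) * 2 ^ (r' - r) = 2 * card (lsol n (Suc c) U' C') \<Longrightarrow> Q m' xs"
  shows "WK col_com Q m xs"
proof -
  let ?F = "frame {1, 2, 5, 6, 7} {5, 6} m"
  let ?b = "If (Minus (Bent (V 1) (V 4)) (Ix 6 (V 1)))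
     (If (V 5) row_com (SetV 5 (N 1) ;; SetV 6 (V 1) ;; Put 6 (V 1) (N 1) ;; SetV 7 (Plus (V 7) (N 1)))) Skip"
  have "WK (For 1 (V 15) ?b) Q (upd 0 5 0 m) xs"
  proof (rule W_For[where k = "n + n" and I = "\<lambda>i m' xs'. xs' = xs \<and> ?F m' \<and> m' 0 1 = i \<and> col_inv C U c r i m'"])
    show "xs = xs \<and> ?F (upd 0 1 0 (upd 0 5 0 m)) \<and> (upd 0 1 0 (upd 0 5 0 m)) 0 1 = 0 \<and>
      col_inv C U c r 0 (upd 0 1 0 (upd 0 5 0 m))"
      using m by (simp add: col_inv_def)
  next
    fix i m' xs' assume I: "xs' = xs \<and> ?F m' \<and> m' 0 1 = i \<and> col_inv C U c r i m'"
    then have "env n a m'" using m(1) frame_env[of "{1, 2, 5, 6, 7}" "{5, 6}" m m'] by auto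
    then show "m' 0 1 = i \<and> val m' (V 15) = n + n" using I by (simp add: envD)
  next
    fix i m' xs' assume i: "i < n + n" and I: "xs' = xs \<and> ?F m' \<and> m' 0 1 = i \<and> col_inv C U c r i m'"
    then have F: "?F m'" and i1: "m' 0 1 = i" and xs: "xs' = xs" by auto
    have e: "env n a m'" using m(1) frame_env[OF F m(1)] by auto
    have c: "m' 0 4 = c" using frame_sc[OF F, of 4] m(4) by simp
    have r2: "m' 2 i = i * (n + 1)" using envD(3)[OF e] i by auto
    have v: "val m' (Bent (V 1) (V 4)) = m' 5 (i * (n + 1) + c)" by (simp only: val.simps i1 c r2)
    let ?R = "\<lambda>m'' xs''. m'' 0 1 = i \<and> xs'' = xs \<and> ?F (upd 0 1 (Suc i) m'') \<and> (upd 0 1 (Suc i) m'') 0 1 = Suc i \<and>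
        col_inv C U c r (Suc i) (upd 0 1 (Suc i) m'')"
    from I have "col_inv C U c r i m'" by blast
    then show "WK ?b ?R m' xs'"
    proof (cases rule: col_invE)
      case no
      have val: "val m' (Minus (Bent (V 1) (V 4)) (Ix 6 (V 1))) = bn (C i c) - (if i \<in> U then 0 else 1)"
        unfolding val.simps(4) v using mat_atD[OF no(3), of i c] usdD[OF no(4), of i] i m(5) i1 by simp
      show ?thesis
      proof (rule W_If)
        assume "0 < val m' (Minus (Bent (V 1) (V 4)) (Ix 6 (V 1)))"
        then have iU: "i \<in> U" "C i c = 1" unfolding val using bn_le[of "C i c"] by (auto simp: bn_pos split: if_splits)
        have S1: "i < S" using i S by simp
        have fin: "?R (upd 0 7 (r + 1) (upd 6 i 1 (upd 0 6 i (upd 0 5 1 m')))) xs'"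
        proof -
          have "mat_at n (\<lambda>l j. if l \<in> U - {i} \<and> l < Suc i \<and> C l c = 1 then C l j + C i j else C l j) m'"
            by (rule mat_at_cong[OF no(3)]) (use no(5) in \<open>auto simp: less_Suc_eq\<close>)
          then have "col_inv C U c r (Suc i) (upd 0 7 (r + 1) (upd 6 i 1 (upd 0 6 i (upd 0 5 1 m'))))"
            using used_flags_put[of n U "upd 0 6 i (upd 0 5 1 m')" i] no(4) by (intro col_inv_yesI[where q = i] iU) simp_all
          then show ?thesis using F i1 xs by simp
        qed
        have B: "i \<le> B" "r + 1 \<le> B" using i m(8) S SB by simp_all
        show "WK (If (V 5) row_com (SetV 5 (N 1) ;; SetV 6 (V 1) ;; Put 6 (V 1) (N 1) ;; SetV 7 (Plus (V 7) (N 1)))) ?R m' xs'"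
        proof (rule W_If)
          show "WK (SetV 5 (N 1) ;; SetV 6 (V 1) ;; Put 6 (V 1) (N 1) ;; SetV 7 (Plus (V 7) (N 1))) ?R m' xs'"
            using fin no(2) i1 S1 B by (intro W_Seq W_Put) simp_all
        qed (use no(1) in simp)
      next
        assume "val m' (Minus (Bent (V 1) (V 4)) (Ix 6 (V 1))) = 0"
        then have "i \<in> U \<longrightarrow> C i c = 0" unfolding val by (auto simp: bn_eq_0 split: if_splits)
        then have "col_inv C U c r (Suc i) m'" using no by (intro col_inv_noI) (auto simp: less_Suc_eq)
        then have "?R m' xs'" using F i1 xs by simp
        then show "WK Skip ?R m' xs'" by - (rule W_Skip)
      qed
    next
      case (yes q)
      let ?C = "\<lambda>l j. if l \<in> U - {q} \<and> l < i \<and> C l c = 1 then C l j + C q j else C l j"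
      have val: "val m' (Minus (Bent (V 1) (V 4)) (Ix 6 (V 1))) = bn (C i c) - (if i \<in> U then 0 else 1)"
        unfolding val.simps(4) v using mat_atD[OF yes(8), of i c] usdD[OF yes(7), of i] i m(5) i1 yes(1) by simp
      show ?thesis
      proof (rule W_If)
        assume "0 < val m' (Minus (Bent (V 1) (V 4)) (Ix 6 (V 1)))"
        then have iU: "i \<in> U" "C i c = 1" unfolding val using bn_le[of "C i c"] by (auto simp: bn_pos split: if_splits)
        show "WK (If (V 5) row_com (SetV 5 (N 1) ;; SetV 6 (V 1) ;; Put 6 (V 1) (N 1) ;; SetV 7 (Plus (V 7) (N 1)))) ?R m' xs'"
        proof (rule W_If)
          show "WK row_com ?R m' xs'"
          proof (rule W_row[OF e yes(8) i1 yes(5) i])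
            show "q < n + n" "i \<noteq> q" using yes(1) i by auto
            fix m'' assume F2: "frame {2} {5} m' m''"
              and M: "mat_at n (\<lambda>i' j'. if i' = i then ?C i j' + ?C q j' else ?C i' j') m''"
            have "mat_at n (\<lambda>l j. if l \<in> U - {q} \<and> l < Suc i \<and> C l c = 1 then C l j + C q j else C l j) m''"
              by (rule mat_at_cong[OF M]) (use iU yes(1) in auto)
            moreover have "?F m''" by (rule frame_trans[OF F F2]) auto
            moreover have "used_flags n (U - {q}) m''" using yes(7) frame_ar[OF F2, of 6] by (simp add: used_flags_def)
            moreover have "m'' 0 5 = 1" "m'' 0 6 = q" "m'' 0 7 = r + 1" "m'' 0 1 = i"
              using yes(4-6) i1 frame_sc[OF F2] by auto
            moreover have "col_inv C U c r (Suc i) m''"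
              by (rule col_inv_yesI[where q = q]) (use calculation yes(1-3) in simp_all)
            ultimately show "?R m'' xs'" using xs by simp
          qed
        qed (use yes(4) in simp)
      next
        assume "val m' (Minus (Bent (V 1) (V 4)) (Ix 6 (V 1))) = 0"
        then have iU: "i \<in> U \<longrightarrow> C i c = 0" unfolding val by (auto simp: bn_eq_0 split: if_splits)
        have "mat_at n (\<lambda>l j. if l \<in> U - {q} \<and> l < Suc i \<and> C l c = 1 then C l j + C q j else C l j) m'"
          by (rule mat_at_cong[OF yes(8)]) (use iU in \<open>auto simp: less_Suc_eq\<close>)
        then have "col_inv C U c r (Suc i) m'" using yes(1-7) by (intro col_inv_yesI[where q = q]) auto
        then have "?R m' xs'" using F i1 xs by simp
        then show "WK Skip ?R m' xs'" by - (rule W_Skip)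
      qed
    qed
  next
    fix m' xs' assume I: "xs' = xs \<and> ?F m' \<and> m' 0 1 = n + n \<and> col_inv C U c r (n + n) m'"
    from I have "col_inv C U c r (n + n) m'" by blast
    then show "Q m' xs'"
    proof (cases rule: col_invE)
      case no
      have "card (lsol n c U C) = 2 * card (lsol n (Suc c) U C)"
        using lsol_no_pivot[OF m(5), of U C] no(5) m(6) by blast
      then show ?thesis using Q[of m' C U r] I no m(6) by simp
    next
      case (yes q)
      let ?C = "\<lambda>l j. if l \<in> U - {q} \<and> l < n + n \<and> C l c = 1 then C l j + C q j else C l j"
      have "card (lsol n c U C) = card (lsol n (Suc c) (U - {q}) ?C)"
        by (rule lsol_pivot[where B = C and q = q, OF m(5) yes(2,3)]) (use m(6) in auto)
      then show ?thesis using Q[of m' ?C "U - {q}" "r + 1"] I yes m(6) by auto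
    qed
  qed simp_all
  then show ?thesis unfolding col_com_def by (intro W_Seq W_Put) simp_all
qed

lemma W_elim:
  assumes m: "env n a m" "mat_at n C m" "used_flags n {..<n + n} m"
    and Q: "\<And>m' r. frame {1, 2, 4, 5, 6, 7, 8} {5, 6} m m' \<Longrightarrow> m' 0 7 = r \<Longrightarrow> r \<le> n \<Longrightarrow>
      (m' 0 8 = 1 \<and> card (lsol n 0 {..<n + n} C) = 2 ^ (n - r)) \<or> (m' 0 8 = 0 \<and> card (lsol n 0 {..<n + n} C) = 0) \<Longrightarrow> Q m' xs"
  shows "WK elim_com Q m xs"
proof -
  let ?F = "frame {1, 2, 4, 5, 6, 7, 8} {5, 6} m"
  let ?X = "card (lsol n 0 {..<n + n} C)"
  let ?chk = "For 1 (V 15) (If (Minus (Bent (V 1) (V 0)) (Ix 6 (V 1))) (SetV 8 (N 0)) Skip)"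
  \<comment> \<open>After \<open>c\<close> columns with \<open>r\<close> pivots the count has been
    halved \<open>c - r\<close> times; stated multiplicatively to avoid division.\<close>
  let ?J = "\<lambda>c m'. \<exists>C' U r. ?F m' \<and> mat_at n C' m' \<and> used_flags n U m' \<and> U \<subseteq> {..<n + n} \<and> m' 0 7 = r \<and> r \<le> c \<and>
    ?X * 2 ^ r = 2 ^ c * card (lsol n c U C')"
  have env: "env n a m'" if "?F m'" for m' using frame_env[OF that m(1)] by auto
  have check: "WK ?chk Q m1 xs"
    if F1: "?F m1" and M: "mat_at n C' m1" and U: "used_flags n U m1" "U \<subseteq> {..<n + n}" and r: "m1 0 7 = r" "r \<le> n" and m8: "m1 0 8 = 1"
      and X: "?X * 2 ^ r = 2 ^ n * card (lsol n n U C')" for m1 C' U r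
  proof (rule W_For[where k = "n + n" and I = "\<lambda>i m' xs'. xs' = xs \<and> frame {1, 8} {} m1 m' \<and> m' 0 1 = i \<and>
      m' 0 8 = (if \<forall>l<i. l \<in> U \<longrightarrow> C' l n = 0 then 1 else 0)"])
    show "xs = xs \<and> frame {1, 8} {} m1 (upd 0 1 0 m1) \<and> (upd 0 1 0 m1) 0 1 = 0 \<and>
      (upd 0 1 0 m1) 0 8 = (if \<forall>l<0. l \<in> U \<longrightarrow> C' l n = 0 then 1 else 0)"
      using m8 by simp
  next
    fix i m' xs' assume I: "xs' = xs \<and> frame {1, 8} {} m1 m' \<and> m' 0 1 = i \<and>
      m' 0 8 = (if \<forall>l<i. l \<in> U \<longrightarrow> C' l n = 0 then 1 else 0)"
    have "env n a m'" using I by (intro frame_env[OF _ env[OF F1]]) auto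
    then show "m' 0 1 = i \<and> val m' (V 15) = n + n" using I by (simp add: envD)
  next
    fix i m' xs' assume i: "i < n + n" and I: "xs' = xs \<and> frame {1, 8} {} m1 m' \<and> m' 0 1 = i \<and>
      m' 0 8 = (if \<forall>l<i. l \<in> U \<longrightarrow> C' l n = 0 then 1 else 0)"
    then have F: "frame {1, 8} {} m1 m'" by blast
    have e: "env n a m'" by (rule frame_env[OF F env[OF F1]]) auto
    have M': "m' 5 (i * (n + 1) + n) = bn (C' i n)" using mat_atD[OF M i, of n] frame_ar[OF F, of 5] by simp
    have U': "m' 6 i = (if i \<in> U then 0 else 1)" using usdD[OF U(1) i] frame_ar[OF F, of 6] by simp
    have val: "val m' (Minus (Bent (V 1) (V 0)) (Ix 6 (V 1))) = bn (C' i n) - (if i \<in> U then 0 else 1)"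
      using I M' U' envD(1)[OF e] envD(3)[OF e, of i] i by simp
    show "WK (If (Minus (Bent (V 1) (V 0)) (Ix 6 (V 1))) (SetV 8 (N 0)) Skip)
      (\<lambda>m'a xs'a. m'a 0 1 = i \<and> xs'a = xs \<and> frame {1, 8} {} m1 (upd 0 1 (Suc i) m'a) \<and>
        (upd 0 1 (Suc i) m'a) 0 1 = Suc i \<and>
        (upd 0 1 (Suc i) m'a) 0 8 = (if \<forall>l<Suc i. l \<in> U \<longrightarrow> C' l n = 0 then 1 else 0)) m' xs'"
    proof (rule W_If)
      assume "0 < val m' (Minus (Bent (V 1) (V 0)) (Ix 6 (V 1)))"
      then have "i \<in> U" "C' i n = 1" unfolding val using bn_le[of "C' i n"] by (auto simp: bn_pos split: if_splits)
      then show "WK (SetV 8 (N 0)) (\<lambda>m'a xs'a. m'a 0 1 = i \<and> xs'a = xs \<and> frame {1, 8} {} m1 (upd 0 1 (Suc i) m'a) \<and>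
        (upd 0 1 (Suc i) m'a) 0 1 = Suc i \<and>
        (upd 0 1 (Suc i) m'a) 0 8 = (if \<forall>l<Suc i. l \<in> U \<longrightarrow> C' l n = 0 then 1 else 0)) m' xs'"
        using I by (intro W_Put) auto
    next
      assume "val m' (Minus (Bent (V 1) (V 0)) (Ix 6 (V 1))) = 0"
      then have "i \<in> U \<longrightarrow> C' i n = 0" unfolding val by (auto simp: bn_eq_0 split: if_splits)
      then show "WK Skip (\<lambda>m'a xs'a. m'a 0 1 = i \<and> xs'a = xs \<and> frame {1, 8} {} m1 (upd 0 1 (Suc i) m'a) \<and>
        (upd 0 1 (Suc i) m'a) 0 1 = Suc i \<and>
        (upd 0 1 (Suc i) m'a) 0 8 = (if \<forall>l<Suc i. l \<in> U \<longrightarrow> C' l n = 0 then 1 else 0)) m' xs'"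
        using I by (intro W_Skip) (auto simp: less_Suc_eq)
    qed
  next
    fix m' xs' assume I: "xs' = xs \<and> frame {1, 8} {} m1 m' \<and> m' 0 1 = n + n \<and>
      m' 0 8 = (if \<forall>l<n + n. l \<in> U \<longrightarrow> C' l n = 0 then 1 else 0)"
    have F: "?F m'" using I by (intro frame_trans[OF F1, of "{1, 8}" "{}"]) auto
    have r7: "m' 0 7 = r" using I r(1) frame_sc[of "{1, 8}" "{}" m1 m' 7] by auto
    have eq: "(\<forall>l<n + n. l \<in> U \<longrightarrow> C' l n = 0) \<longleftrightarrow> (\<forall>l\<in>U. C' l n = 0)" using U(2) by auto
    have "(m' 0 8 = 1 \<and> ?X = 2 ^ (n - r)) \<or> (m' 0 8 = 0 \<and> ?X = 0)"
    proof (cases "\<forall>l\<in>U. C' l n = 0")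
      case True
      have "(2::nat) ^ n = 2 ^ (n - r) * 2 ^ r" using r(2) by (simp add: power_add[symmetric])
      then show ?thesis using X True I eq by (simp add: lsol_final)
    next
      case False
      then have "?X * 2 ^ r = 0" using X by (simp add: lsol_final)
      then have "?X = 0" by (metis mult_is_0 power_not_zero zero_neq_numeral)
      then show ?thesis using False I eq by simp
    qed
    then show "Q m' xs'" using Q[OF F r7 r(2)] I by blast
  qed simp_all
  have "WK (For 4 (V 0) col_com) (\<lambda>m' xs'. xs' = xs \<and> ?J n m') (upd 0 7 0 m) xs"
  proof (rule W_For[where k = n and I = "\<lambda>c m' xs'. xs' = xs \<and> m' 0 4 = c \<and> ?J c m' \<and> c \<le> n"])
    show "xs = xs \<and> (upd 0 4 0 (upd 0 7 0 m)) 0 4 = 0 \<and> ?J 0 (upd 0 4 0 (upd 0 7 0 m)) \<and> 0 \<le> n"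
      using m by (auto intro!: exI[of _ C] exI[of _ "{..<n + n}"])
  next
    fix c m' xs' assume I: "xs' = xs \<and> m' 0 4 = c \<and> ?J c m' \<and> c \<le> n"
    then show "m' 0 4 = c \<and> val m' (V 0) = n" using env envD(1) by auto
  next
    fix c m' xs' assume c: "c < n" and I: "xs' = xs \<and> m' 0 4 = c \<and> ?J c m' \<and> c \<le> n"
    then obtain C' U r where J: "?F m'" "mat_at n C' m'" "used_flags n U m'" "U \<subseteq> {..<n + n}" "m' 0 7 = r" "r \<le> c"
      "?X * 2 ^ r = 2 ^ c * card (lsol n c U C')" by blast
    show "WK col_com (\<lambda>m'a xs'a. m'a 0 4 = c \<and> xs'a = xs \<and> (upd 0 4 (Suc c) m'a) 0 4 = Suc c \<and>
        ?J (Suc c) (upd 0 4 (Suc c) m'a) \<and> Suc c \<le> n) m' xs'"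
    proof (rule W_col[OF env[OF J(1)] J(2,3) _ c J(4,5)])
      show "m' 0 4 = c" "r \<le> n" using I J(6) c by auto
      fix m'' C'' U'' r''
      assume A: "frame {1, 2, 5, 6, 7} {5, 6} m' m''" "mat_at n C'' m''" "used_flags n U'' m''" "U'' \<subseteq> {..<n + n}"
        "m'' 0 7 = r''" "r \<le> r''" "r'' \<le> r + 1" "card (lsol n c U C') * 2 ^ (r'' - r) = 2 * card (lsol n (Suc c) U'' C'')"
      have F: "?F m''" by (rule frame_trans[OF J(1) A(1)]) auto
      have "?X * 2 ^ r'' = ?X * 2 ^ r * 2 ^ (r'' - r)" using A(6) by (simp add: power_add[symmetric] mult.assoc)
      also have "\<dots> = 2 ^ c * (card (lsol n c U C') * 2 ^ (r'' - r))" unfolding J(7) by (rule mult.assoc)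
      also have "\<dots> = 2 ^ Suc c * card (lsol n (Suc c) U'' C'')" unfolding A(8) by simp
      finally have "?X * 2 ^ r'' = 2 ^ Suc c * card (lsol n (Suc c) U'' C'')" .
      moreover have "m'' 0 4 = c" using frame_sc[OF A(1), of 4] I by simp
      ultimately show "m'' 0 4 = c \<and> xs' = xs \<and> (upd 0 4 (Suc c) m'') 0 4 = Suc c \<and>
        ?J (Suc c) (upd 0 4 (Suc c) m'') \<and> Suc c \<le> n"
        using F A(2-5,7) J(6) I c by (auto intro!: exI[of _ C''] exI[of _ U''])
    qed
  qed simp_all
  then have "WK (For 4 (V 0) col_com) (\<lambda>m' xs'. WK (SetV 8 (N 1) ;; ?chk) Q m' xs') (upd 0 7 0 m) xs"
  proof (rule W_conseq[OF _ order_refl])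
    fix m' xs' assume "xs' = xs \<and> ?J n m'"
    then obtain C' U r where x: "xs' = xs" and J: "?F m'" "mat_at n C' m'" "used_flags n U m'" "U \<subseteq> {..<n + n}" "m' 0 7 = r" "r \<le> n"
      "?X * 2 ^ r = 2 ^ n * card (lsol n n U C')" by blast
    have "WK ?chk Q (upd 0 8 1 m') xs" by (rule check[OF _ _ _ J(4) _ J(6) _ J(7)]) (use J in simp_all)
    then show "WK (SetV 8 (N 1) ;; ?chk) Q m' xs'" unfolding x by (intro W_Seq W_Put) simp_all
  qed
  then show ?thesis unfolding elim_com_def by (intro W_Seq W_Put) simp_all
qed


section \<open>Setting up the linear system of a prefix\<close>

lemma W_clear:
  assumes m: "env n a m"
    and Q: "\<And>m'. frame {1, 2} {5, 6} m m' \<Longrightarrow> mat_at n (\<lambda>_ _. 0) m' \<Longrightarrow> used_flags n {..<n + n} m' \<Longrightarrow> Q m' xs"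
  shows "WK clear_com Q m xs"
  unfolding clear_com_def
proof (rule W_For[where k = "n + n" and I = "\<lambda>i m' xs'. xs' = xs \<and> frame {1, 2} {5, 6} m m' \<and> m' 0 1 = i \<and>
    (\<forall>l<i. m' 6 l = 0) \<and> (\<forall>l<i. \<forall>j\<le>n. m' 5 (l * (n + 1) + j) = 0)"])
  show "xs = xs \<and> frame {1, 2} {5, 6} m (upd 0 1 0 m) \<and> (upd 0 1 0 m) 0 1 = 0 \<and>
    (\<forall>l<0. (upd 0 1 0 m) 6 l = 0) \<and> (\<forall>l<0. \<forall>j\<le>n. (upd 0 1 0 m) 5 (l * (n + 1) + j) = 0)" by simp
next
  fix i m' xs' assume I: "xs' = xs \<and> frame {1, 2} {5, 6} m m' \<and> m' 0 1 = i \<and>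
    (\<forall>l<i. m' 6 l = 0) \<and> (\<forall>l<i. \<forall>j\<le>n. m' 5 (l * (n + 1) + j) = 0)"
  have "env n a m'" using I by (intro frame_env[OF _ m]) auto
  then show "m' 0 1 = i \<and> val m' (V 15) = n + n" using I by (simp add: envD)
next
  fix i m' xs' assume i: "i < n + n" and I: "xs' = xs \<and> frame {1, 2} {5, 6} m m' \<and> m' 0 1 = i \<and>
    (\<forall>l<i. m' 6 l = 0) \<and> (\<forall>l<i. \<forall>j\<le>n. m' 5 (l * (n + 1) + j) = 0)"
  then have F: "frame {1, 2} {5, 6} m m'" by blast
  let ?R = "\<lambda>m'a xs'a. m'a 0 1 = i \<and> xs'a = xs \<and> frame {1, 2} {5, 6} m (upd 0 1 (Suc i) m'a) \<and>
    (upd 0 1 (Suc i) m'a) 0 1 = Suc i \<and> (\<forall>l<Suc i. (upd 0 1 (Suc i) m'a) 6 l = 0) \<and>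
    (\<forall>l<Suc i. \<forall>j\<le>n. (upd 0 1 (Suc i) m'a) 5 (l * (n + 1) + j) = 0)"
  let ?J = "\<lambda>j m''. frame {2} {5} m' m'' \<and> m'' 0 2 = j \<and>
    (\<forall>l<i. \<forall>j'\<le>n. m'' 5 (l * (n + 1) + j') = 0) \<and> (\<forall>j'<j. m'' 5 (i * (n + 1) + j') = 0)"
  have env: "env n a m''" if "?J j m''" for j m''
    using that by (intro frame_env[OF _ frame_env[OF F m]]) auto
  have i1: "m'' 0 1 = i" if "?J j m''" for j m'' using that I frame_sc[of "{2}" "{5}" m' m'' 1] by auto
  have "WK (For 2 (Plus (V 0) (N 1)) (PutB (V 1) (V 2) (N 0))) (\<lambda>m'' xs''. WK (Put 6 (V 1) (N 0)) ?R m'' xs'') m' xs'"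
  proof (rule W_For[where k = "n + 1" and I = "\<lambda>j m'' xs''. xs'' = xs \<and> ?J j m''"])
    show "xs' = xs \<and> ?J 0 (upd 0 2 0 m')" using I by simp
  next
    fix j m'' xs'' assume J: "xs'' = xs \<and> ?J j m''"
    then have "env n a m''" using env by blast
    then show "m'' 0 2 = j \<and> val m'' (Plus (V 0) (N 1)) = n + 1" using J by (simp add: envD)
  next
    fix j m'' xs'' assume j: "j < n + 1" and J: "xs'' = xs \<and> ?J j m''"
    have e: "env n a m''" and i1': "m'' 0 1 = i" using env i1 J by blast+
    have v: "val m'' (Plus (Ix 2 (V 1)) (V 2)) = i * (n + 1) + j"
      using J i1' envD(3)[OF e, of i] i by simp
    show "WK (PutB (V 1) (V 2) (N 0)) (\<lambda>m'a xs'a. m'a 0 2 = j \<and> xs'a = xs \<and> ?J (Suc j) (upd 0 2 (Suc j) m'a)) m'' xs''"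
    proof (rule W_Put)
      show "val m'' (Plus (Ix 2 (V 1)) (V 2)) < S" unfolding v using idx_lt[OF i] j by simp
      show "(upd 5 (val m'' (Plus (Ix 2 (V 1)) (V 2))) (val m'' (N 0)) m'') 0 2 = j \<and> xs'' = xs \<and>
        ?J (Suc j) (upd 0 2 (Suc j) (upd 5 (val m'' (Plus (Ix 2 (V 1)) (V 2))) (val m'' (N 0)) m''))"
        unfolding v using J by (auto simp: less_Suc_eq)
    qed simp
  next
    fix m'' xs'' assume J: "xs'' = xs \<and> ?J (n + 1) m''"
    have "frame {1, 2} {5, 6} m m''" using J by (intro frame_trans[OF F, of "{2}" "{5}"]) auto
    moreover have "m'' 6 = m' 6" using J frame_ar[of "{2}" "{5}" m' m'' 6] by auto
    moreover have "i < S" using i S by simp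
    moreover have "m'' 0 1 = i" using i1 J by blast
    moreover have "\<forall>l<Suc i. \<forall>j\<le>n. m'' 5 (l * (n + 1) + j) = 0"
    proof (intro allI impI)
      fix l j assume l: "l < Suc i" "j \<le> n"
      from J have Ja: "\<forall>l<i. \<forall>j'\<le>n. m'' 5 (l * (n + 1) + j') = 0" by blast
      from J have Jb: "\<forall>j'<n + 1. m'' 5 (i * (n + 1) + j') = 0" by blast
      show "m'' 5 (l * (n + 1) + j) = 0"
      proof (cases "l = i")
        case True
        show ?thesis unfolding True by (rule Jb[rule_format]) (use l in simp)
      next
        case False
        show ?thesis by (rule Ja[rule_format]) (use l False in simp_all)
      qed
    qed
    moreover have "xs'' = xs" using J by blast
    moreover have "\<forall>l<i. m' 6 l = 0" using I by blast
    ultimately show "WK (Put 6 (V 1) (N 0)) ?R m'' xs''"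
      by (intro W_Put) (simp_all add: less_Suc_eq)
  qed simp_all
  then show "WK (For 2 (Plus (V 0) (N 1)) (PutB (V 1) (V 2) (N 0)) ;; Put 6 (V 1) (N 0)) ?R m' xs'" by - (rule W_Seq)
next
  fix m' xs' assume "xs' = xs \<and> frame {1, 2} {5, 6} m m' \<and> m' 0 1 = n + n \<and>
    (\<forall>l<n + n. m' 6 l = 0) \<and> (\<forall>l<n + n. \<forall>j\<le>n. m' 5 (l * (n + 1) + j) = 0)"
  then show "Q m' xs'" using Q[of m'] by (simp add: mat_at_def used_flags_def)
qed simp_all

lemma W_copy:
  assumes m: "env n a m" "mat_at n C m" "m 0 1 = i" "i < n"
    and Q: "\<And>m'. frame {2} {5} m m' \<Longrightarrow> mat_at n (\<lambda>l j. if l = n + i \<and> j < n then a i j else C l j) m' \<Longrightarrow> Q m' xs"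
  shows "WK copy_com Q m xs"
  unfolding copy_com_def
proof (rule W_For[where k = n and I = "\<lambda>j m' xs'. xs' = xs \<and> frame {2} {5} m m' \<and> m' 0 2 = j \<and>
    mat_at n (\<lambda>l j'. if l = n + i \<and> j' < j then a i j' else C l j') m'"])
  show "xs = xs \<and> frame {2} {5} m (upd 0 2 0 m) \<and> (upd 0 2 0 m) 0 2 = 0 \<and>
    mat_at n (\<lambda>l j'. if l = n + i \<and> j' < 0 then a i j' else C l j') (upd 0 2 0 m)" using m by simp
next
  fix j m' xs' assume I: "xs' = xs \<and> frame {2} {5} m m' \<and> m' 0 2 = j \<and>
    mat_at n (\<lambda>l j'. if l = n + i \<and> j' < j then a i j' else C l j') m'"
  then have "env n a m'" using m(1) frame_env by auto
  then show "m' 0 2 = j \<and> val m' (V 0) = n" using I by (simp add: envD)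
next
  fix j m' xs' assume j: "j < n" and I: "xs' = xs \<and> frame {2} {5} m m' \<and> m' 0 2 = j \<and>
    mat_at n (\<lambda>l j'. if l = n + i \<and> j' < j then a i j' else C l j') m'"
  then have e: "env n a m'" using m(1) frame_env by auto
  have sc: "m' 0 1 = i" "m' 0 2 = j" "m' 0 0 = n" using I m frame_sc[of "{2}" "{5}" m m'] envD(1)[OF e] by auto
  have r: "m' 2 i = i * (n + 1)" "m' 2 (n + i) = (n + i) * (n + 1)" using envD(3)[OF e] m(4) by auto
  have v: "val m' (Plus (Ix 2 (Plus (V 0) (V 1))) (V 2)) = (n + i) * (n + 1) + j" by (simp only: val.simps sc r)
  have x: "val m' (Aent (V 1) (V 2)) = bn (a i j)" by (simp only: val.simps sc r envD(4)[OF e m(4) j])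
  have "mat_at n (\<lambda>l j'. if l = n + i \<and> j' = j then a i j else (if l = n + i \<and> j' < j then a i j' else C l j'))
     (upd 5 ((n + i) * (n + 1) + j) (bn (a i j)) m')"
    using I m(4) j by (intro mat_at_put) auto
  then have M: "mat_at n (\<lambda>l j'. if l = n + i \<and> j' < Suc j then a i j' else C l j')
      (upd 5 ((n + i) * (n + 1) + j) (bn (a i j)) m')"
    by (rule mat_at_cong) (auto simp: less_Suc_eq)
  show "WK (PutB (Plus (V 0) (V 1)) (V 2) (Aent (V 1) (V 2)))
     (\<lambda>m'a xs'a. m'a 0 2 = j \<and> xs'a = xs \<and> frame {2} {5} m (upd 0 2 (Suc j) m'a) \<and>
        (upd 0 2 (Suc j) m'a) 0 2 = Suc j \<and>
        mat_at n (\<lambda>l j'. if l = n + i \<and> j' < Suc j then a i j' else C l j') (upd 0 2 (Suc j) m'a)) m' xs'"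
    using I idx_lt[of "n + i" j] m(4) j M sc by (intro W_Put) (simp_all only: v x bn_le_B, auto)
next
  fix m' xs' assume "xs' = xs \<and> frame {2} {5} m m' \<and> m' 0 2 = n \<and>
    mat_at n (\<lambda>l j'. if l = n + i \<and> j' < n then a i j' else C l j') m'"
  then show "Q m' xs'" using Q by auto
qed simp_all

definition prefix_at :: "bit list \<Rightarrow> (nat \<Rightarrow> nat \<Rightarrow> nat) \<Rightarrow> bool" where
  "prefix_at p m \<longleftrightarrow> m 0 9 = length p \<and> m 3 0 = 0 \<and> (\<forall>i<length p. m 3 (i + 1) = bn (point p i))"

definition shift_at :: "(nat \<Rightarrow> bit) \<Rightarrow> (nat \<Rightarrow> nat \<Rightarrow> nat) \<Rightarrow> bool" where
  "shift_at \<rho> m \<longleftrightarrow> (\<forall>i<n. m 4 i = bn (\<rho> i))"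

lemma prefix_at_frame: "frame X Y m m' \<Longrightarrow> 9 \<notin> X \<Longrightarrow> 3 \<notin> Y \<Longrightarrow> prefix_at p m \<Longrightarrow> prefix_at p m'"
  by (simp add: prefix_at_def frame_def)

lemma shift_at_frame: "frame X Y m m' \<Longrightarrow> 4 \<notin> Y \<Longrightarrow> shift_at \<rho> m \<Longrightarrow> shift_at \<rho> m'"
  by (simp add: shift_at_def frame_def)

text \<open>The parameter \<open>k\<close> is the number of coordinates already entered, which makes
  this the loop invariant; at \<open>k = length p\<close> the system is complete.\<close>

definition prefix_system :: "(nat \<Rightarrow> nat \<Rightarrow> bit) \<Rightarrow> (nat \<Rightarrow> bit) \<Rightarrow> bit list \<Rightarrow> nat \<Rightarrow> nat \<Rightarrow> nat \<Rightarrow> bit" where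
  "prefix_system a \<rho> p k l j = (if l < n then (if l < k then (if j = n then point p l else if j = l then 1 else 0) else 0)
     else if l - n < k \<and> (l - n = 0 \<or> point p (l - n) = 0) then (if j = n then 1 + \<rho> (l - n) else a (l - n) j) else 0)"

lemma lsol_prefix_system_eq_sol: "length p \<le> n \<Longrightarrow> lsol n 0 {..<n + n} (prefix_system a \<rho> p (length p)) = sol n a \<rho> p"
  by (rule lsol_prefix_system) (auto simp: prefix_system_def)

lemma W_build:
  assumes m: "env n a m" "prefix_at p m" "shift_at \<rho> m" "length p \<le> n"
    and Q: "\<And>m'. frame {1, 2} {5, 6} m m' \<Longrightarrow> mat_at n (prefix_system a \<rho> p (length p)) m' \<Longrightarrow> used_flags n {..<n + n} m' \<Longrightarrow> Q m' xs"
  shows "WK build_com Q m xs"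
proof -
  let ?F = "frame {1, 2} {5, 6} m"
  let ?b = "PutB (V 1) (V 1) (N 1) ;; PutB (V 1) (V 0) (Ix 3 (Plus (V 1) (N 1))) ;;
     If (Plus (Minus (N 1) (V 1)) (Minus (N 1) (Ix 3 (Plus (V 1) (N 1)))))
       (copy_com ;; PutB (Plus (V 0) (V 1)) (V 0) (Minus (N 1) (Ix 4 (V 1)))) Skip"
  have env: "env n a m'" and prefix_at: "prefix_at p m'" and shift_at: "shift_at \<rho> m'" if "?F m'" for m'
    using frame_env[OF that m(1)] prefix_at_frame[OF that _ _ m(2)] shift_at_frame[OF that _ m(3)] by auto
  have "WK (For 1 (V 9) ?b) Q m1 xs" if F1: "?F m1" and M1: "mat_at n (\<lambda>_ _. 0) m1" and U1: "used_flags n {..<n + n} m1" for m1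
  proof (rule W_For[where k = "length p" and I = "\<lambda>i m' xs'. xs' = xs \<and> ?F m' \<and> m' 0 1 = i \<and> mat_at n (prefix_system a \<rho> p i) m' \<and> used_flags n {..<n + n} m'"])
    have "mat_at n (prefix_system a \<rho> p 0) m1" by (rule mat_at_cong[OF M1]) (simp add: prefix_system_def)
    then show "xs = xs \<and> ?F (upd 0 1 0 m1) \<and> (upd 0 1 0 m1) 0 1 = 0 \<and> mat_at n (prefix_system a \<rho> p 0) (upd 0 1 0 m1) \<and> used_flags n {..<n + n} (upd 0 1 0 m1)"
      using F1 U1 by simp
  next
    fix i m' xs' assume I: "xs' = xs \<and> ?F m' \<and> m' 0 1 = i \<and> mat_at n (prefix_system a \<rho> p i) m' \<and> used_flags n {..<n + n} m'"
    then show "m' 0 1 = i \<and> val m' (V 9) = length p" using prefix_at[of m'] by (simp add: prefix_at_def)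
  next
    fix i m' xs' assume i: "i < length p" and I: "xs' = xs \<and> ?F m' \<and> m' 0 1 = i \<and> mat_at n (prefix_system a \<rho> p i) m' \<and> used_flags n {..<n + n} m'"
    then have F: "?F m'" and i1: "m' 0 1 = i" and M: "mat_at n (prefix_system a \<rho> p i) m'" and U: "used_flags n {..<n + n} m'" and xs: "xs' = xs" by auto
    have iN: "i < n" using i m(4) by simp
    let ?R = "\<lambda>m'a xs'a. m'a 0 1 = i \<and> xs'a = xs \<and> ?F (upd 0 1 (Suc i) m'a) \<and> (upd 0 1 (Suc i) m'a) 0 1 = Suc i \<and>
      mat_at n (prefix_system a \<rho> p (Suc i)) (upd 0 1 (Suc i) m'a) \<and> used_flags n {..<n + n} (upd 0 1 (Suc i) m'a)"
    have e: "env n a m'" by (rule env[OF F])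
    have r: "m' 2 i = i * (n + 1)" using envD(3)[OF e] iN by auto
    let ?m1 = "upd 5 (i * (n + 1) + i) 1 m'"
    let ?C1 = "\<lambda>l j. if l = i \<and> j = i then 1 else prefix_system a \<rho> p i l j"
    have M2: "mat_at n ?C1 ?m1" using mat_at_put[OF M, of i i 1] iN by simp
    let ?m2 = "upd 5 (i * (n + 1) + n) (bn (point p i)) ?m1"
    let ?C2 = "\<lambda>l j. if l = i \<and> j = n then point p i else ?C1 l j"
    have M3: "mat_at n ?C2 ?m2" by (rule mat_at_put[OF M2]) (use iN in auto)
    have F2: "?F ?m2" using F by simp
    have e2: "env n a ?m2" by (rule env[OF F2])
    have x: "m' 3 (i + 1) = bn (point p i)" using prefix_at[OF F] i by (simp add: prefix_at_def)
    have v0: "val m' (Plus (Ix 2 (V 1)) (V 1)) = i * (n + 1) + i" by (simp only: val.simps i1 r)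
    have v1: "val ?m1 (Plus (Ix 2 (V 1)) (V 0)) = i * (n + 1) + n"
      "val ?m1 (Ix 3 (Plus (V 1) (N 1))) = bn (point p i)"
      using i1 r x envD(1)[OF e] by simp_all
    let ?e = "Plus (Minus (N 1) (V 1)) (Minus (N 1) (Ix 3 (Plus (V 1) (N 1))))"
    have v2: "val ?m2 ?e = (1 - i) + bn (1 + point p i)" using i1 x by (simp add: bn_not[symmetric])
    have step: "WK (If ?e (copy_com ;; PutB (Plus (V 0) (V 1)) (V 0) (Minus (N 1) (Ix 4 (V 1)))) Skip) ?R ?m2 xs"
    proof (rule W_If)
      assume "0 < val ?m2 ?e"
      \<comment> \<open>The truncated \<open>1 - i\<close> is positive only for
        \<open>i = 0\<close>.\<close>
      then have con: "i = 0 \<or> point p i = 0" unfolding v2 by (cases "point p i") auto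
      show "WK (copy_com ;; PutB (Plus (V 0) (V 1)) (V 0) (Minus (N 1) (Ix 4 (V 1)))) ?R ?m2 xs"
      proof (rule W_Seq, rule W_copy[OF e2 M3 _ iN])
        show "?m2 0 1 = i" using i1 by simp
        fix m3 assume F3: "frame {2} {5} ?m2 m3"
          and M4: "mat_at n (\<lambda>l j. if l = n + i \<and> j < n then a i j else ?C2 l j) m3"
        have F4: "?F m3" by (rule frame_trans[OF F2 F3]) auto
        have e3: "env n a m3" by (rule env[OF F4])
        have s3: "m3 0 1 = i" using frame_sc[OF F3, of 1] i1 by simp
        have u3: "used_flags n {..<n + n} m3" using frame_ar[OF F3, of 6] U by (simp add: used_flags_def)
        have "shift_at \<rho> m3" by (rule shift_at[OF F4])
        then have r3: "val m3 (Minus (N 1) (Ix 4 (V 1))) = bn (1 + \<rho> i)" using iN s3 by (simp add: shift_at_def bn_not[symmetric])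
        have v3: "val m3 (Plus (Ix 2 (Plus (V 0) (V 1))) (V 0)) = (n + i) * (n + 1) + n"
          using s3 envD(1)[OF e3] envD(3)[OF e3, of "n + i"] iN by simp
        have "mat_at n (\<lambda>l j. if l = n + i \<and> j = n then 1 + \<rho> i else if l = n + i \<and> j < n then a i j else ?C2 l j)
            (upd 5 ((n + i) * (n + 1) + n) (bn (1 + \<rho> i)) m3)"
          by (rule mat_at_put[OF M4]) (use iN in auto)
        then have M5: "mat_at n (prefix_system a \<rho> p (Suc i)) (upd 5 ((n + i) * (n + 1) + n) (bn (1 + \<rho> i)) m3)"
        proof (rule mat_at_cong)
          fix l j assume "l < n + n" "j \<le> n"
          then show "(if l = n + i \<and> j = n then 1 + \<rho> i else if l = n + i \<and> j < n then a i j else ?C2 l j) = prefix_system a \<rho> p (Suc i) l j"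
            using iN con unfolding prefix_system_def by (cases "l < n") (auto simp: less_Suc_eq split: if_splits)
        qed
        show "WK (PutB (Plus (V 0) (V 1)) (V 0) (Minus (N 1) (Ix 4 (V 1)))) ?R m3 xs"
        proof (rule W_Put, unfold v3 r3)
          show "bn (1 + \<rho> i) \<le> B" by simp
          show "(n + i) * (n + 1) + n < S" by (rule idx_lt) (use iN in auto)
          show "?R (upd 5 ((n + i) * (n + 1) + n) (bn (1 + \<rho> i)) m3) xs"
            using M5 F4 s3 u3 by simp
        qed
      qed
    next
      assume "val ?m2 ?e = 0"
      then have con: "\<not> (i = 0 \<or> point p i = 0)" unfolding v2 by (cases "point p i") auto
      have "mat_at n (prefix_system a \<rho> p (Suc i)) ?m2"
      proof (rule mat_at_cong[OF M3])
        fix l j assume "l < n + n" "j \<le> n"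
        then show "?C2 l j = prefix_system a \<rho> p (Suc i) l j"
          using iN con unfolding prefix_system_def by (cases "l < n") (auto simp: less_Suc_eq split: if_splits)
      qed
      then have "?R ?m2 xs" using F2 U i1 by simp
      then show "WK Skip ?R ?m2 xs" by - (rule W_Skip)
    qed
    show "WK ?b ?R m' xs'"
    proof (rule W_Seq, rule W_Put, unfold v0)
      show "i * (n + 1) + i < S" by (rule idx_lt) (use iN in auto)
      show "WK (PutB (V 1) (V 0) (Ix 3 (Plus (V 1) (N 1))) ;; If ?e (copy_com ;; PutB (Plus (V 0) (V 1)) (V 0) (Minus (N 1) (Ix 4 (V 1)))) Skip)
        ?R (upd 5 (i * (n + 1) + i) (val m' (N 1)) m') xs'"
        unfolding val.simps(1)
      proof (rule W_Seq, rule W_Put, unfold v1)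
        show "bn (point p i) \<le> B" by simp
        show "i * (n + 1) + n < S" by (rule idx_lt) (use iN in auto)
        show "WK (If ?e (copy_com ;; PutB (Plus (V 0) (V 1)) (V 0) (Minus (N 1) (Ix 4 (V 1)))) Skip) ?R ?m2 xs'"
          using step xs by blast
      qed
    qed simp
  next
    fix m' xs' assume "xs' = xs \<and> ?F m' \<and> m' 0 1 = length p \<and> mat_at n (prefix_system a \<rho> p (length p)) m' \<and> used_flags n {..<n + n} m'"
    then show "Q m' xs'" using Q by blast
  next
    show "length p \<le> B" "length p \<le> L" using m(4) small(5,11) by (meson le_trans)+
  qed simp
  then show ?thesis unfolding build_com_def by (intro W_Seq W_clear[OF m(1)])
qed


section \<open>The determinant at a leaf\<close>

lemma W_drow:
  assumes m: "env n a m" "prefix_at p m" "length p = n" "mat_at n C m" "m 0 1 = i" "i < n" "m 0 16 = bn d"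
    and Q: "\<And>m'. frame {2, 16, 17} {5} m m' \<Longrightarrow> m' 0 16 = bn (d + (\<Sum>v<n. a i v * point p v)) \<Longrightarrow>
      mat_at n (\<lambda>l j. if l = i \<and> j < n \<and> j \<noteq> 0 then a i j * point p j else C l j) m' \<Longrightarrow> Q m' xs"
  shows "WK (For 2 (V 0) drow_com) Q m xs"
proof -
  let ?x = "point p"
  let ?F = "frame {2, 16, 17} {5} m"
  let ?C = "\<lambda>k l j. if l = i \<and> j < k \<and> j \<noteq> 0 then a i j * ?x j else C l j"
  have env: "env n a m'" "prefix_at p m'" "m' 0 1 = i" if "?F m'" for m'
    using frame_env[OF that m(1)] prefix_at_frame[OF that _ _ m(2)] frame_sc[OF that, of 1] m(5) by auto
  show ?thesis
  proof (rule W_For[where k = n and I = "\<lambda>k m' xs'. xs' = xs \<and> ?F m' \<and> m' 0 2 = k \<and>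
      m' 0 16 = bn (d + (\<Sum>v<k. a i v * ?x v)) \<and> mat_at n (?C k) m'"])
    show "xs = xs \<and> ?F (upd 0 2 0 m) \<and> (upd 0 2 0 m) 0 2 = 0 \<and>
      (upd 0 2 0 m) 0 16 = bn (d + (\<Sum>v<0. a i v * ?x v)) \<and> mat_at n (?C 0) (upd 0 2 0 m)"
      using m by simp
  next
    fix k m' xs' assume "xs' = xs \<and> ?F m' \<and> m' 0 2 = k \<and>
      m' 0 16 = bn (d + (\<Sum>v<k. a i v * ?x v)) \<and> mat_at n (?C k) m'"
    then show "m' 0 2 = k \<and> val m' (V 0) = n" using env(1)[of m'] by (simp add: envD)
  next
    fix k m' xs' assume k: "k < n" and I: "xs' = xs \<and> ?F m' \<and> m' 0 2 = k \<and>
      m' 0 16 = bn (d + (\<Sum>v<k. a i v * ?x v)) \<and> mat_at n (?C k) m'"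
    then have xs: "xs' = xs" and F: "?F m'" and k2: "m' 0 2 = k" and d: "m' 0 16 = bn (d + (\<Sum>v<k. a i v * ?x v))"
      and M: "mat_at n (?C k) m'" by auto
    note e = env(1)[OF F] and p = env(2)[OF F] and i1 = env(3)[OF F]
    have r: "m' 2 i = i * (n + 1)" using envD(3)[OF e] m(6) by auto
    have x: "m' 3 (k + 1) = bn (?x k)" using p k m(3) by (simp add: prefix_at_def)
    let ?b = "a i k * ?x k" and ?d = "d + (\<Sum>v<Suc k. a i v * ?x v)"
    have v1: "val m' (Minus (Plus (Aent (V 1) (V 2)) (Ix 3 (Plus (V 2) (N 1)))) (N 1)) = bn ?b"
      by (simp only: val.simps i1 k2 r x envD(4)[OF e m(6) k] bn_and)
    let ?m1 = "upd 0 17 (bn ?b) m'"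
    have v2: "val ?m1 (Xor (V 16) (V 17)) = bn ?d"
    proof -
      have "val ?m1 (Xor (V 16) (V 17)) = bn ((d + (\<Sum>v<k. a i v * ?x v)) + ?b)" by (simp add: d bn_xor)
      then show ?thesis by (simp only: sum.lessThan_Suc add.assoc)
    qed
    let ?m2 = "upd 0 16 (bn ?d) ?m1"
    let ?R = "\<lambda>m'a xs'a. m'a 0 2 = k \<and> xs'a = xs \<and> ?F (upd 0 2 (Suc k) m'a) \<and> (upd 0 2 (Suc k) m'a) 0 2 = Suc k \<and>
      (upd 0 2 (Suc k) m'a) 0 16 = bn ?d \<and> mat_at n (?C (Suc k)) (upd 0 2 (Suc k) m'a)"
    have M2: "mat_at n (?C k) ?m2" using M by simp
    have step: "WK (If (V 2) (PutB (V 1) (V 2) (V 17)) Skip) ?R ?m2 xs"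
    proof (rule W_If)
      assume "0 < val ?m2 (V 2)"
      then have k0: "k \<noteq> 0" using k2 by simp
      have v: "val ?m2 (Plus (Ix 2 (V 1)) (V 2)) = i * (n + 1) + k" "val ?m2 (V 17) = bn ?b" using i1 k2 r by simp_all
      have "mat_at n (\<lambda>l j. if l = i \<and> j = k then ?b else ?C k l j) (upd 5 (i * (n + 1) + k) (bn ?b) ?m2)"
        by (rule mat_at_put[OF M2]) (use m(6) k in auto)
      then have "mat_at n (?C (Suc k)) (upd 5 (i * (n + 1) + k) (bn ?b) ?m2)"
        by (rule mat_at_cong) (use k0 in \<open>auto simp: less_Suc_eq\<close>)
      moreover have "?F (upd 5 (i * (n + 1) + k) (bn ?b) ?m2)" using F by simp
      moreover have "(upd 5 (i * (n + 1) + k) (bn ?b) ?m2) 0 16 = bn ?d" "(upd 5 (i * (n + 1) + k) (bn ?b) ?m2) 0 2 = k"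
        using k2 by simp_all
      ultimately show "WK (PutB (V 1) (V 2) (V 17)) ?R ?m2 xs"
        using idx_lt[of i k] m(6) k by (intro W_Put) (simp_all only: v bn_le_B, simp_all)
    next
      assume "val ?m2 (V 2) = 0"
      then have k0: "k = 0" using k2 by simp
      have "mat_at n (?C (Suc k)) ?m2" by (rule mat_at_cong[OF M2]) (use k0 in auto)
      moreover have "?F ?m2" using F by simp
      moreover have "?m2 0 16 = bn ?d" "?m2 0 2 = k" using k2 by simp_all
      ultimately have "?R ?m2 xs" by simp
      then show "WK Skip ?R ?m2 xs" by - (rule W_Skip)
    qed
    show "WK drow_com ?R m' xs'" unfolding drow_com_def xs
    proof (rule W_Seq, rule W_Put)
      show "val m' (Minus (Plus (Aent (V 1) (V 2)) (Ix 3 (Plus (V 2) (N 1)))) (N 1)) \<le> B" unfolding v1 by (rule bn_le_B)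
      show "WK (SetV 16 (Xor (V 16) (V 17)) ;; If (V 2) (PutB (V 1) (V 2) (V 17)) Skip) ?R
        (upd 0 (val m' (N 17)) (val m' (Minus (Plus (Aent (V 1) (V 2)) (Ix 3 (Plus (V 2) (N 1)))) (N 1))) m') xs"
        unfolding v1 val.simps(1)
      proof (rule W_Seq, rule W_Put)
        show "val ?m1 (Xor (V 16) (V 17)) \<le> B" unfolding v2 by (rule bn_le_B)
        show "WK (If (V 2) (PutB (V 1) (V 2) (V 17)) Skip) ?R (upd 0 (val ?m1 (N 16)) (val ?m1 (Xor (V 16) (V 17))) ?m1) xs"
          unfolding v2 val.simps(1) by (rule step)
      qed simp
    qed simp
  next
    fix m' xs' assume "xs' = xs \<and> ?F m' \<and> m' 0 2 = n \<and>
      m' 0 16 = bn (d + (\<Sum>v<n. a i v * ?x v)) \<and> mat_at n (?C n) m'"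
    then show "Q m' xs'" using Q by blast
  qed simp_all
qed

text \<open>The matrix after \<open>k\<close> rows have been written. Rows from \<open>k\<close> on
  and the right-hand side are zero, so at \<open>k = n\<close> it has the format required by
  \<open>pdet_lsol\<close>.\<close>

definition lap_rows :: "(nat \<Rightarrow> nat \<Rightarrow> bit) \<Rightarrow> (nat \<Rightarrow> bit) \<Rightarrow> (nat \<Rightarrow> bit) \<Rightarrow> nat \<Rightarrow> nat \<Rightarrow> nat \<Rightarrow> bit" where
  "lap_rows a \<rho> x k l j = (if l < k \<and> j < n then lap n a \<rho> x l j else 0)"

lemma W_detb:
  assumes m: "env n a m" "prefix_at p m" "shift_at \<rho> m" "length p = n"
    and Q: "\<And>m'. frame {1, 2, 16, 17} {5, 6} m m' \<Longrightarrow> mat_at n (lap_rows a \<rho> (point p) n) m' \<Longrightarrow> used_flags n {..<n + n} m' \<Longrightarrow> Q m' xs"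
  shows "WK detb_com Q m xs"
proof -
  let ?x = "point p"
  let ?F = "frame {1, 2, 16, 17} {5, 6} m"
  let ?b = "SetV 16 (Ix 4 (V 1)) ;; For 2 (V 0) drow_com ;; PutB (V 1) (V 1) (Xor (Bent (V 1) (V 1)) (V 16))"
  have env: "env n a m'" "prefix_at p m'" "shift_at \<rho> m'" if "?F m'" for m'
    using frame_env[OF that m(1)] prefix_at_frame[OF that _ _ m(2)] shift_at_frame[OF that _ m(3)] by auto
  have "WK (For 1 (V 0) ?b) Q m1 xs" if F1: "?F m1" and M1: "mat_at n (\<lambda>_ _. 0) m1" and U1: "used_flags n {..<n + n} m1" for m1
  proof (rule W_For[where k = n and I = "\<lambda>i m' xs'. xs' = xs \<and> ?F m' \<and> m' 0 1 = i \<and> mat_at n (lap_rows a \<rho> ?x i) m' \<and> used_flags n {..<n + n} m'"])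
    have "mat_at n (lap_rows a \<rho> ?x 0) m1" by (rule mat_at_cong[OF M1]) (simp add: lap_rows_def)
    then show "xs = xs \<and> ?F (upd 0 1 0 m1) \<and> (upd 0 1 0 m1) 0 1 = 0 \<and> mat_at n (lap_rows a \<rho> ?x 0) (upd 0 1 0 m1) \<and> used_flags n {..<n + n} (upd 0 1 0 m1)"
      using F1 U1 by simp
  next
    fix i m' xs' assume "xs' = xs \<and> ?F m' \<and> m' 0 1 = i \<and> mat_at n (lap_rows a \<rho> ?x i) m' \<and> used_flags n {..<n + n} m'"
    then show "m' 0 1 = i \<and> val m' (V 0) = n" using env(1)[of m'] by (simp add: envD)
  next
    fix i m' xs' assume i: "i < n" and I: "xs' = xs \<and> ?F m' \<and> m' 0 1 = i \<and> mat_at n (lap_rows a \<rho> ?x i) m' \<and> used_flags n {..<n + n} m'"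
    then have F: "?F m'" and i1: "m' 0 1 = i" and M: "mat_at n (lap_rows a \<rho> ?x i) m'" and U: "used_flags n {..<n + n} m'" and xs: "xs' = xs" by auto
    let ?R = "\<lambda>m'a xs'a. m'a 0 1 = i \<and> xs'a = xs \<and> ?F (upd 0 1 (Suc i) m'a) \<and> (upd 0 1 (Suc i) m'a) 0 1 = Suc i \<and>
      mat_at n (lap_rows a \<rho> ?x (Suc i)) (upd 0 1 (Suc i) m'a) \<and> used_flags n {..<n + n} (upd 0 1 (Suc i) m'a)"
    have v0: "val m' (Ix 4 (V 1)) = bn (\<rho> i)" using env(3)[OF F] i i1 by (simp add: shift_at_def)
    \<comment> \<open>Starting scalar 16 at \<rho> i lets the row loop end with the whole entry of
      \<open>d\<close>, which is added to the diagonal afterwards.\<close>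
    let ?m1 = "upd 0 16 (bn (\<rho> i)) m'"
    let ?d = "\<rho> i + (\<Sum>v<n. a i v * ?x v)"
    let ?C = "\<lambda>l j. if l = i \<and> j < n \<and> j \<noteq> 0 then a i j * ?x j else lap_rows a \<rho> ?x i l j"
    have F1: "?F ?m1" using F by simp
    have step: "WK (For 2 (V 0) drow_com) (\<lambda>m'' xs''. WK (PutB (V 1) (V 1) (Xor (Bent (V 1) (V 1)) (V 16))) ?R m'' xs'') ?m1 xs"
    proof (rule W_drow[OF env(1,2)[OF F1] m(4) _ _ i])
      show "mat_at n (lap_rows a \<rho> ?x i) ?m1" "?m1 0 1 = i" "?m1 0 16 = bn (\<rho> i)" using M i1 by simp_all
      fix m2 assume F2: "frame {2, 16, 17} {5} ?m1 m2" and d: "m2 0 16 = bn ?d" and M2: "mat_at n ?C m2"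
      have F3: "?F m2" by (rule frame_trans[OF F1 F2]) auto
      have i2: "m2 0 1 = i" using frame_sc[OF F2, of 1] i1 by simp
      have r: "m2 2 i = i * (n + 1)" using envD(3)[OF env(1)[OF F3]] i by auto
      have Ci: "m2 5 (i * (n + 1) + i) = bn (?C i i)" using mat_atD[OF M2, of i i] i by simp
      let ?e = "?C i i + ?d"
      have v: "val m2 (Plus (Ix 2 (V 1)) (V 1)) = i * (n + 1) + i" by (simp only: val.simps i2 r)
      have v': "val m2 (Xor (Bent (V 1) (V 1)) (V 16)) = bn ?e" by (simp only: val.simps i2 r Ci d bn_xor)
      have "mat_at n (\<lambda>l j. if l = i \<and> j = i then ?e else ?C l j) (upd 5 (i * (n + 1) + i) (bn ?e) m2)"
        by (rule mat_at_put[OF M2]) (use i in auto)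
      then have M3: "mat_at n (lap_rows a \<rho> ?x (Suc i)) (upd 5 (i * (n + 1) + i) (bn ?e) m2)"
      proof (rule mat_at_cong)
        fix l j assume "l < n + n" "j \<le> n"
        show "(if l = i \<and> j = i then ?e else ?C l j) = lap_rows a \<rho> ?x (Suc i) l j"
        proof (cases "l = i")
          case True
          have E: "?e = lap n a \<rho> ?x i i" using i unfolding lap_def lap_rows_def by (simp only: if_True if_False less_irrefl simp_thms add.commute[of "\<rho> i"] split: if_split)
          show ?thesis
          proof (cases "j = i")
            case True
            then show ?thesis using \<open>l = i\<close> i E by (simp only: simp_thms if_True lap_rows_def lessI)
          next
            case False
            then show ?thesis using \<open>l = i\<close> by (simp add: lap_rows_def lap_def)
          qed
        next
          case False
          then show ?thesis by (auto simp: lap_rows_def less_Suc_eq)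
        qed
      qed
      have u: "used_flags n {..<n + n} m2" using frame_ar[OF F2, of 6] U by (simp add: used_flags_def)
      show "WK (PutB (V 1) (V 1) (Xor (Bent (V 1) (V 1)) (V 16))) ?R m2 xs"
      proof (rule W_Put, unfold v v')
        show "bn ?e \<le> B" by (rule bn_le_B)
        show "i * (n + 1) + i < S" by (rule idx_lt) (use i in auto)
        show "?R (upd 5 (i * (n + 1) + i) (bn ?e) m2) xs"
        proof (intro conjI)
          show "mat_at n (lap_rows a \<rho> ?x (Suc i)) (upd 0 1 (Suc i) (upd 5 (i * (n + 1) + i) (bn ?e) m2))"
            using M3 by (simp only: mat_at_upd_other zero_neq_numeral not_False_eq_True)
        qed (use F3 i2 u in simp_all)
      qed
    qed
    show "WK ?b ?R m' xs'" unfolding xs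
      by (rule W_Seq, rule W_Put, unfold v0 val.simps(1), simp, simp, rule W_Seq, rule step)
  next
    fix m' xs' assume "xs' = xs \<and> ?F m' \<and> m' 0 1 = n \<and> mat_at n (lap_rows a \<rho> ?x n) m' \<and> used_flags n {..<n + n} m'"
    then show "Q m' xs'" using Q by blast
  qed simp_all
  moreover have "?F m'" if "frame {1, 2} {5, 6} m m'" for m'
    by (rule frame_trans[OF that, of "{}" "{}"]) auto
  ultimately show ?thesis unfolding detb_com_def by (intro W_Seq W_clear[OF m(1)]) blast
qed

text \<open>A homogeneous system is solvable, so elimination finds \<open>2 ^ (n - r)\<close> kernel
  vectors, and the kernel is trivial iff the rank \<open>r\<close> is \<open>n\<close>.\<close>

lemma W_det:
  assumes m: "env n a m" "prefix_at p m" "shift_at \<rho> m" "length p = n"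
    and Q: "\<And>m' r. frame {1, 2, 4, 5, 6, 7, 8, 16, 17} {5, 6} m m' \<Longrightarrow> m' 0 7 = r \<Longrightarrow> r \<le> n \<Longrightarrow>
      pdet n (lap n a \<rho> (point p)) = 1 \<longleftrightarrow> r = n \<Longrightarrow> Q m' xs"
  shows "WK (detb_com ;; elim_com) Q m xs"
proof (rule W_Seq, rule W_detb[OF m])
  fix m1 assume F1: "frame {1, 2, 16, 17} {5, 6} m m1" and M1: "mat_at n (lap_rows a \<rho> (point p) n) m1" and U1: "used_flags n {..<n + n} m1"
  have e1: "env n a m1" by (rule frame_env[OF F1 m(1)]) auto
  show "WK elim_com Q m1 xs"
  proof (rule W_elim[OF e1 M1 U1])
    let ?X = "card (lsol n 0 {..<n + n} (lap_rows a \<rho> (point p) n))"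
    fix m2 r assume F2: "frame {1, 2, 4, 5, 6, 7, 8} {5, 6} m1 m2" and r: "m2 0 7 = r" "r \<le> n"
      and c: "(m2 0 8 = 1 \<and> ?X = 2 ^ (n - r)) \<or> (m2 0 8 = 0 \<and> ?X = 0)"
    have "(\<lambda>_. 0) \<in> lsol n 0 {..<n + n} (lap_rows a \<rho> (point p) n)"
      by (simp add: lsol_def cube_def lap_rows_def)
    then have "?X \<noteq> 0" by (metis card_0_eq empty_iff finite_lsol)
    with c have "?X = 2 ^ (n - r)" by (elim disjE conjE) (assumption, erule notE, assumption)
    moreover have "pdet n (lap n a \<rho> (point p)) = 1 \<longleftrightarrow> ?X = 1"
      by (rule pdet_lsol) (auto simp: lap_rows_def)
    ultimately have "pdet n (lap n a \<rho> (point p)) = 1 \<longleftrightarrow> (2::nat) ^ (n - r) = 1" by (simp only:)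
    also have "\<dots> \<longleftrightarrow> r = n" using r(2) by auto
    finally have "pdet n (lap n a \<rho> (point p)) = 1 \<longleftrightarrow> r = n" .
    moreover have "frame {1, 2, 4, 5, 6, 7, 8, 16, 17} {5, 6} m m2" by (rule frame_trans[OF F1 F2]) auto
    ultimately show "Q m2 xs" by (intro Q[of m2 r] r)
  qed
qed

lemma W_node:
  assumes m: "env n a m" "prefix_at p m" "shift_at \<rho> m" "length p \<le> n"
    and Q: "\<And>m' r. frame {1, 2, 4, 5, 6, 7, 8} {5, 6} m m' \<Longrightarrow> m' 0 7 = r \<Longrightarrow> r \<le> n \<Longrightarrow>
      (m' 0 8 = 1 \<and> card (sol n a \<rho> p) = 2 ^ (n - r)) \<or> (m' 0 8 = 0 \<and> \<not> node n a \<rho> p) \<Longrightarrow> Q m' xs"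
  shows "WK (build_com ;; elim_com) Q m xs"
proof (rule W_Seq, rule W_build[OF m])
  fix m1 assume F1: "frame {1, 2} {5, 6} m m1" and M1: "mat_at n (prefix_system a \<rho> p (length p)) m1" and U1: "used_flags n {..<n + n} m1"
  have e1: "env n a m1" by (rule frame_env[OF F1 m(1)]) auto
  show "WK elim_com Q m1 xs"
  proof (rule W_elim[OF e1 M1 U1], unfold lsol_prefix_system_eq_sol[OF m(4)])
    fix m2 r assume F2: "frame {1, 2, 4, 5, 6, 7, 8} {5, 6} m1 m2" and r: "m2 0 7 = r" "r \<le> n"
      and c: "(m2 0 8 = 1 \<and> card (sol n a \<rho> p) = 2 ^ (n - r)) \<or> (m2 0 8 = 0 \<and> card (sol n a \<rho> p) = 0)"
    have "frame {1, 2, 4, 5, 6, 7, 8} {5, 6} m m2" by (rule frame_trans[OF F1 F2]) auto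
    moreover have z: "card (sol n a \<rho> p) = 0 \<Longrightarrow> \<not> node n a \<rho> p" by (metis card_0_eq finite_sol)
    have "(m2 0 8 = 1 \<and> card (sol n a \<rho> p) = 2 ^ (n - r)) \<or> (m2 0 8 = 0 \<and> \<not> node n a \<rho> p)"
      using c by (elim disjE conjE) (intro disjI1 conjI, assumption+, intro disjI2 conjI z, assumption+)
    ultimately show "Q m2 xs" by (intro Q[of m2 r] r)
  qed
qed

end

section \<open>The depth-first search\<close>

lemma point_Cons: "i < length p \<Longrightarrow> point (b # p) i = point p i" "point (b # p) (length p) = b"
  by (simp_all add: point_def nth_append)

text \<open>The contribution of the subtrees still to be visited when the search stands at the node \<open>p\<close>.\<close>

fun rest :: "(bit list \<Rightarrow> nat) \<Rightarrow> bit list \<Rightarrow> nat" where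
  "rest G [] = 0"
| "rest G (b # p) = (if b = 0 then G (1 # p) else 0) + rest G p"

text \<open>A node with bit 1 is a second child, so no sibling of it remains to be visited.\<close>

lemma rest_ones: "rest G (replicate k 1 @ p) = rest G p"
  by (induction k) auto

context bounds
begin

lemma prefix_at_Cons: "prefix_at (b # p) m \<longleftrightarrow> m 0 9 = length p + 1 \<and> m 3 0 = 0 \<and> (\<forall>i<length p. m 3 (i + 1) = bn (point p i)) \<and>
    m 3 (length p + 1) = bn b"
  unfolding prefix_at_def by (auto simp: less_Suc_eq point_Cons)

text \<open>The next node is the sibling at the deepest 0 of the prefix, and its subtree is the
  leading term of \<open>rest\<close>. The case \<open>more\<close> exposes the shape of
  \<open>p\<close>, so that \<open>rest\<close> can be evaluated for the sum and for the node count
  alike.\<close>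

lemma W_adv:
  assumes m: "prefix_at p m" "length p \<le> n"
    and fin: "\<And>m'. frame {9, 10} {3} m m' \<Longrightarrow> rest G p = rest G [] \<Longrightarrow> (\<exists>k. p = replicate k 1) \<Longrightarrow> prefix_at [] m' \<Longrightarrow> m' 0 10 = 0 \<Longrightarrow> Q m' xs"
    and more: "\<And>m' k q. frame {9, 10} {3} m m' \<Longrightarrow> p = replicate k 1 @ 0 # q \<Longrightarrow> prefix_at (1 # q) m' \<Longrightarrow> m' 0 10 = m 0 10 \<Longrightarrow> Q m' xs"
  shows "WK adv_com Q m xs"
proof -
  let ?I = "\<lambda>m' xs'. xs' = xs \<and> frame {9} {} m m' \<and> (\<exists>k q. p = replicate k 1 @ q \<and> prefix_at q m')"
  have top: "m' 3 (m' 0 9) = (case q of [] \<Rightarrow> 0 | b # _ \<Rightarrow> bn b)" if "prefix_at q m'" for q m'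
    using that by (cases q) (simp_all add: prefix_at_Cons prefix_at_def[of "[]"])
  have "W B S (1 + m 0 9 * (1 + cost L (SetV 9 (Minus (V 9) (N 1))))) (While (Ix 3 (V 9)) (SetV 9 (Minus (V 9) (N 1))))
     (\<lambda>m' xs'. WK (If (V 9) (Put 3 (V 9) (N 1)) (SetV 10 (N 0))) Q m' xs') m xs"
  proof (rule W_While[where I = ?I and f = "\<lambda>m. m 0 9"])
    show "?I m xs" using m by (auto intro!: exI[of _ 0])
  next
    fix m' xs' assume I: "?I m' xs'" and pos: "0 < val m' (Ix 3 (V 9))"
    then obtain k q where q: "p = replicate k 1 @ q" "prefix_at q m'" and F: "frame {9} {} m m'" and xs: "xs' = xs" by blast
    then obtain q' where q': "q = 1 # q'" using pos top[OF q(2)] by (cases q) (auto simp: bn_pos)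
    have len: "m' 0 9 = length q' + 1" using q(2) unfolding q' prefix_at_Cons by blast
    have "p = replicate (Suc k) 1 @ q'" using q(1) unfolding q' by (simp add: replicate_app_Cons_same)
    moreover have "prefix_at q' (upd 0 9 (m' 0 9 - 1) m')" using q(2) unfolding q' prefix_at_Cons by (simp add: prefix_at_def)
    ultimately have ex: "\<exists>k q. p = replicate k 1 @ q \<and> prefix_at q (upd 0 9 (m' 0 9 - 1) m')" by blast
    have "m' 0 9 - 1 \<le> B" using q(1) m(2) q' len S SB by simp
    then show "0 < m' 0 9 \<and> W B S (cost L (SetV 9 (Minus (V 9) (N 1)))) (SetV 9 (Minus (V 9) (N 1)))
        (\<lambda>m'a xs'. ?I m'a xs' \<and> m'a 0 9 < m' 0 9) m' xs'"
      using F xs len ex by (intro conjI W_Put) simp_all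
  next
    fix m' xs' assume I: "?I m' xs'" and z: "val m' (Ix 3 (V 9)) = 0"
    then obtain k q where q: "p = replicate k 1 @ q" "prefix_at q m'" and F: "frame {9} {} m m'" and xs: "xs' = xs" by blast
    have F': "frame {9, 10} {3} m m'" by (rule frame_trans[OF F, of "{}" "{}"]) auto
    show "WK (If (V 9) (Put 3 (V 9) (N 1)) (SetV 10 (N 0))) Q m' xs'"
    proof (cases q)
      case Nil
      then have "m' 0 9 = 0" using q(2) by (simp add: prefix_at_def)
      moreover have "Q (upd 0 10 0 m') xs"
        by (rule fin) (use F' q Nil rest_ones[of G k "[]"] in \<open>auto simp: prefix_at_def\<close>)
      ultimately show ?thesis unfolding xs by (intro W_If W_Put) simp_all
    next
      case (Cons b q')
      have b: "b = 0" using z top[OF q(2)] Cons by (simp add: bn_eq_0)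
      have len: "m' 0 9 = length q' + 1" using q(2) unfolding Cons prefix_at_Cons by blast
      have "prefix_at (1 # q') (upd 3 (length q' + 1) 1 m')" using q(2) unfolding Cons prefix_at_Cons by simp
      then have "Q (upd 3 (length q' + 1) 1 m') xs"
        using F' q(1) b Cons frame_sc[OF F, of 10] by (intro more[of _ k q']) simp_all
      moreover have "length q' + 1 < S" using q(1) m(2) Cons S by simp
      moreover have "1 \<le> B" using small(4)[of 1] by simp
      ultimately show ?thesis using len unfolding xs by (intro W_If W_Put) simp_all
    qed
  qed
  then have "W B S (cost L (While (Ix 3 (V 9)) (SetV 9 (Minus (V 9) (N 1))))) (While (Ix 3 (V 9)) (SetV 9 (Minus (V 9) (N 1))))
     (\<lambda>m' xs'. WK (If (V 9) (Put 3 (V 9) (N 1)) (SetV 10 (N 0))) Q m' xs') m xs"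
  proof (rule W_conseq)
    have "m 0 9 \<le> L" using m L by (simp add: prefix_at_def)
    then show "1 + m 0 9 * (1 + cost L (SetV 9 (Minus (V 9) (N 1)))) \<le> cost L (While (Ix 3 (V 9)) (SetV 9 (Minus (V 9) (N 1))))"
      by simp
  qed
  then show ?thesis unfolding adv_com_def by - (rule W_Seq)
qed

definition leaf_val :: "(nat \<Rightarrow> nat \<Rightarrow> bit) \<Rightarrow> (nat \<Rightarrow> bit) \<Rightarrow> nat \<Rightarrow> bit list \<Rightarrow> nat" where
  "leaf_val a \<rho> fl p = (if fl = 0 then wleaf n a \<rho> p else dleaf n a \<rho> p)"

lemma W_leaf:
  assumes m: "env n a m" "prefix_at p m" "shift_at \<rho> m" "length p \<le> n" "m 0 14 = fl" "0 < fl \<Longrightarrow> length p = n"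
      "m 0 7 = r" "card (sol n a \<rho> p) = 2 ^ (n - r)" "m 0 11 + leaf_val a \<rho> fl p \<le> B"
    and Q: "\<And>m'. frame {1, 2, 4, 5, 6, 7, 8, 11, 16, 17} {5, 6} m m' \<Longrightarrow> m' 0 11 = m 0 11 + leaf_val a \<rho> fl p \<Longrightarrow> Q m' xs"
  shows "WK leaf_com Q m xs"
  unfolding leaf_com_def
proof (rule W_If)
  assume "0 < val m (V 14)"
  then have fl: "0 < fl" using m(5) by simp
  show "WK ((detb_com ;; elim_com) ;; SetV 11 (Plus (V 11) (Minus (N 1) (Minus (V 0) (V 7))))) Q m xs"
  proof (rule W_Seq, rule W_det[OF m(1-3) m(6)[OF fl]])
    fix m1 r1 assume F: "frame {1, 2, 4, 5, 6, 7, 8, 16, 17} {5, 6} m m1" and r: "m1 0 7 = r1" "r1 \<le> n"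
      and d: "pdet n (lap n a \<rho> (point p)) = 1 \<longleftrightarrow> r1 = n"
    have s: "m1 0 11 = m 0 11" "m1 0 0 = n" using frame_sc[OF F] envD(1)[OF m(1)] by auto
    have "1 - (n - r1) = dleaf n a \<rho> p" using d r(2) by (auto simp: dleaf_def)
    then have v: "val m1 (Plus (V 11) (Minus (N 1) (Minus (V 0) (V 7)))) = m 0 11 + leaf_val a \<rho> fl p"
      using s r fl by (simp add: leaf_val_def)
    have "frame {1, 2, 4, 5, 6, 7, 8, 11, 16, 17} {5, 6} m m1" by (rule frame_trans[OF F, of "{}" "{}"]) auto
    then have "Q (upd 0 11 (m 0 11 + leaf_val a \<rho> fl p) m1) xs" by (intro Q) simp_all
    then show "WK (SetV 11 (Plus (V 11) (Minus (N 1) (Minus (V 0) (V 7))))) Q m1 xs"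
      using m(9) by (intro W_Put) (simp_all only: v val.simps(1), simp)
  qed
next
  assume "val m (V 14) = 0"
  then have fl: "fl = 0" using m(5) by simp
  have "m 7 (n - r) = fib (n - r + 2)" by (rule envD(5)[OF m(1)]) simp
  then have "val m (Plus (V 11) (Ix 7 (Minus (V 0) (V 7)))) = m 0 11 + leaf_val a \<rho> fl p"
    using envD(1)[OF m(1)] m(7) fl by (simp add: leaf_val_def m(8) del: fib.simps)
  moreover have "Q (upd 0 11 (m 0 11 + leaf_val a \<rho> fl p) m) xs" by (rule Q) simp_all
  ultimately show "WK (SetV 11 (Plus (V 11) (Ix 7 (Minus (V 0) (V 7))))) Q m xs"
    using m(9) by (intro W_Put) (simp_all only: val.simps(1), simp)
qed

abbreviation trav_scalars :: "nat set" where "trav_scalars \<equiv> {1, 2, 4, 5, 6, 7, 8, 9, 10, 11, 16, 17}"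
abbreviation trav_arrays :: "nat set" where "trav_arrays \<equiv> {3, 5, 6}"

text \<open>Reads the prefix back from memory. The bound on the number of rounds in
  \<open>W_While\<close> must be a function of the memory alone, but the count of remaining nodes is
  a function of the prefix.\<close>

definition prefix :: "(nat \<Rightarrow> nat \<Rightarrow> nat) \<Rightarrow> bit list" where
  "prefix m = rev (map (\<lambda>i. if m 3 (i + 1) = 1 then 1 else 0) [0..<m 0 9])"

lemma prefix_prefix_at: "prefix_at p m \<Longrightarrow> prefix m = p"
proof -
  assume p: "prefix_at p m"
  have "map (\<lambda>i. if m 3 (i + 1) = 1 then 1 else 0) [0..<m 0 9] = rev p"
  proof (rule nth_equalityI)
    show "length (map (\<lambda>i. if m 3 (i + 1) = 1 then 1 else 0) [0..<m 0 9]) = length (rev p)"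
      using p by (simp add: prefix_at_def)
    fix i assume "i < length (map (\<lambda>i. if m 3 (i + 1) = 1 then 1 else (0 :: bit)) [0..<m 0 9])"
    then have i: "i < length p" using p by (simp add: prefix_at_def)
    have "(if bn b = 1 then 1 else 0) = b" for b by (cases b) simp_all
    then show "map (\<lambda>i. if m 3 (i + 1) = 1 then 1 else 0) [0..<m 0 9] ! i = rev p ! i"
      using p i by (simp add: prefix_at_def point_def)
  qed
  then have "rev (map (\<lambda>i. if m 3 (i + 1) = 1 then 1 else (0 :: bit)) [0..<m 0 9]) = p" by (metis rev_rev_ident)
  then show ?thesis unfolding prefix_def .
qed

text \<open>One round visits one node. The accumulated sum, the subtree of the current node and the
  subtrees still open add up to the total throughout, and the same decomposition of the node count
  is the variant.\<close>

lemma W_loop: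
  assumes m: "env n a m" "shift_at \<rho> m" "m 0 14 = fl" "m 0 13 = dep" "dep \<le> n" "0 < fl \<Longrightarrow> dep = n"
      "prefix_at [] m" "m 0 10 = 1" "m 0 11 = 0"
    and bnd: "tsum (node n a \<rho>) (leaf_val a \<rho> fl) dep [] \<le> B"
    and Q: "\<And>m'. frame trav_scalars trav_arrays m m' \<Longrightarrow> m' 0 11 = tsum (node n a \<rho>) (leaf_val a \<rho> fl) dep [] \<Longrightarrow> Q m' xs"
  shows "W B S (1 + tcount (node n a \<rho>) dep [] * (1 + cost L body_com)) (While (V 10) body_com) Q m xs"
proof -
  define Ts where "Ts p = tsum (node n a \<rho>) (leaf_val a \<rho> fl) (dep - length p) p" for p
  define Tc where "Tc p = tcount (node n a \<rho>) (dep - length p) p" for p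
  let ?N = "node n a \<rho>"
  let ?Tot = "Ts []"
  let ?F = "frame trav_scalars trav_arrays m"
  let ?I = "\<lambda>m' xs'. xs' = xs \<and> ?F m' \<and> (\<exists>p. prefix_at p m' \<and> length p \<le> dep \<and>
     ((m' 0 10 = 1 \<and> m' 0 11 + Ts p + rest Ts p = ?Tot) \<or> (m' 0 10 = 0 \<and> m' 0 11 = ?Tot)))"
  let ?f = "\<lambda>m'. if m' 0 10 = 0 then 0 else Tc (prefix m') + rest Tc (prefix m')"
  have Tc_pos: "0 < Tc p" for p unfolding Tc_def by (cases "dep - length p") auto
  have f0: "?f m = tcount ?N dep []" using m(8) prefix_prefix_at[OF m(7)] by (simp add: Tc_def)
  have f: "?f m' = Tc p + rest Tc p" if "prefix_at p m'" "m' 0 10 = 1" for m' p using prefix_prefix_at[OF that(1)] that(2) by simp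
  have "W B S (1 + ?f m * (1 + cost L body_com)) (While (V 10) body_com) Q m xs"
  proof (rule W_While[where I = ?I])
    show "?I m xs" using m by (auto intro!: exI[of _ "[]"])
  next
    fix m' xs' assume I: "?I m' xs'" and "0 < val m' (V 10)"
    then obtain p where xs: "xs' = xs" and F: "?F m'" and p: "prefix_at p m'" "length p \<le> dep"
      and g: "m' 0 10 = 1" and acc: "m' 0 11 + Ts p + rest Ts p = ?Tot" by auto
    have e: "env n a m'" by (rule frame_env[OF F m(1)]) auto
    have rh: "shift_at \<rho> m'" by (rule shift_at_frame[OF F _ m(2)]) simp
    have pn: "length p \<le> n" using p(2) m(5) by simp
    have f': "?f m' = Tc p + rest Tc p" by (rule f[OF p(1) g])
    let ?R = "\<lambda>m'' xs''. ?I m'' xs'' \<and> ?f m'' < ?f m'"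
    have adv: "WK adv_com ?R m2 xs"
      if F2: "?F m2" and p2: "prefix_at p m2" and g2: "m2 0 10 = 1" and acc2: "m2 0 11 + rest Ts p = ?Tot" and Tc1: "Tc p = 1" for m2
    proof (rule W_adv[OF p2 pn, where G = Ts])
      fix m3 assume F3: "frame {9, 10} {3} m2 m3" and r: "rest Ts p = rest Ts []" and k: "\<exists>k. p = replicate k 1"
        and p3: "prefix_at [] m3" and z: "m3 0 10 = 0"
      have "?F m3" by (rule frame_trans[OF F2 F3]) auto
      moreover have "m3 0 11 = ?Tot" using frame_sc[OF F3, of 11] acc2 r by simp
      moreover have "?f m3 < ?f m'" unfolding f' using z Tc1 by simp
      ultimately show "?R m3 xs" using p3 z by auto
    next
      fix m3 k q assume F3: "frame {9, 10} {3} m2 m3" and pk: "p = replicate k 1 @ 0 # q"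
        and p3: "prefix_at (1 # q) m3" and z: "m3 0 10 = m2 0 10"
      have R: "rest G p = G (1 # q) + rest G (1 # q)" for G unfolding pk rest_ones by simp
      have "?F m3" by (rule frame_trans[OF F2 F3]) auto
      moreover have "m3 0 11 + Ts (1 # q) + rest Ts (1 # q) = ?Tot" using frame_sc[OF F3, of 11] acc2 R[of Ts] by simp
      moreover have g3: "m3 0 10 = 1" using z g2 by simp
      moreover have "?f m3 < ?f m'" unfolding f' f[OF p3 g3] Tc1 R[of Tc] by simp
      moreover have "length (1 # q) \<le> dep" using p(2) unfolding pk by simp
      ultimately show "?R m3 xs" using p3 by blast
    qed
    have "WK body_com ?R m' xs" unfolding body_com_def
    proof (rule W_Seq, rule W_node[OF e p(1) rh pn])
      fix m1 r assume F1: "frame {1, 2, 4, 5, 6, 7, 8} {5, 6} m' m1" and r: "m1 0 7 = r" "r \<le> n"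
        and c: "(m1 0 8 = 1 \<and> card (sol n a \<rho> p) = 2 ^ (n - r)) \<or> (m1 0 8 = 0 \<and> \<not> ?N p)"
      have FF: "?F m1" by (rule frame_trans[OF F F1]) auto
      have e1: "env n a m1" by (rule frame_env[OF FF m(1)]) auto
      have rh1: "shift_at \<rho> m1" by (rule shift_at_frame[OF FF _ m(2)]) simp
      have p1: "prefix_at p m1" by (rule prefix_at_frame[OF F1 _ _ p(1)]) auto
      have s1: "m1 0 10 = 1" "m1 0 11 = m' 0 11" using frame_sc[OF F1] g by auto
      have s2: "m1 0 14 = fl" "m1 0 13 = dep" using frame_sc[OF FF] m(3,4) by auto
      have s3: "m1 0 9 = length p" using p1 by (simp add: prefix_at_def)
      show "WK (If (V 8) (If (Minus (V 13) (V 9)) (SetV 9 (Plus (V 9) (N 1)) ;; Put 3 (V 9) (N 0)) (leaf_com ;; adv_com)) adv_com) ?R m1 xs"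
      proof (rule W_If)
        assume "0 < val m1 (V 8)"
        then have c: "card (sol n a \<rho> p) = 2 ^ (n - r)" using c by auto
        then have N: "?N p" by (metis card.empty power_not_zero zero_neq_numeral)
        show "WK (If (Minus (V 13) (V 9)) (SetV 9 (Plus (V 9) (N 1)) ;; Put 3 (V 9) (N 0)) (leaf_com ;; adv_com)) ?R m1 xs"
        proof (rule W_If)
          assume "0 < val m1 (Minus (V 13) (V 9))"
          then have lt: "length p < dep" using s2 s3 by simp
          then have d: "dep - length p = Suc (dep - length (0 # p))" by simp
          \<comment> \<open>Descending to \<open>0 # p\<close> uses up the node \<open>p\<close> and
            moves the subtree of its other child into \<open>rest\<close>.\<close>
          have T: "Ts p = Ts (0 # p) + Ts (1 # p)" "Tc p = 1 + Tc (0 # p) + Tc (1 # p)"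
            unfolding Ts_def Tc_def d using N by (simp_all del: sol.simps)
          let ?m2 = "upd 3 (length p + 1) 0 (upd 0 9 (length p + 1) m1)"
          have p2: "prefix_at (0 # p) ?m2" using p1 unfolding prefix_at_Cons by (simp add: prefix_at_def)
          have g2: "?m2 0 10 = 1" using s1 by simp
          have "?m2 0 11 + Ts (0 # p) + rest Ts (0 # p) = ?Tot" using acc T(1) s1 by simp
          moreover have "?f ?m2 < ?f m'" unfolding f' f[OF p2 g2] T(2) by simp
          moreover have "?F ?m2" using FF by simp
          moreover have "length (0 # p) \<le> dep" using lt by simp
          ultimately have "?R ?m2 xs" using p2 g2 by blast
          moreover have "length p + 1 \<le> B" "length p + 1 < S" using pn S SB by auto
          moreover have v: "val m1 (Plus (V 9) (N 1)) = length p + 1"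
            "val (upd 0 9 (length p + 1) m1) (V 9) = length p + 1" using s3 by simp_all
          ultimately show "WK (SetV 9 (Plus (V 9) (N 1)) ;; Put 3 (V 9) (N 0)) ?R m1 xs"
            by (intro W_Seq W_Put) (simp_all only: v val.simps(1), simp_all only: small(1) le0 less_numeral_extra numeral_less_iff semiring_norm)
        next
          assume "val m1 (Minus (V 13) (V 9)) = 0"
          then have eq: "length p = dep" using s2 s3 p(2) by simp
          then have T: "Ts p = leaf_val a \<rho> fl p" "Tc p = 1" unfolding Ts_def Tc_def using N by simp_all
          have B11: "m1 0 11 + leaf_val a \<rho> fl p \<le> B" using acc T(1) s1 bnd by (simp add: Ts_def)
          show "WK (leaf_com ;; adv_com) ?R m1 xs"
          proof (rule W_Seq, rule W_leaf[OF e1 p1 rh1 pn s2(1) _ r(1) c B11])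
            show "length p = n" if "0 < fl" using m(6)[OF that] eq by simp
            fix m2 assume F2: "frame {1, 2, 4, 5, 6, 7, 8, 11, 16, 17} {5, 6} m1 m2"
              and a2: "m2 0 11 = m1 0 11 + leaf_val a \<rho> fl p"
            show "WK adv_com ?R m2 xs"
            proof (rule adv[OF _ _ _ _ T(2)])
              show "?F m2" by (rule frame_trans[OF FF F2]) auto
              show "prefix_at p m2" by (rule prefix_at_frame[OF F2 _ _ p1]) auto
              show "m2 0 10 = 1" using frame_sc[OF F2, of 10] s1 by simp
              show "m2 0 11 + rest Ts p = ?Tot" using a2 acc T(1) s1 by simp
            qed
          qed
        qed
      next
        assume "val m1 (V 8) = 0"
        then have N: "\<not> ?N p" using c by auto
        have T: "Ts p = 0" "Tc p = 1" unfolding Ts_def Tc_def using N by (cases "dep - length p"; simp)+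
        show "WK adv_com ?R m1 xs" by (rule adv[OF FF p1 s1(1) _ T(2)]) (use acc T(1) s1 in simp)
      qed
    qed
    then show "0 < ?f m' \<and> WK body_com ?R m' xs'" using Tc_pos[of p] f' xs by simp
  next
    fix m' xs' assume I: "?I m' xs'" and "val m' (V 10) = 0"
    then show "Q m' xs'" using Q[of m'] by (auto simp: Ts_def)
  qed
  then show ?thesis unfolding f0 .
qed

text \<open>The 5 is made up of four assignments and the last test of the loop.\<close>

lemma W_trav:
  assumes m: "env n a m" "shift_at \<rho> m" "m 0 14 = fl" "m 0 13 = dep" "dep \<le> n" "0 < fl \<Longrightarrow> dep = n"
    and bnd: "tsum (node n a \<rho>) (leaf_val a \<rho> fl) dep [] \<le> B"
    and Q: "\<And>m'. frame trav_scalars trav_arrays m m' \<Longrightarrow> m' 0 11 = tsum (node n a \<rho>) (leaf_val a \<rho> fl) dep [] \<Longrightarrow> Q m' xs"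
    and K: "tcount (node n a \<rho>) dep [] \<le> K"
  shows "W B S (5 + K * (1 + cost L body_com)) trav_com Q m xs"
proof -
  let ?m = "upd 0 10 1 (upd 3 0 0 (upd 0 9 0 (upd 0 11 0 m)))"
  have F: "frame trav_scalars trav_arrays m ?m" by simp
  have "W B S (1 + tcount (node n a \<rho>) dep [] * (1 + cost L body_com)) (While (V 10) body_com) Q ?m xs"
  proof (rule W_loop[OF _ _ _ _ m(5,6) _ _ _ bnd])
    show "env n a ?m" "?m 0 14 = fl" "?m 0 13 = dep" "prefix_at [] ?m" "?m 0 10 = 1" "?m 0 11 = 0"
      using m by (simp_all add: prefix_at_def)
    show "shift_at \<rho> ?m" using m(2) by (simp add: shift_at_def)
    fix m' assume "frame trav_scalars trav_arrays ?m m'" "m' 0 11 = tsum (node n a \<rho>) (leaf_val a \<rho> fl) dep []"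
    then show "Q m' xs" using frame_trans[OF F, of trav_scalars trav_arrays m' trav_scalars trav_arrays] Q by blast
  qed
  moreover have "1 \<le> B" using small(4)[of 1] by simp
  ultimately have "W B S (1 + (1 + (1 + (1 + (1 + tcount (node n a \<rho>) dep [] * (1 + cost L body_com)))))) trav_com Q m xs"
    unfolding trav_com_def by (intro W_Seq_gen W_Put[where L = 0, unfolded cost.simps]) simp_all
  then show ?thesis
  proof (rule W_conseq)
    have "tcount (node n a \<rho>) dep [] * (1 + cost L body_com) \<le> K * (1 + cost L body_com)" using K by (rule mult_le_mono1)
    then show "1 + (1 + (1 + (1 + (1 + tcount (node n a \<rho>) dep [] * (1 + cost L body_com))))) \<le> 5 + K * (1 + cost L body_com)"
      by simp
  qed
qed

end

text \<open>For branches whose time bound is not of the form \<open>cost L\<close>, such as those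
  containing a traversal.\<close>

lemma W_If_gen:
  assumes "0 < val m e \<Longrightarrow> W B S K c Q m xs" "val m e = 0 \<Longrightarrow> W B S K d Q m xs"
  shows "W B S (1 + K) (If e c d) Q m xs"
  unfolding W_def
proof (intro allI impI)
  fix s :: st assume s: "mm s = m \<and> ins s = xs"
  then have t: "mm (tick s) = m \<and> ins (tick s) = xs" by simp
  show "\<exists>s'. ev B S (If e c d) s s' \<and> Q (mm s') (ins s') \<and> outs s' = outs s \<and> tm s' \<le> tm s + (1 + K)"
  proof (cases "0 < val m e")
    case True
    then obtain s' where "ev B S c (tick s) s'" "Q (mm s') (ins s')" "outs s' = outs s" "tm s' \<le> Suc (tm s) + K"
      using assms(1)[unfolded W_def, rule_format, OF _ t] by auto
    then show ?thesis using True s ev.IfT[of s e B S c s' d] by (intro exI[of _ s']) simp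
  next
    case False
    then obtain s' where "ev B S d (tick s) s'" "Q (mm s') (ins s')" "outs s' = outs s" "tm s' \<le> Suc (tm s) + K"
      using assms(2)[unfolded W_def, rule_format, OF _ t] by auto
    then show ?thesis using False s ev.IfF[of s e B S d s' c] by (intro exI[of _ s']) simp
  qed
qed

section \<open>Reading the input and filling the tables\<close>

lemma length_concat_rows: "length (concat (map (\<lambda>u. map (f u) [0..<n]) [0..<k])) = k * n"
  by (induction k) simp_all

lemma nth_concat_rows:
  "i < k \<Longrightarrow> j < n \<Longrightarrow> concat (map (\<lambda>u. map (f u) [0..<n]) [0..<k]) ! (i * n + j) = f i j"
proof (induction k)
  case (Suc k)
  show ?case
  proof (cases "i < k")
    case True
    then have "Suc i * n \<le> k * n" by (intro mult_le_mono1) simp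
    then have "i * n + j < k * n" using Suc.prems by simp
    then show ?thesis using Suc True by (simp add: nth_append length_concat_rows)
  next
    case False
    then have "i = k" using Suc.prems by simp
    then show ?thesis using Suc.prems by (simp add: nth_append length_concat_rows)
  qed
qed simp

lemma hd0_drop: "k < length xs \<Longrightarrow> hd0 (drop k xs) = xs ! k"
  by (simp add: hd0_def Cons_nth_drop_Suc[symmetric])

context bounds
begin

lemma W_head:
  assumes Q: "\<And>m'. m' 0 0 = n \<Longrightarrow> m' 0 15 = n + n \<Longrightarrow> \<forall>i\<le>n + n. m' 2 i = i * (n + 1) \<Longrightarrow> m' 4 = (\<lambda>_. 0) \<Longrightarrow> m' 0 14 = 0 \<Longrightarrow> Q m' xs"
  shows "WK head_com Q (\<lambda>_ _. 0) (n # xs)"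
proof -
  let ?m = "upd 2 0 0 (upd 0 15 (n + n) (upd 0 0 n (\<lambda>_ _. 0)))"
  have "WK (For 1 (V 15) (Put 2 (Plus (V 1) (N 1)) (Plus (Ix 2 (V 1)) (Plus (V 0) (N 1))))) Q ?m xs"
  proof (rule W_For[where k = "n + n" and I = "\<lambda>i m' xs'. xs' = xs \<and> m' 0 1 = i \<and> m' 0 0 = n \<and> m' 0 15 = n + n \<and>
      (\<forall>l\<le>i. m' 2 l = l * (n + 1)) \<and> m' 4 = (\<lambda>_. 0) \<and> m' 0 14 = 0"])
    fix i and m' :: "nat \<Rightarrow> nat \<Rightarrow> nat" and xs' :: "nat list"
    assume i: "i < n + n" and I: "xs' = xs \<and> m' 0 1 = i \<and> m' 0 0 = n \<and> m' 0 15 = n + n \<and>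
      (\<forall>l\<le>i. m' 2 l = l * (n + 1)) \<and> m' 4 = (\<lambda>_. 0) \<and> m' 0 14 = 0"
    have v: "val m' (Plus (Ix 2 (V 1)) (Plus (V 0) (N 1))) = (i + 1) * (n + 1)" "val m' (Plus (V 1) (N 1)) = i + 1"
      using I by simp_all
    \<comment> \<open>The offsets are built by repeated addition, as the machine cannot multiply;
      this bounds the largest of them.\<close>
    have "(i + 1) * (n + 1) \<le> (n + n) * (n + 1)" using i by (intro mult_le_mono1) simp
    then have b: "(i + 1) * (n + 1) \<le> B" "i + 1 < S" using S SB i by simp_all
    show "WK (Put 2 (Plus (V 1) (N 1)) (Plus (Ix 2 (V 1)) (Plus (V 0) (N 1)))) (\<lambda>m'a xs'a. m'a 0 1 = i \<and> xs'a = xs \<and>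
      (upd 0 1 (Suc i) m'a) 0 1 = Suc i \<and> (upd 0 1 (Suc i) m'a) 0 0 = n \<and> (upd 0 1 (Suc i) m'a) 0 15 = n + n \<and>
      (\<forall>l\<le>Suc i. (upd 0 1 (Suc i) m'a) 2 l = l * (n + 1)) \<and> (upd 0 1 (Suc i) m'a) 4 = (\<lambda>_. 0) \<and>
      (upd 0 1 (Suc i) m'a) 0 14 = 0) m' xs'"
      by (rule W_Put, unfold v) (use I b in \<open>auto simp: le_Suc_eq\<close>)
  qed (use Q in auto)
  then show ?thesis unfolding head_com_def by (intro W_Seq W_Get W_Put) (simp_all add: hd0_def)
qed

lemma W_rows:
  assumes m: "m 0 0 = n" "m 0 15 = n + n" "\<forall>i\<le>n + n. m 2 i = i * (n + 1)"
    and xs: "xs = concat (map (\<lambda>u. map (\<lambda>v. bn (a u v)) [0..<n]) [0..<n])"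
    and Q: "\<And>m' xs'. frame {1, 2} {1} m m' \<Longrightarrow> (\<forall>i<n. \<forall>j<n. m' 1 (i * (n + 1) + j) = bn (a i j)) \<Longrightarrow> Q m' xs'"
  shows "WK rows_com Q m xs"
  unfolding rows_com_def
proof (rule W_For[where k = n and I = "\<lambda>i m' xs'. xs' = drop (i * n) xs \<and> m' 0 1 = i \<and> frame {1, 2} {1} m m' \<and>
    (\<forall>l<i. \<forall>j<n. m' 1 (l * (n + 1) + j) = bn (a l j))"])
  fix i m' xs' assume i: "i < n" and I: "xs' = drop (i * n) xs \<and> m' 0 1 = i \<and> frame {1, 2} {1} m m' \<and>
    (\<forall>l<i. \<forall>j<n. m' 1 (l * (n + 1) + j) = bn (a l j))"
  let ?R = "\<lambda>m'a xs'a. m'a 0 1 = i \<and> xs'a = drop (Suc i * n) xs \<and> (upd 0 1 (Suc i) m'a) 0 1 = Suc i \<and>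
    frame {1, 2} {1} m (upd 0 1 (Suc i) m'a) \<and> (\<forall>l<Suc i. \<forall>j<n. (upd 0 1 (Suc i) m'a) 1 (l * (n + 1) + j) = bn (a l j))"
  show "WK (For 2 (V 0) (Get 1 (Plus (Ix 2 (V 1)) (V 2)))) ?R m' xs'"
  proof (rule W_For[where k = n and I = "\<lambda>j m'' xs''. xs'' = drop (i * n + j) xs \<and> m'' 0 2 = j \<and> m'' 0 1 = i \<and>
      frame {1, 2} {1} m m'' \<and> (\<forall>l<i. \<forall>j<n. m'' 1 (l * (n + 1) + j) = bn (a l j)) \<and> (\<forall>j'<j. m'' 1 (i * (n + 1) + j') = bn (a i j'))"])
    show "xs' = drop (i * n + 0) xs \<and> (upd 0 2 0 m') 0 2 = 0 \<and> (upd 0 2 0 m') 0 1 = i \<and> frame {1, 2} {1} m (upd 0 2 0 m') \<and>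
      (\<forall>l<i. \<forall>j<n. (upd 0 2 0 m') 1 (l * (n + 1) + j) = bn (a l j)) \<and> (\<forall>j'<0. (upd 0 2 0 m') 1 (i * (n + 1) + j') = bn (a i j'))"
      using I by simp
  next
    fix j m'' xs'' assume J: "xs'' = drop (i * n + j) xs \<and> m'' 0 2 = j \<and> m'' 0 1 = i \<and>
      frame {1, 2} {1} m m'' \<and> (\<forall>l<i. \<forall>j<n. m'' 1 (l * (n + 1) + j) = bn (a l j)) \<and> (\<forall>j'<j. m'' 1 (i * (n + 1) + j') = bn (a i j'))"
    then show "m'' 0 2 = j \<and> val m'' (V 0) = n" using frame_sc[of "{1, 2}" "{1}" m m'' 0] m(1) by auto
  next
    fix j m'' xs'' assume j: "j < n" and J: "xs'' = drop (i * n + j) xs \<and> m'' 0 2 = j \<and> m'' 0 1 = i \<and>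
      frame {1, 2} {1} m m'' \<and> (\<forall>l<i. \<forall>j<n. m'' 1 (l * (n + 1) + j) = bn (a l j)) \<and> (\<forall>j'<j. m'' 1 (i * (n + 1) + j') = bn (a i j'))"
    then have F: "frame {1, 2} {1} m m''" and x: "xs'' = drop (i * n + j) xs" and s: "m'' 0 2 = j" "m'' 0 1 = i"
      and A: "\<forall>l<i. \<forall>j<n. m'' 1 (l * (n + 1) + j) = bn (a l j)" "\<forall>j'<j. m'' 1 (i * (n + 1) + j') = bn (a i j')" by blast+
    have r: "m'' 2 i = i * (n + 1)" using frame_ar[OF F, of 2] m(3) i by simp
    have v: "val m'' (Plus (Ix 2 (V 1)) (V 2)) = i * (n + 1) + j" by (simp only: val.simps s r)
    have "Suc i * n \<le> n * n" using i by (intro mult_le_mono1) simp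
    then have "i * n + j < n * n" using j by simp
    then have len: "i * n + j < length xs" unfolding xs length_concat_rows .
    have h: "hd0 xs'' = bn (a i j)" unfolding x hd0_drop[OF len] unfolding xs by (rule nth_concat_rows[OF i j])
    have t: "tl xs'' = drop (i * n + Suc j) xs" unfolding x by (simp add: drop_Suc tl_drop)
    let ?m = "upd 1 (i * (n + 1) + j) (bn (a i j)) m''"
    have A1: "\<forall>l<i. \<forall>j<n. ?m 1 (l * (n + 1) + j) = bn (a l j)"
    proof (intro allI impI)
      fix l j' assume l: "l < i" "j' < n"
      then have "\<not> (l * (n + 1) + j' = i * (n + 1) + j)" using idx_inj[of j' n j l i] j by simp
      then show "?m 1 (l * (n + 1) + j') = bn (a l j')" using A(1) l by simp
    qed
    have A2: "\<forall>j'<Suc j. ?m 1 (i * (n + 1) + j') = bn (a i j')" using A(2) by (auto simp: less_Suc_eq)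
    let ?T = "\<lambda>m'a xs'a. m'a 0 2 = j \<and> xs'a = drop (i * n + Suc j) xs \<and>
      (upd 0 2 (Suc j) m'a) 0 2 = Suc j \<and> (upd 0 2 (Suc j) m'a) 0 1 = i \<and> frame {1, 2} {1} m (upd 0 2 (Suc j) m'a) \<and>
      (\<forall>l<i. \<forall>j'<n. (upd 0 2 (Suc j) m'a) 1 (l * (n + 1) + j') = bn (a l j')) \<and>
      (\<forall>j'<Suc j. (upd 0 2 (Suc j) m'a) 1 (i * (n + 1) + j') = bn (a i j'))"
    have T: "?T ?m (drop (i * n + Suc j) xs)"
    proof (intro conjI)
      show "\<forall>l<i. \<forall>j'<n. (upd 0 2 (Suc j) ?m) 1 (l * (n + 1) + j') = bn (a l j')" using A1 by simp
      show "\<forall>j'<Suc j. (upd 0 2 (Suc j) ?m) 1 (i * (n + 1) + j') = bn (a i j')" using A2 by simp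
    qed (use s F in simp_all)
    show "WK (Get 1 (Plus (Ix 2 (V 1)) (V 2))) ?T m'' xs''"
    proof (rule W_Get)
      show "hd0 xs'' \<le> B" unfolding h by (rule bn_le_B)
      show "val m'' (Plus (Ix 2 (V 1)) (V 2)) < S" unfolding v by (rule idx_lt) (use i j in auto)
      show "?T (upd 1 (val m'' (Plus (Ix 2 (V 1)) (V 2))) (hd0 xs'') m'') (tl xs'')"
        unfolding v h t by (rule T)
    qed
  next
    fix m'' xs'' assume J: "xs'' = drop (i * n + n) xs \<and> m'' 0 2 = n \<and> m'' 0 1 = i \<and>
      frame {1, 2} {1} m m'' \<and> (\<forall>l<i. \<forall>j<n. m'' 1 (l * (n + 1) + j) = bn (a l j)) \<and> (\<forall>j'<n. m'' 1 (i * (n + 1) + j') = bn (a i j'))"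
    then show "?R m'' xs''" by (auto simp: less_Suc_eq add.commute)
  qed simp_all
next
  fix i m' xs' assume "xs' = drop (i * n) xs \<and> m' 0 1 = i \<and> frame {1, 2} {1} m m' \<and>
    (\<forall>l<i. \<forall>j<n. m' 1 (l * (n + 1) + j) = bn (a l j))"
  then show "m' 0 1 = i \<and> val m' (V 0) = n" using frame_sc[of "{1, 2}" "{1}" m m' 0] m(1) by auto
next
  fix m' xs' assume "xs' = drop (n * n) xs \<and> m' 0 1 = n \<and> frame {1, 2} {1} m m' \<and>
    (\<forall>l<n. \<forall>j<n. m' 1 (l * (n + 1) + j) = bn (a l j))"
  then show "Q m' xs'" using Q by blast
qed simp_all

lemma W_fibs:
  assumes m: "m 0 0 = n"
    and Q: "\<And>m'. frame {1} {7} m m' \<Longrightarrow> (\<forall>i\<le>n. m' 7 i = fib (i + 2)) \<Longrightarrow> Q m' xs"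
  shows "WK fibs_com Q m xs"
proof -
  let ?m = "upd 7 1 2 (upd 7 0 1 m)"
  have "WK (For 1 (V 0) (Put 7 (Plus (V 1) (N 2)) (Plus (Ix 7 (V 1)) (Ix 7 (Plus (V 1) (N 1)))))) Q ?m xs"
  proof (rule W_For[where k = n and I = "\<lambda>i m' xs'. xs' = xs \<and> m' 0 1 = i \<and> frame {1} {7} m m' \<and> (\<forall>l\<le>i + 1. m' 7 l = fib (l + 2))"])
    show "xs = xs \<and> (upd 0 1 0 ?m) 0 1 = 0 \<and> frame {1} {7} m (upd 0 1 0 ?m) \<and> (\<forall>l\<le>0 + 1. (upd 0 1 0 ?m) 7 l = fib (l + 2))"
      by (auto simp: le_Suc_eq numeral_eq_Suc)
  next
    fix i m' xs' assume "xs' = xs \<and> m' 0 1 = i \<and> frame {1} {7} m m' \<and> (\<forall>l\<le>i + 1. m' 7 l = fib (l + 2))"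
    then show "m' 0 1 = i \<and> val m' (V 0) = n" using frame_sc[of "{1}" "{7}" m m' 0] m by auto
  next
    fix i m' xs' assume i: "i < n" and I: "xs' = xs \<and> m' 0 1 = i \<and> frame {1} {7} m m' \<and> (\<forall>l\<le>i + 1. m' 7 l = fib (l + 2))"
    have "m' 7 i = fib (i + 2)" "m' 7 (i + 1) = fib (i + 1 + 2)" using I by (simp_all del: fib.simps)
    moreover have "fib (i + 2) + fib (i + 1 + 2) = fib (i + 2 + 2)" by (simp add: numeral_eq_Suc)
    ultimately have v: "val m' (Plus (Ix 7 (V 1)) (Ix 7 (Plus (V 1) (N 1)))) = fib (i + 2 + 2)" "val m' (Plus (V 1) (N 2)) = i + 2"
      using I by (simp_all del: fib.simps)
    \<comment> \<open>The last round fills entry \<open>n + 1\<close> of the table, whose value is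
      \<open>fib (n + 3)\<close>.\<close>
    have "fib (i + 2 + 2) \<le> fib (n + 3)" using i by (intro fib_mono) simp
    then have b: "fib (i + 2 + 2) \<le> B" "i + 2 < S" using FB S i by simp_all
    have A: "\<forall>l\<le>Suc i + 1. (upd 7 (i + 2) (fib (i + 2 + 2)) m') 7 l = fib (l + 2)"
      using I by (auto simp: le_Suc_eq simp del: fib.simps)
    show "WK (Put 7 (Plus (V 1) (N 2)) (Plus (Ix 7 (V 1)) (Ix 7 (Plus (V 1) (N 1))))) (\<lambda>m'a xs'a. m'a 0 1 = i \<and> xs'a = xs \<and>
      (upd 0 1 (Suc i) m'a) 0 1 = Suc i \<and> frame {1} {7} m (upd 0 1 (Suc i) m'a) \<and>
      (\<forall>l\<le>Suc i + 1. (upd 0 1 (Suc i) m'a) 7 l = fib (l + 2))) m' xs'"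
    proof (rule W_Put, unfold v)
      show "(upd 7 (i + 2) (fib (i + 2 + 2)) m') 0 1 = i \<and> xs' = xs \<and>
        (upd 0 1 (Suc i) (upd 7 (i + 2) (fib (i + 2 + 2)) m')) 0 1 = Suc i \<and>
        frame {1} {7} m (upd 0 1 (Suc i) (upd 7 (i + 2) (fib (i + 2 + 2)) m')) \<and>
        (\<forall>l\<le>Suc i + 1. (upd 0 1 (Suc i) (upd 7 (i + 2) (fib (i + 2 + 2)) m')) 7 l = fib (l + 2))"
        using A I by (simp del: fib.simps)
    qed (use b in auto)
  next
    fix m' xs' assume "xs' = xs \<and> m' 0 1 = n \<and> frame {1} {7} m m' \<and> (\<forall>l\<le>n + 1. m' 7 l = fib (l + 2))"
    then show "Q m' xs'" using Q[of m'] by (simp del: fib.simps)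
  qed simp_all
  moreover have "2 \<le> B" using small(4)[of 2] by simp
  moreover have "1 \<le> B" using small(4)[of 1] by simp
  ultimately show ?thesis unfolding fibs_com_def by (intro W_Seq W_Put) simp_all
qed

section \<open>Choosing the shift and summing the determinants\<close>

definition tcost :: nat where
  "tcost = 5 + (1 + 2 * (n * fib (n + 2))) * (1 + cost L body_com)"

lemma pot_le_B: "pot n a \<rho> j \<le> 2 * fib (n + 2) \<Longrightarrow> pot n a \<rho> j \<le> B"
proof -
  assume "pot n a \<rho> j \<le> 2 * fib (n + 2)"
  moreover have "fib (n + 2) \<le> fib (n + 3)" by (rule fib_mono) simp
  ultimately show ?thesis using FB by linarith
qed

lemma leaf_val_0: "leaf_val a \<rho> 0 = wleaf n a \<rho>"
  by (rule ext) (simp add: leaf_val_def)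

text \<open>Only levels above the last enter the count of visited nodes. While a bit is being
  chosen, these are already bounded by \<open>fib (n + 2)\<close>, even if the bad value of the bit
  doubles the last level.\<close>

lemma tcount_tcost:
  assumes "\<And>j. j < d \<Longrightarrow> pot n a \<rho> j \<le> fib (n + 2)" "d \<le> n"
  shows "tcount (node n a \<rho>) d [] \<le> 1 + 2 * (n * fib (n + 2))"
proof -
  have "tcount (node n a \<rho>) d [] \<le> 1 + 2 * (d * fib (n + 2))" by (rule tcount_bound) (rule assms(1))
  also have "\<dots> \<le> 1 + 2 * (n * fib (n + 2))" using assms(2) mult_le_mono1[of d n "fib (n + 2)"] by linarith
  finally show ?thesis .
qed

lemma shift_at_put: "shift_at \<rho> m \<Longrightarrow> shift_at (\<rho>(t := b)) (upd 4 t (bn b) m)"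
  by (simp add: shift_at_def)

lemma W_sel:
  assumes m: "env n a m" "shift_at \<rho> m" "m 0 14 = 0" "m 0 3 = t" "t < n" "\<forall>j\<le>t. pot n a \<rho> j \<le> fib (n + 2)"
    and Q: "\<And>m' \<rho>'. env n a m' \<Longrightarrow> shift_at \<rho>' m' \<Longrightarrow> m' 0 14 = 0 \<Longrightarrow> m' 0 3 = t \<Longrightarrow>
      \<forall>j\<le>Suc t. pot n a \<rho>' j \<le> fib (n + 2) \<Longrightarrow> Q m' xs"
  shows "W B S (6 + 2 * tcost) sel_com Q m xs"
proof -
  let ?r = "\<lambda>b. \<rho>(t := b)"
  have P: "pot n a (?r b) j \<le> fib (n + 2)" if "j \<le> t" for b j using pot_upd[OF that] m(6) that by simp
  have step: "pot n a (?r 0) (Suc t) + pot n a (?r 1) (Suc t) \<le> 2 * pot n a \<rho> t" by (rule pot_step)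
  \<comment> \<open>The two potentials add up to at most \<open>2 * fib (n + 2)\<close>. Hence each
    fits into a register, and the smaller one is at most \<open>fib (n + 2)\<close>.\<close>
  have two: "pot n a (?r 0) (Suc t) \<le> 2 * fib (n + 2)" "pot n a (?r 1) (Suc t) \<le> 2 * fib (n + 2)"
    "pot n a (?r 0) (Suc t) \<le> fib (n + 2) \<or> pot n a (?r 1) (Suc t) \<le> fib (n + 2)"
    "pot n a (?r 0) (Suc t) \<le> pot n a (?r 1) (Suc t) \<Longrightarrow> pot n a (?r 0) (Suc t) \<le> fib (n + 2)"
    "pot n a (?r 1) (Suc t) \<le> pot n a (?r 0) (Suc t) \<Longrightarrow> pot n a (?r 1) (Suc t) \<le> fib (n + 2)"
    using step m(6)[rule_format, of t] by linarith+
  have P': "\<forall>j\<le>Suc t. pot n a (?r b) j \<le> fib (n + 2)" if "pot n a (?r b) (Suc t) \<le> fib (n + 2)" for b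
    using P that by (auto simp: le_Suc_eq)
  have b1: "1 \<le> B" "t + 1 \<le> B" "t < S" using m(5) S SB by simp_all
  have trav: "W B S tcost trav_com Q' m' xs"
    if "env n a m'" "shift_at (?r b) m'" "m' 0 14 = 0" "m' 0 13 = Suc t" "pot n a (?r b) (Suc t) \<le> 2 * fib (n + 2)"
      "\<And>m''. frame trav_scalars trav_arrays m' m'' \<Longrightarrow> m'' 0 11 = pot n a (?r b) (Suc t) \<Longrightarrow> Q' m'' xs" for Q' m' b
    unfolding tcost_def
  proof (rule W_trav[OF that(1-4)])
    show "Suc t \<le> n" using m(5) by simp
    show "tsum (node n a (?r b)) (leaf_val a (?r b) 0) (Suc t) [] \<le> B"
      using pot_le_B[OF that(5)] unfolding leaf_val_0 pot_def .
    show "tcount (node n a (?r b)) (Suc t) [] \<le> 1 + 2 * (n * fib (n + 2))"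
      by (rule tcount_tcost) (use P m(5) in auto)
    show "Q' m'' xs" if "frame trav_scalars trav_arrays m' m''" "m'' 0 11 = tsum (node n a (?r b)) (leaf_val a (?r b) 0) (Suc t) []" for m''
      using \<open>\<And>m''. frame trav_scalars trav_arrays m' m'' \<Longrightarrow> m'' 0 11 = pot n a (?r b) (Suc t) \<Longrightarrow> Q' m'' xs\<close>[OF that(1)] that(2)
      unfolding leaf_val_0 pot_def .
  qed simp
  note rules = W_Seq_gen W_Put[where L = 0, unfolded cost.simps]
  have "W B S (1 + (1 + (tcost + (1 + (1 + (tcost + (1 + 1))))))) sel_com Q m xs"
    unfolding sel_com_def
  proof (rule W_Seq_gen, rule rules(2))
    let ?m1 = "upd 4 t 0 m"
    have v1: "val m (V 3) = t" using m(4) by simp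
    let ?m2 = "upd 0 13 (t + 1) ?m1"
    have v2: "val ?m1 (Plus (V 3) (N 1)) = t + 1" using m(4) by simp
    have rho2: "shift_at (?r 0) ?m2" using shift_at_put[OF m(2), of t 0] by (simp add: shift_at_def)
    have e2: "env n a ?m2" using m(1) by simp
    show "W B S (1 + (tcost + (1 + (1 + (tcost + (1 + 1)))))) (SetV 13 (Plus (V 3) (N 1)) ;; trav_com ;; SetV 12 (V 11) ;;
     Put 4 (V 3) (N 1) ;; trav_com ;; If (Minus (V 11) (V 12)) (Put 4 (V 3) (N 0)) Skip) Q (upd 4 (val m (V 3)) (val m (N 0)) m) xs"
      unfolding v1 val.simps(1)
    proof (rule W_Seq_gen, rule rules(2), unfold v2)
      show "W B S (tcost + (1 + (1 + (tcost + (1 + 1))))) (trav_com ;; SetV 12 (V 11) ;; Put 4 (V 3) (N 1) ;; trav_com ;;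
        If (Minus (V 11) (V 12)) (Put 4 (V 3) (N 0)) Skip) Q (upd 0 (val ?m1 (N 13)) (t + 1) ?m1) xs"
        unfolding val.simps(1)
      proof (rule W_Seq_gen, rule trav[OF e2 rho2 _ _ two(1)])
        fix m3 assume F3: "frame trav_scalars trav_arrays ?m2 m3" and a3: "m3 0 11 = pot n a (?r 0) (Suc t)"
        have e3: "env n a m3" by (rule frame_env[OF F3 e2]) auto
        have s3: "m3 0 3 = t" "m3 0 13 = Suc t" "m3 0 14 = 0" using frame_sc[OF F3] m(3,4) by auto
        have rho3: "shift_at (?r 0) m3" by (rule shift_at_frame[OF F3 _ rho2]) simp
        let ?m4 = "upd 0 12 (pot n a (?r 0) (Suc t)) m3"
        let ?m5 = "upd 4 t 1 ?m4"
        have v4: "val m3 (V 11) = pot n a (?r 0) (Suc t)" "val ?m4 (V 3) = t" using a3 s3 by simp_all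
        have "(?r 0)(t := 1) = ?r 1" by simp
        then have rho5: "shift_at (?r 1) ?m5" using shift_at_put[OF rho3, of t 1] by (simp add: shift_at_def)
        have e5: "env n a ?m5" using e3 by simp
        show "W B S (1 + (1 + (tcost + (1 + 1)))) (SetV 12 (V 11) ;; Put 4 (V 3) (N 1) ;; trav_com ;;
          If (Minus (V 11) (V 12)) (Put 4 (V 3) (N 0)) Skip) Q m3 xs"
        proof (rule W_Seq_gen, rule rules(2), unfold v4)
          show "pot n a (?r 0) (Suc t) \<le> B" by (rule pot_le_B[OF two(1)])
          show "W B S (1 + (tcost + (1 + 1))) (Put 4 (V 3) (N 1) ;; trav_com ;; If (Minus (V 11) (V 12)) (Put 4 (V 3) (N 0)) Skip)
             Q (upd 0 (val m3 (N 12)) (pot n a (?r 0) (Suc t)) m3) xs"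
            unfolding val.simps(1)
          proof (rule W_Seq_gen, rule rules(2), unfold v4)
            show "W B S (tcost + (1 + 1)) (trav_com ;; If (Minus (V 11) (V 12)) (Put 4 (V 3) (N 0)) Skip)
              Q (upd 4 t (val ?m4 (N 1)) ?m4) xs"
              unfolding val.simps(1)
            proof (rule W_Seq_gen, rule trav[OF e5 rho5 _ _ two(2)])
              show "?m5 0 14 = 0" "?m5 0 13 = Suc t" using s3 by simp_all
              fix m6 assume F6: "frame trav_scalars trav_arrays ?m5 m6" and a6: "m6 0 11 = pot n a (?r 1) (Suc t)"
              have e6: "env n a m6" by (rule frame_env[OF F6 e5]) auto
              have s6: "m6 0 3 = t" "m6 0 14 = 0" "m6 0 12 = pot n a (?r 0) (Suc t)" using frame_sc[OF F6] s3 by auto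
              have rho6: "shift_at (?r 1) m6" by (rule shift_at_frame[OF F6 _ rho5]) simp
              show "W B S (1 + 1) (If (Minus (V 11) (V 12)) (Put 4 (V 3) (N 0)) Skip) Q m6 xs"
              proof (rule W_If_gen)
                assume "0 < val m6 (Minus (V 11) (V 12))"
                then have "pot n a (?r 0) (Suc t) \<le> pot n a (?r 1) (Suc t)" using a6 s6 by simp
                then have P0: "\<forall>j\<le>Suc t. pot n a (?r 0) j \<le> fib (n + 2)" by (intro P' two(4))
                have "(?r 1)(t := 0) = ?r 0" by simp
                then have "shift_at (?r 0) (upd 4 t 0 m6)" using shift_at_put[OF rho6, of t 0] by (simp add: shift_at_def)
                then have "Q (upd 4 t 0 m6) xs" by (intro Q[OF _ _ _ _ P0]) (use e6 s6 in simp_all)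
                then show "W B S 1 (Put 4 (V 3) (N 0)) Q m6 xs"
                  by (intro rules(2)) (use s6 b1 in simp_all)
              next
                assume "val m6 (Minus (V 11) (V 12)) = 0"
                then have "pot n a (?r 1) (Suc t) \<le> pot n a (?r 0) (Suc t)" using a6 s6 by simp
                then have P1: "\<forall>j\<le>Suc t. pot n a (?r 1) j \<le> fib (n + 2)" by (intro P' two(5))
                have "Q m6 xs" by (rule Q[OF e6 rho6 s6(2,1) P1])
                then have "W B S 0 Skip Q m6 xs" by - (rule W_Skip[where L = 0, unfolded cost.simps])
                then show "W B S 1 Skip Q m6 xs" by (rule W_conseq) simp_all
              qed
            qed
          qed (use b1 in simp_all)
        qed simp
      qed (use m(3,4) in simp_all)
    qed (use b1 in simp_all)
  qed (use b1 m(4) in simp_all)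
  then show ?thesis by (rule W_conseq) simp_all
qed


lemma W_final:
  assumes G: "pair_fin_digraph G" "pverts G = {0..<n}"
    and m: "env n (adj G) m" "shift_at \<rho> m" "\<forall>j\<le>n. pot n (adj G) \<rho> j \<le> fib (n + 2)"
    and Q: "\<And>m'. m' 0 11 = card (hamiltonian_cycles G) mod 2 \<Longrightarrow> Q m' xs"
  shows "W B S (4 + tcost + 2 * fib (n + 2)) final_com Q m xs"
proof -
  let ?a = "adj G"
  let ?T = "tsum (node n ?a \<rho>) (leaf_val ?a \<rho> 1) n []"
  note rules = W_Seq_gen W_Put[where L = 0, unfolded cost.simps]
  \<comment> \<open>Leaves contribute 0 or 1, so the sum is at most the number of nonempty nodes on
    level \<open>n\<close>.\<close>
  have T: "?T \<le> fib (n + 2)"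
  proof -
    have "?T \<le> tsum (node n ?a \<rho>) (\<lambda>_. 1) n []" by (rule tsum_mono) (simp add: leaf_val_def dleaf_def)
    also have "\<dots> \<le> pot n ?a \<rho> n" by (rule level_le_pot)
    also have "\<dots> \<le> fib (n + 2)" using m(3) by simp
    finally show ?thesis .
  qed
  have fB: "fib (n + 2) \<le> B"
  proof -
    have "fib (n + 2) \<le> fib (n + 3)" by (rule fib_mono) simp
    then show ?thesis using FB by linarith
  qed
  have "W B S (1 + (1 + (1 + (tcost + (1 + fib (n + 2) * (1 + 1)))))) final_com Q m xs"
    unfolding final_com_def
  proof (rule W_If_gen)
    assume "0 < val m (V 0)"
    then have n: "0 < n" using envD(1)[OF m(1)] by simp
    let ?m = "upd 0 13 n (upd 0 14 1 m)"
    let ?wh = "While (Minus (V 11) (N 1)) (SetV 11 (Minus (V 11) (N 2)))"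
    have trav: "W B S tcost trav_com (\<lambda>m' xs'. W B S (1 + fib (n + 2) * (1 + 1)) ?wh Q m' xs') ?m xs"
      unfolding tcost_def
    proof (rule W_trav)
      show "env n ?a ?m" "shift_at \<rho> ?m" "?m 0 14 = 1" "?m 0 13 = n" using m(1,2) by (simp_all add: shift_at_def)
      show "?T \<le> B" using T fB by simp
      show "tcount (node n ?a \<rho>) n [] \<le> 1 + 2 * (n * fib (n + 2))"
        by (rule tcount_tcost) (use m(3) in auto)
      fix m1 :: "nat \<Rightarrow> nat \<Rightarrow> nat" assume a1: "m1 0 11 = ?T"
      have par: "?T mod 2 = card (hamiltonian_cycles G) mod 2"
      proof -
        have "leaf_val ?a \<rho> 1 = dleaf n ?a \<rho>" by (rule ext) (simp add: leaf_val_def)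
        then show ?thesis using tsum_dleaf_parity[OF G n, of \<rho>] by simp
      qed
      have "W B S (1 + m1 0 11 * (1 + 1)) ?wh Q m1 xs"
      proof (rule W_While[where I = "\<lambda>m' xs'. xs' = xs \<and> m' 0 11 mod 2 = ?T mod 2 \<and> m' 0 11 \<le> B" and f = "\<lambda>m'. m' 0 11"])
        show "xs = xs \<and> m1 0 11 mod 2 = ?T mod 2 \<and> m1 0 11 \<le> B" using a1 T fB by simp
      next
        fix m' xs' assume I: "xs' = xs \<and> m' 0 11 mod 2 = ?T mod 2 \<and> m' 0 11 \<le> B" and pos: "0 < val m' (Minus (V 11) (N 1))"
        have ge: "2 \<le> m' 0 11" using pos by simp
        then have "(m' 0 11 - 2) mod 2 = ?T mod 2" using I by (metis le_mod_geq)
        moreover have "m' 0 11 - 2 \<le> B" using I by linarith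
        ultimately show "0 < m' 0 11 \<and> W B S 1 (SetV 11 (Minus (V 11) (N 2)))
          (\<lambda>m'a xs'. (xs' = xs \<and> m'a 0 11 mod 2 = ?T mod 2 \<and> m'a 0 11 \<le> B) \<and> m'a 0 11 < m' 0 11) m' xs'"
          using I ge by (intro conjI rules(2)) simp_all
      next
        fix m' xs' assume I: "xs' = xs \<and> m' 0 11 mod 2 = ?T mod 2 \<and> m' 0 11 \<le> B" and z: "val m' (Minus (V 11) (N 1)) = 0"
        have "m' 0 11 = m' 0 11 mod 2" using z by simp
        then have "m' 0 11 = card (hamiltonian_cycles G) mod 2" using I par by simp
        then show "Q m' xs'" using Q I by simp
      qed
      then show "W B S (1 + fib (n + 2) * (1 + 1)) ?wh Q m1 xs"
        by (rule W_conseq) (use a1 T in simp_all)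
    qed simp_all
    show "W B S (1 + (1 + (tcost + (1 + fib (n + 2) * (1 + 1))))) (SetV 14 (N 1) ;; SetV 13 (V 0) ;; trav_com ;; ?wh) Q m xs"
    proof (rule rules(1), rule rules(2), unfold val.simps(1))
      show "1 \<le> B" using small(4)[of 1] by simp
      show "W B S (1 + (tcost + (1 + fib (n + 2) * (1 + 1)))) (SetV 13 (V 0) ;; trav_com ;; ?wh) Q (upd 0 14 1 m) xs"
      proof (rule rules(1), rule rules(2))
        have v: "val (upd 0 14 1 m) (V 0) = n" using envD(1)[OF m(1)] by simp
        show "val (upd 0 14 1 m) (V 0) \<le> B" unfolding v by simp
        show "W B S (tcost + (1 + fib (n + 2) * (1 + 1))) (trav_com ;; ?wh) Q (upd 0 (val (upd 0 14 1 m) (N 13)) (val (upd 0 14 1 m) (V 0)) (upd 0 14 1 m)) xs"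
          unfolding v val.simps(1) by (rule rules(1)) (rule trav)
      qed simp
    qed simp
  next
    assume "val m (V 0) = 0"
    then have n: "n = 0" using envD(1)[OF m(1)] by simp
    have "hamiltonian_cycles G = {}"
      unfolding hamiltonian_cycles_def using n G(2) by (auto simp: pre_digraph.cycle_def)
    then have "Q (upd 0 11 0 m) xs" by (intro Q) simp
    then have "W B S 1 (SetV 11 (N 0)) Q m xs" by (intro rules(2)) simp_all
    then show "W B S (1 + (1 + (tcost + (1 + fib (n + 2) * (1 + 1))))) (SetV 11 (N 0)) Q m xs"
      by (rule W_conseq) simp_all
  qed
  then show ?thesis by (rule W_conseq) simp_all
qed

definition mcost :: nat where
  "mcost = cost L head_com + cost L rows_com + cost L fibs_com + (2 + n * (8 + 2 * tcost)) + (4 + tcost + 2 * fib (n + 2))"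

lemma W_main:
  assumes G: "pair_fin_digraph G" "pverts G = {0..<n}"
  shows "W B S mcost main_com (\<lambda>m _. m 0 11 = card (hamiltonian_cycles G) mod 2) (\<lambda>_ _. 0) (graph_input n G)"
proof -
  let ?a = "adj G"
  let ?Q = "\<lambda>m (_ :: nat list). m 0 11 = card (hamiltonian_cycles G) mod 2"
  let ?xs = "concat (map (\<lambda>u. map (\<lambda>v. bn (?a u v)) [0..<n]) [0..<n])"
  let ?KS = "2 + n * (2 + (6 + 2 * tcost))" and ?KF = "4 + tcost + 2 * fib (n + 2)"
  have inp: "graph_input n G = n # ?xs"
  proof -
    have "bn (?a u v) = (if (u, v) \<in> parcs G then 1 else 0)" for u v
      by (cases "(u, v) \<in> parcs G") (simp_all add: adj_def)
    then show ?thesis unfolding graph_input_def by simp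
  qed
  have sel: "W B S ?KS (For 3 (V 0) sel_com) (\<lambda>m xs. W B S ?KF final_com ?Q m xs) m xs"
    if m: "env n ?a m" "m 4 = (\<lambda>_. 0)" "m 0 14 = 0" for m xs
  proof (rule W_For_gen[where k = n and I = "\<lambda>t m' xs'. env n ?a m' \<and> m' 0 14 = 0 \<and> m' 0 3 = t \<and>
      (\<exists>\<rho>. shift_at \<rho> m' \<and> (\<forall>j\<le>t. pot n ?a \<rho> j \<le> fib (n + 2)))"])
    have "shift_at (\<lambda>_. 0) (upd 0 3 0 m)" using m(2) by (simp add: shift_at_def)
    then show "env n ?a (upd 0 3 0 m) \<and> (upd 0 3 0 m) 0 14 = 0 \<and> (upd 0 3 0 m) 0 3 = 0 \<and>
      (\<exists>\<rho>. shift_at \<rho> (upd 0 3 0 m) \<and> (\<forall>j\<le>0. pot n ?a \<rho> j \<le> fib (n + 2)))"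
      using m pot_0[of n ?a] by (auto simp del: fib.simps)
  next
    fix t m' xs' assume "env n ?a m' \<and> m' 0 14 = 0 \<and> m' 0 3 = t \<and> (\<exists>\<rho>. shift_at \<rho> m' \<and> (\<forall>j\<le>t. pot n ?a \<rho> j \<le> fib (n + 2)))"
    then show "m' 0 3 = t \<and> val m' (V 0) = n" using envD(1)[of n ?a m'] by auto
  next
    fix t m' xs' assume t: "t < n" and "env n ?a m' \<and> m' 0 14 = 0 \<and> m' 0 3 = t \<and> (\<exists>\<rho>. shift_at \<rho> m' \<and> (\<forall>j\<le>t. pot n ?a \<rho> j \<le> fib (n + 2)))"
    then obtain \<rho> where I: "env n ?a m'" "shift_at \<rho> m'" "m' 0 14 = 0" "m' 0 3 = t" "\<forall>j\<le>t. pot n ?a \<rho> j \<le> fib (n + 2)" by blast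
    show "W B S (6 + 2 * tcost) sel_com (\<lambda>m'a xs'. m'a 0 3 = t \<and> env n ?a (upd 0 3 (Suc t) m'a) \<and>
        (upd 0 3 (Suc t) m'a) 0 14 = 0 \<and> (upd 0 3 (Suc t) m'a) 0 3 = Suc t \<and>
        (\<exists>\<rho>. shift_at \<rho> (upd 0 3 (Suc t) m'a) \<and> (\<forall>j\<le>Suc t. pot n ?a \<rho> j \<le> fib (n + 2)))) m' xs'"
    proof (rule W_sel[OF I(1-4) t I(5)])
      fix m2 \<rho>' assume A: "env n ?a m2" "shift_at \<rho>' m2" "m2 0 14 = 0" "m2 0 3 = t" "\<forall>j\<le>Suc t. pot n ?a \<rho>' j \<le> fib (n + 2)"
      have "shift_at \<rho>' (upd 0 3 (Suc t) m2)" using A(2) by (simp add: shift_at_def)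
      then have "\<exists>\<rho>. shift_at \<rho> (upd 0 3 (Suc t) m2) \<and> (\<forall>j\<le>Suc t. pot n ?a \<rho> j \<le> fib (n + 2))" using A(5) by blast
      then show "m2 0 3 = t \<and> env n ?a (upd 0 3 (Suc t) m2) \<and>
        (upd 0 3 (Suc t) m2) 0 14 = 0 \<and> (upd 0 3 (Suc t) m2) 0 3 = Suc t \<and>
        (\<exists>\<rho>. shift_at \<rho> (upd 0 3 (Suc t) m2) \<and> (\<forall>j\<le>Suc t. pot n ?a \<rho> j \<le> fib (n + 2)))"
        using A(1,3,4) by simp
    qed
  next
    fix m' xs' assume "env n ?a m' \<and> m' 0 14 = 0 \<and> m' 0 3 = n \<and> (\<exists>\<rho>. shift_at \<rho> m' \<and> (\<forall>j\<le>n. pot n ?a \<rho> j \<le> fib (n + 2)))"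
    then obtain \<rho> where I: "env n ?a m'" "shift_at \<rho> m'" "\<forall>j\<le>n. pot n ?a \<rho> j \<le> fib (n + 2)" by blast
    show "W B S ?KF final_com ?Q m' xs'" by (rule W_final[OF G I]) simp
  qed simp_all
  have fibs: "WK fibs_com (\<lambda>m xs. W B S (?KS + ?KF) (For 3 (V 0) sel_com ;; final_com) ?Q m xs) m2 xs"
    if m: "m2 0 0 = n" "m2 0 15 = n + n" "\<forall>i\<le>n + n. m2 2 i = i * (n + 1)" "m2 4 = (\<lambda>_. 0)" "m2 0 14 = 0"
      "\<forall>i<n. \<forall>j<n. m2 1 (i * (n + 1) + j) = bn (?a i j)" for m2 xs
  proof (rule W_fibs, rule m(1))
    fix m3 assume F: "frame {1} {7} m2 m3" and fb: "\<forall>i\<le>n. m3 7 i = fib (i + 2)"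
    have "env n ?a m3" unfolding env_def using fb frame_sc[OF F] frame_ar[OF F] m by (simp del: fib.simps)
    moreover have "m3 4 = (\<lambda>_. 0)" "m3 0 14 = 0" using frame_sc[OF F] frame_ar[OF F] m by simp_all
    ultimately show "W B S (?KS + ?KF) (For 3 (V 0) sel_com ;; final_com) ?Q m3 xs"
      by (intro W_Seq_gen sel)
  qed
  have "W B S (cost L head_com + (cost L rows_com + (cost L fibs_com + (?KS + ?KF)))) main_com ?Q (\<lambda>_ _. 0) (n # ?xs)"
    unfolding main_com_def
  proof (rule W_Seq_gen, rule W_head)
    fix m1 :: "nat \<Rightarrow> nat \<Rightarrow> nat" assume m: "m1 0 0 = n" "m1 0 15 = n + n" "\<forall>i\<le>n + n. m1 2 i = i * (n + 1)" "m1 4 = (\<lambda>_. 0)" "m1 0 14 = 0"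
    show "W B S (cost L rows_com + (cost L fibs_com + (?KS + ?KF))) (rows_com ;; fibs_com ;; For 3 (V 0) sel_com ;; final_com) ?Q m1 ?xs"
    proof (rule W_Seq_gen, rule W_rows[OF m(1-3) refl])
      fix m2 xs assume F: "frame {1, 2} {1} m1 m2" and A: "\<forall>i<n. \<forall>j<n. m2 1 (i * (n + 1) + j) = bn (?a i j)"
      have "m2 0 0 = n" "m2 0 15 = n + n" "m2 0 14 = 0" using frame_sc[OF F] m by simp_all
      moreover have "m2 2 = m1 2" "m2 4 = m1 4" using frame_ar[OF F] by simp_all
      ultimately show "W B S (cost L fibs_com + (?KS + ?KF)) (fibs_com ;; For 3 (V 0) sel_com ;; final_com) ?Q m2 xs"
        by (intro W_Seq_gen fibs) (use m A in simp_all)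
    qed
  qed
  then show ?thesis unfolding inp mcost_def by (rule W_conseq) simp_all
qed

end

section \<open>Polynomial bounds and the main theorem\<close>

definition parity_com :: com where
  "parity_com = main_com ;; Out (V 11)"

lemma cwf_parity_com: "cwf parity_com"
  by (simp add: parity_com_def main_com_def final_com_def sel_com_def trav_com_def
      body_com_def leaf_com_def adv_com_def detb_com_def drow_com_def
      build_com_def copy_com_def clear_com_def elim_com_def col_com_def
      row_com_def head_com_def rows_com_def fibs_com_def For_def)

definition poly_bounded :: "(nat \<Rightarrow> nat) \<Rightarrow> bool" where
  "poly_bounded f \<longleftrightarrow> (\<exists>p :: nat poly. \<forall>n. f n \<le> poly p n)"

lemma poly_bounded_const: "poly_bounded (\<lambda>_. c)"
  unfolding poly_bounded_def by (intro exI[of _ "[:c:]"]) simp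

lemma poly_bounded_id: "poly_bounded (\<lambda>n. n)"
  unfolding poly_bounded_def by (intro exI[of _ "[:0, 1:]"]) simp

lemma poly_bounded_add: "poly_bounded f \<Longrightarrow> poly_bounded g \<Longrightarrow> poly_bounded (\<lambda>n. f n + g n)"
  unfolding poly_bounded_def
proof (elim exE)
  fix p q :: "nat poly" assume "\<forall>n. f n \<le> poly p n" "\<forall>n. g n \<le> poly q n"
  then show "\<exists>p. \<forall>n. f n + g n \<le> poly p n" by (intro exI[of _ "p + q"]) (simp add: add_mono)
qed

lemma poly_bounded_mult: "poly_bounded f \<Longrightarrow> poly_bounded g \<Longrightarrow> poly_bounded (\<lambda>n. f n * g n)"
  unfolding poly_bounded_def
proof (elim exE)
  fix p q :: "nat poly" assume "\<forall>n. f n \<le> poly p n" "\<forall>n. g n \<le> poly q n"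
  then show "\<exists>p. \<forall>n. f n * g n \<le> poly p n" by (intro exI[of _ "p * q"]) (simp add: mult_le_mono)
qed

lemma poly_bounded_cost: "poly_bounded (\<lambda>n. cost (n + n + 2) c)"
proof -
  obtain p :: "nat poly" where "\<forall>L. cost L c = poly p L" using cost_poly by blast
  then show ?thesis unfolding poly_bounded_def by (intro exI[of _ "pcompose p [:2, 2:]"]) (simp add: poly_pcompose mult_2_right)
qed

lemmas poly_bounded_intros = poly_bounded_add poly_bounded_mult poly_bounded_cost poly_bounded_const poly_bounded_id

lemma bitsize_le: "x \<le> 2 ^ k \<Longrightarrow> bitsize x \<le> k + 1"
proof -
  assume "x \<le> 2 ^ k"
  then have "floorlog 2 x \<le> floorlog 2 (2 ^ k)" by (rule floorlog_mono)
  also have "floorlog 2 (2 ^ k :: nat) = k + 1" by (simp add: floorlog_def log_nat_power)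
  finally show ?thesis by (simp add: bitsize_def)
qed

lemma bitsize_le_Suc: "bitsize x \<le> x + 1"
  by (rule bitsize_le) (rule less_imp_le[OF less_exp])

lemma fib_le_power2: "fib k \<le> 2 ^ k"
  by (induction k rule: fib.induct) auto

text \<open>Turns the natural bound of the search into one in terms of \<open>fib n\<close>. It
  fails at 0, where \<open>fib 0 = 0\<close>; the time bound is claimed for positive
  \<open>n\<close> for this reason.\<close>

lemma fib_add_2_le: "1 \<le> n \<Longrightarrow> fib (n + 2) \<le> 3 * fib n"
proof -
  assume "1 \<le> n"
  then obtain k where n: "n = Suc k" by (cases n) auto
  have "fib k \<le> fib (Suc k)" by (rule fib_mono) simp
  then show ?thesis unfolding n by simp
qed

lemma fib_bigo: "(\<lambda>n. real (fib n)) \<in> O(\<lambda>n. 1.619 ^ n)"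
proof (rule landau_o.bigI[of 1])
  have "real (fib n) \<le> 1.619 ^ n" for n
  proof (induction n rule: fib.induct)
    case (3 n)
    have "real (fib (Suc (Suc n))) \<le> 1.619 ^ Suc n + 1.619 ^ n" using 3 by simp
    also have "\<dots> = 2.619 * 1.619 ^ n" by simp
    \<comment> \<open>1.619 lies just above the golden ratio, so its square is at least 1.619 +
      1.\<close>
    also have "\<dots> \<le> (1.619 * 1.619) * 1.619 ^ n" by (rule mult_right_mono) simp_all
    finally show ?case by simp
  qed simp_all
  then show "\<forall>\<^sub>F n in at_top. norm (real (fib n)) \<le> 1 * norm (1.619 ^ n :: real)" by simp
qed simp

theorem theorem1:
  shows "(\<exists>(P :: instr list) (p :: nat poly) (q :: nat poly).
            \<forall>(n :: nat) (G :: nat pair_pre_digraph).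
              pair_fin_digraph G \<and> pverts G = {0..<n} \<longrightarrow>
              (\<exists>t. halted P (run P (graph_input n G) t) \<and>
                   out (run P (graph_input n G) t) = [card (hamiltonian_cycles G) mod 2] \<and>
                   (n \<ge> 1 \<longrightarrow> time_used P (graph_input n G) t \<le> poly p n * fib n) \<and>
                   space_used P (graph_input n G) t \<le> poly q n))
         \<and> (\<lambda>n. real (fib n)) \<in> O(\<lambda>n. 1.619 ^ n)"
proof
  let ?c = parity_com
  let ?P = "comp 0 ?c"
  define S where "S n = (n + n) * (n + 1) + n + 30" for n :: nat
  \<comment> \<open>A power of 2, so that register lengths are linear in \<open>n\<close>. The
    exponent leaves room for the quadratic \<open>S n\<close> and for
    \<open>4 * fib (n + 3)\<close>, which is at most \<open>2 ^ (n + 5)\<close>.\<close>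
  define B where "B n = (2::nat) ^ (n + n + 8)" for n :: nat
  define A where "A n = 16 * (S n + csize ?c)" for n
  define X where "X n = cmag ?c * (B n + 1)" for n
  define kb where "kb n = cost (n + n + 2) body_com" for n
  \<comment> \<open>\<open>tc\<close> and \<open>R\<close> are the cofactors of
    \<open>fib (n + 2)\<close> in bounds for \<open>tcost\<close> and \<open>mcost + 1\<close>; the
    1 is the output command. The 3 in \<open>Tm\<close> pays for passing from
    \<open>fib (n + 2)\<close> to \<open>fib n\<close>, and its last factor bounds the logarithmic
    cost of one instruction.\<close>
  define tc where "tc n = 5 + (1 + 2 * n) * (1 + kb n)" for n
  define R where "R n = cost (n + n + 2) head_com + cost (n + n + 2) rows_com + cost (n + n + 2) fibs_com
    + (2 + n * (8 + 2 * tc n)) + (6 + tc n) + 1" for n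
  define Tm where "Tm n = clen ?c * (3 * R n) * (2 * (cmag ?c + n + n + 10))" for n
  define Sp where "Sp n = A n * (A n + 1 + (cmag ?c + n + n + 10))" for n
  have bnd: "bounds n (B n) (S n) (n + n + 2)" for n
  proof
    show "S n = (n + n) * (n + 1) + n + 30" by (rule S_def)
    show "S n \<le> B n"
    proof (induction n)
      case (Suc n)
      have "n < 2 ^ n" by (rule less_exp)
      moreover have "(2::nat) ^ n \<le> 2 ^ (n + n)" by (rule power_increasing) simp_all
      ultimately have "n \<le> 2 ^ (n + n)" by linarith
      moreover have "B n = 256 * 2 ^ (n + n)" unfolding B_def by (subst power_add) (simp only: mult.commute, simp)
      moreover have "(1::nat) \<le> 2 ^ (n + n)" by (rule one_le_power) simp
      ultimately have "4 * n + 5 \<le> B n" by linarith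
      moreover have "S (Suc n) = S n + (4 * n + 5)" by (simp add: S_def algebra_simps)
      moreover have "B (Suc n) = 4 * B n" by (simp add: B_def power_add)
      ultimately show ?case using Suc by linarith
    qed (simp add: S_def B_def)
    have "4 * fib (n + 3) \<le> 4 * 2 ^ (n + 3)" by (intro mult_le_mono2 fib_le_power2)
    also have "\<dots> = 2 ^ (n + 5)" by (simp add: power_add)
    also have "\<dots> \<le> B n" unfolding B_def by (rule power_increasing) simp_all
    finally show "4 * fib (n + 3) \<le> B n" .
  qed simp
  have bX: "bitsize (X n) \<le> cmag ?c + n + n + 10" for n
  proof -
    have "cmag ?c \<le> 2 ^ cmag ?c" by (rule less_imp_le[OF less_exp])
    moreover have "B n + 1 \<le> 2 ^ (n + n + 9)" using one_le_power[of "2 :: nat" "n + n"] unfolding B_def power_add by simp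
    ultimately have "X n \<le> 2 ^ cmag ?c * 2 ^ (n + n + 9)" unfolding X_def by (rule mult_le_mono)
    also have "\<dots> = 2 ^ (cmag ?c + (n + n + 9))" by (rule power_add[symmetric])
    finally have "bitsize (X n) \<le> cmag ?c + (n + n + 9) + 1" by (rule bitsize_le)
    then show ?thesis by simp
  qed
  have main: "\<exists>t. halted ?P (run ?P (graph_input n G) t) \<and>
      out (run ?P (graph_input n G) t) = [card (hamiltonian_cycles G) mod 2] \<and>
      (n \<ge> 1 \<longrightarrow> time_used ?P (graph_input n G) t \<le> Tm n * fib n) \<and>
      space_used ?P (graph_input n G) t \<le> Sp n"
    if G: "pair_fin_digraph G" "pverts G = {0..<n}" for n G
  proof -
    interpret bounds n "B n" "S n" "n + n + 2" by (rule bnd)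
    let ?F = "fib (n + 2)"
    have "mm (init (graph_input n G)) = (\<lambda>_ _. 0) \<and> ins (init (graph_input n G)) = graph_input n G" by (simp add: init_def)
    with W_main[OF G] obtain s1 where s1: "ev (B n) (S n) main_com (init (graph_input n G)) s1"
      "mm s1 0 11 = card (hamiltonian_cycles G) mod 2" "outs s1 = []" "tm s1 \<le> mcost"
      unfolding W_def by (fastforce simp: init_def)
    let ?s = "(tick s1)\<lparr>outs := outs s1 @ [val (mm s1) (V 11)]\<rparr>"
    have ev: "ev (B n) (S n) ?c (init (graph_input n G)) ?s"
      unfolding parity_com_def by (rule ev.Seq[OF s1(1) ev.Out])
    have inB: "\<forall>x\<in>set (graph_input n G). x \<le> B n"
      using small(4)[of 1] small(5) by (auto simp: graph_input_def)
    obtain t where t: "halted ?P (run ?P (graph_input n G) t)" "out (run ?P (graph_input n G) t) = outs ?s"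
      "time_used ?P (graph_input n G) t \<le> clen ?c * tm ?s * (2 * bitsize (X n))"
      "space_used ?P (graph_input n G) t \<le> A n * (bitsize (A n) + bitsize (X n))"
      using run_correct[OF ev cwf_parity_com inB refl X_def A_def] by blast
    have F1: "1 \<le> ?F" using fib_neq_0_nat[of "n + 2"] by linarith
    have tcF: "tcost \<le> tc n * ?F"
    proof -
      have "1 + 2 * (n * ?F) \<le> (1 + 2 * n) * ?F" using F1 by (simp add: algebra_simps del: fib.simps)
      then have "(1 + 2 * (n * ?F)) * (1 + kb n) \<le> (1 + 2 * n) * ?F * (1 + kb n)" by (rule mult_le_mono1)
      moreover have "5 \<le> 5 * ?F" using F1 by linarith
      ultimately have "tcost \<le> 5 * ?F + (1 + 2 * n) * ?F * (1 + kb n)" unfolding tcost_def kb_def by linarith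
      also have "\<dots> = tc n * ?F" unfolding tc_def by (simp add: algebra_simps del: fib.simps)
      finally show ?thesis .
    qed
    have c1: "c \<le> c * ?F" for c using F1 by (simp del: fib.simps)
    have "tm ?s \<le> R n * ?F"
    proof -
      have "tm ?s \<le> mcost + 1" using s1(4) by simp
      moreover have "n * (8 + 2 * tcost) \<le> n * (8 + 2 * tc n) * ?F"
      proof -
        have "8 + 2 * tcost \<le> (8 + 2 * tc n) * ?F" using tcF c1[of 8] by (simp add: algebra_simps del: fib.simps)
        then show ?thesis using mult_le_mono2[of _ _ n] by (simp only: mult.assoc)
      qed
      moreover have "mcost + 1 \<le> R n * ?F"
        if le: "n * (8 + 2 * tcost) \<le> n * (8 + 2 * tc n) * ?F"
      proof -
        have le2: "4 + tcost + 2 * ?F \<le> 6 * ?F + tc n * ?F" using tcF F1 by linarith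
        show ?thesis unfolding mcost_def R_def distrib_right
          by (rule add_mono[OF add_mono[OF add_mono[OF add_mono[OF add_mono[OF c1 c1] c1] add_mono[OF c1 le]] le2] c1])
      qed
      ultimately show ?thesis by linarith
    qed
    then have "clen ?c * tm ?s * (2 * bitsize (X n)) \<le> clen ?c * (R n * ?F) * (2 * (cmag ?c + n + n + 10))"
      by (intro mult_le_mono mult_le_mono2 bX) simp_all
    then have "time_used ?P (graph_input n G) t \<le> clen ?c * (R n * ?F) * (2 * (cmag ?c + n + n + 10))"
      using t(3) by linarith
    moreover have "clen ?c * (R n * ?F) * (2 * (cmag ?c + n + n + 10)) \<le> Tm n * fib n" if "1 \<le> n"
    proof -
      have "R n * ?F \<le> R n * (3 * fib n)" by (intro mult_le_mono2 fib_add_2_le that)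
      then have "clen ?c * (R n * ?F) * (2 * (cmag ?c + n + n + 10)) \<le> clen ?c * (R n * (3 * fib n)) * (2 * (cmag ?c + n + n + 10))"
        by (rule mult_le_mono1[OF mult_le_mono2])
      also have "\<dots> = Tm n * fib n" unfolding Tm_def by (simp only: mult_ac)
      finally show ?thesis .
    qed
    ultimately have "n \<ge> 1 \<longrightarrow> time_used ?P (graph_input n G) t \<le> Tm n * fib n" by (meson le_trans)
    moreover have "space_used ?P (graph_input n G) t \<le> Sp n"
    proof -
      have "A n * (bitsize (A n) + bitsize (X n)) \<le> Sp n"
        unfolding Sp_def by (intro mult_le_mono2 add_mono bitsize_le_Suc bX)
      then show ?thesis using t(4) by linarith
    qed
    ultimately show ?thesis using t(1,2) s1(2,3) by (intro exI[of _ t]) simp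
  qed
  have "poly_bounded Tm" unfolding Tm_def R_def tc_def kb_def by (intro poly_bounded_intros)
  then obtain p :: "nat poly" where p: "\<And>n. Tm n \<le> poly p n" unfolding poly_bounded_def by blast
  have "poly_bounded Sp" unfolding Sp_def A_def S_def by (intro poly_bounded_intros)
  then obtain q :: "nat poly" where q: "\<And>n. Sp n \<le> poly q n" unfolding poly_bounded_def by blast
  show "\<exists>(P :: instr list) (p :: nat poly) (q :: nat poly).
            \<forall>(n :: nat) (G :: nat pair_pre_digraph).
              pair_fin_digraph G \<and> pverts G = {0..<n} \<longrightarrow>
              (\<exists>t. halted P (run P (graph_input n G) t) \<and>
                   out (run P (graph_input n G) t) = [card (hamiltonian_cycles G) mod 2] \<and>
                   (n \<ge> 1 \<longrightarrow> time_used P (graph_input n G) t \<le> poly p n * fib n) \<and>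
                   space_used P (graph_input n G) t \<le> poly q n)"
  proof (rule exI[of _ ?P], rule exI[of _ p], rule exI[of _ q], intro allI impI)
    fix n and G :: "nat pair_pre_digraph"
    assume G: "pair_fin_digraph G \<and> pverts G = {0..<n}"
    then obtain t where t: "halted ?P (run ?P (graph_input n G) t)"
      "out (run ?P (graph_input n G) t) = [card (hamiltonian_cycles G) mod 2]"
      "n \<ge> 1 \<longrightarrow> time_used ?P (graph_input n G) t \<le> Tm n * fib n"
      "space_used ?P (graph_input n G) t \<le> Sp n" using main by blast
    have "Tm n * fib n \<le> poly p n * fib n" by (intro mult_le_mono1 p)
    then have "n \<ge> 1 \<longrightarrow> time_used ?P (graph_input n G) t \<le> poly p n * fib n" using t(3) by (meson le_trans)
    moreover have "space_used ?P (graph_input n G) t \<le> poly q n" using t(4) q[of n] by linarith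
    ultimately show "\<exists>t. halted ?P (run ?P (graph_input n G) t) \<and>
                   out (run ?P (graph_input n G) t) = [card (hamiltonian_cycles G) mod 2] \<and>
                   (n \<ge> 1 \<longrightarrow> time_used ?P (graph_input n G) t \<le> poly p n * fib n) \<and>
                   space_used ?P (graph_input n G) t \<le> poly q n"
      using t(1,2) by blast
  qed
qed (rule fib_bigo)

end
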